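(* Let $K,P,L\ge 1$ be integers, let $\mathcal{X}\subseteq\mathbb{R}^P$, let $\{F_0(\cdot;\psi):\psi\in\Psi_0\}$ be a family of probability distribution functions on $\mathbb{R}^K$, and let $\Phi_1,\dots,\Phi_L$ be probability distribution functions on $\mathbb{R}$. Assume: (i) (denseness condition on the expert function) for every $q\in\mathbb{R}^K$ there is a sequence $(\psi^{(n)}(q))_{n\ge1}$ in $\Psi_0$ such that $F_0(\cdot;\psi^{(n)}(q))$ converges weakly, as $n\to\infty$, to the point mass at $q$; (ii) each $\Phi_l$ ($l=1,\dots,L$) is a continuous distribution function. Then the class of nested mixed mixture-of-experts models $\mathcal{M}_L^{*\mathrm{MMoE}}(\mathcal{X};F_0,\Phi)$ (with independent random effects) is compactly dense in the class of generalized nested mixed effects models $\mathcal{M}_L^{*\mathrm{gen}}(\mathcal{X})$ (in which lower-level factors may depend on their upper-level factors). Explicitly: let $\Theta_1,\dots,\Theta_L$ be any complete separable metric spaces, let $G_1$ be any probability measure on $\Theta_1$ and, for $l=2,\dots,L$, let $G_l(\cdot\mid\theta_1,\dots,\theta_{l-1})$ be any probability kernel from $\Theta_1\times\cdots\times\Theta_{l-1}$ to $\Theta_l$, and let $H(\cdot\mid x,\theta)$, $x\in\mathcal{X}$, $\theta\in\Theta:=\Theta_1\times\cdots\times\Theta_L$, be any family of probability distribution functions on $\mathbb{R}^K$ such that $(y,x,\theta)\mapsto H(y\mid x,\theta)$ is continuous on $\mathbb{R}^K\times\mathcal{X}\times\Theta$. Then there exists a sequence $(F^{(n)})_{n\ge1}$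 of MMoE conditional distribution functions (as defined in the context, each with its own number of components and its own parameters) such that, for every hierarchical design $\mathbf{N}$ and every compact $\bar{\mathcal{X}}\subseteq\mathcal{X}$, $$\tilde F^{(n)}(\mathbf{y}\mid\mathbf{x})\longrightarrow\tilde H(\mathbf{y}\mid\mathbf{x})\quad\text{as } n\to\infty,$$ uniformly over $\mathbf{y}=(y_{\mathbf{i}})_{\mathbf{i}\in\mathcal{I}}$ with $y_{\mathbf{i}}\in\mathbb{R}^K$ and $\mathbf{x}=(x_{\mathbf{i}})_{\mathbf{i}\in\mathcal{I}}$ with $x_{\mathbf{i}}\in\bar{\mathcal{X}}$, where $\tilde H$ and $\tilde F^{(n)}$ are the joint distribution functions of all observations induced by $(H,G_1,\dots,G_L)$ and by $(F^{(n)},\Phi_1,\dots,\Phi_L)$ respectively. The sequence $(F^{(n)})$ does not depend on $\mathbf{N}$ or $\bar{\mathcal{X}}$.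
   Context: **Hierarchical design.** Observations are labelled by $\mathbf{i}=(i_1,\dots,i_{L+1})$, and $\mathbf{i}_l=(i_1,\dots,i_l)$ denotes the label up to level $l$. A hierarchical design $\mathbf{N}$ consists of $N_0\in\mathbb{N}$ (the number of level-1 units) together with positive integers $N_{\mathbf{i}_l}$ for every $\mathbf{i}_l\in\mathcal{I}_l$, $l=1,\dots,L$, where $\mathcal{I}_1=\{1,\dots,N_0\}$ and $\mathcal{I}_l=\{\mathbf{i}_l:\mathbf{i}_{l-1}\in\mathcal{I}_{l-1},\ 1\le i_l\le N_{\mathbf{i}_{l-1}}\}$ for $l=2,\dots,L$. The set of observations is $\mathcal{I}=\{\mathbf{i}:\mathbf{i}_L\in\mathcal{I}_L,\ 1\le i_{L+1}\le N_{\mathbf{i}_L}\}$. So level-$l$ units are nested within level-$(l-1)$ units, and observations are nested within level-$L$ units. **Generalized nested mixed effects model.** Given $\Theta_l$, $G_l$, $H$, each unit $\mathbf{i}_l\in\mathcal{I}_l$ has an unobserved factor $\theta_{\mathbf{i}_l}\in\Theta_l$. The factor of a unit depends directly only on the factors of its ancestors: the joint law of $\tilde\theta=\{\theta_{\mathbf{i}_l}:\mathbf{i}_l\in\mathcal{I}_l,\ l=1,\dots,L\}$ is $$G(d\tilde\theta)=\prod_{i_1=1}^{N_0}G_1(d\theta_{\mathbf{i}_1})\prod_{i_2=1}^{N_{\mathbf{i}_1}}G_2(d\theta_{\mathbf{i}_2}\mid\theta_{\mathbf{i}_1})\cdots\prod_{i_L=1}^{N_{\mathbf{i}_{L-1}}}G_L(d\theta_{\mathbf{i}_L}\mid\theta_{\mathbf{i}_1},\dots,\theta_{\mathbf{i}_{L-1}}).$$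 Conditionally on the factors, the observations are independent with $y_{\mathbf{i}}\sim H(\cdot\mid x_{\mathbf{i}},\theta_{\mathbf{i}})$, where $\theta_{\mathbf{i}}=(\theta_{\mathbf{i}_1},\dots,\theta_{\mathbf{i}_L})$. The joint distribution function is $$\tilde H(\mathbf{y}\mid\mathbf{x})=\int\prod_{\mathbf{i}\in\mathcal{I}}H(y_{\mathbf{i}}\mid x_{\mathbf{i}},\theta_{\mathbf{i}})\,G(d\tilde\theta).$$ The class $\mathcal{M}_L^{*\mathrm{gen}}(\mathcal{X})$ consists of all such models in which every $\Theta_l$ is a complete separable metric space (with its Borel $\sigma$-algebra) and $H(y\mid x,\theta)$ is continuous in $(y,x,\theta)$. **Nested MMoE model.** An MMoE conditional distribution function is a function of the form $$F(y\mid x,w)=\sum_{j=1}^g\pi_j(x,w)\,F_0(y;\psi_j),\qquad \pi_j(x,w)=\frac{\exp\{\alpha_{j0}+\alpha_j^{T}x+\beta_j^{T}w\}}{\sum_{j'=1}^g\exp\{\alpha_{j'0}+\alpha_{j'}^{T}x+\beta_{j'}^{T}w\}},$$ for $y\in\mathbb{R}^K$, $x\in\mathcal{X}$, $w\in\mathbb{R}^L$, where $g\in\mathbb{N}$, $\alpha_{j0}\in\mathbb{R}$, $\alpha_j\in\mathbb{R}^P$, $\beta_j\in\mathbb{R}^L$, $\psi_j\in\Psi_0$ are arbitrary. The random effects $\{w_{\mathbf{i}_l}:\mathbf{i}_l\in\mathcal{I}_l,\ l=1,\dots,L\}$ are mutually independent real random variables with $w_{\mathbf{i}_l}\sim\Phi_l$.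 With $w_{\mathbf{i}}=(w_{\mathbf{i}_1},\dots,w_{\mathbf{i}_L})$, the induced joint distribution function is $$\tilde F(\mathbf{y}\mid\mathbf{x})=\int\prod_{\mathbf{i}\in\mathcal{I}}F(y_{\mathbf{i}}\mid x_{\mathbf{i}},w_{\mathbf{i}})\ \prod_{l=1}^L\prod_{\mathbf{i}_l\in\mathcal{I}_l}\Phi_l(dw_{\mathbf{i}_l}).$$ The class $\mathcal{M}_L^{*\mathrm{MMoE}}(\mathcal{X};F_0,\Phi)$ consists of all such models, with $F_0$ and $\Phi_1,\dots,\Phi_L$ fixed and $g,\alpha,\beta,\psi$ varying. **Compact denseness.** A class $\mathcal{M}_1$ of nested models is compactly dense in a class $\mathcal{M}_2$ if for each model in $\mathcal{M}_2$ there is a sequence of models in $\mathcal{M}_1$ whose joint distribution functions converge to those of the target model for all hierarchical designs $\mathbf{N}$, uniformly in $(\mathbf{y},\mathbf{x})$ with all $x_{\mathbf{i}}$ in $\bar{\mathcal{X}}$, for every compact $\bar{\mathcal{X}}\subseteq\mathcal{X}$. *)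

theory Defs
  imports "HOL-Probability.Probability"
begin

section \<open>Distribution functions and weak convergence\<close>

text \<open>
  Distributions are represented by their laws.  The order on \<^typ>\<open>real ^ 'k\<close> is componentwise,
  so \<open>dist_fun\<close> is the joint distribution function; for real laws the library has \<^const>\<open>cdf\<close>.
\<close>

definition dist_fun :: "(real ^ 'k) measure \<Rightarrow> real ^ 'k \<Rightarrow> real" where
  "dist_fun M y = measure M {..y}"

definition converges_weakly ::
    "(nat \<Rightarrow> (real ^ 'k) measure) \<Rightarrow> (real ^ 'k) measure \<Rightarrow> bool" where
  "converges_weakly M M' \<longleftrightarrow>
     (\<forall>f :: real ^ 'k \<Rightarrow> real. continuous_on UNIV f \<and> bounded (range f) \<longrightarrow>
        (\<lambda>n. \<integral>z. f z \<partial>M n) \<longlonglongrightarrow> (\<integral>z. f z \<partial>M'))"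

definition metric_borel :: "'a metric \<Rightarrow> 'a measure" where
  "metric_borel m = sigma (mspace m) {U. openin (mtopology_of m) U}"


section \<open>Hierarchical designs\<close>

text \<open>
  The label \<open>(i\<^sub>1, \<dots>, i\<^sub>l)\<close> is the list \<open>[i\<^sub>1, \<dots>, i\<^sub>l]\<close>, so its ancestor at level \<open>m\<close> is its
  prefix \<open>take m i\<close>.  A design is a function \<open>N\<close> on labels; \<open>N []\<close> is the number of level-1 units.
  The observations under \<open>L\<close> levels of units are the labels of length \<open>L + 1\<close>.
\<close>

fun units :: "(nat list \<Rightarrow> nat) \<Rightarrow> nat \<Rightarrow> nat list set" where
  "units N 0 = {[]}"
| "units N (Suc l) = {i @ [j] | i j. i \<in> units N l \<and> 1 \<le> j \<and> j \<le> N i}"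

definition units_upto :: "(nat list \<Rightarrow> nat) \<Rightarrow> nat \<Rightarrow> nat list set" where
  "units_upto N l = (\<Union>m\<in>{1..l}. units N m)"

abbreviation observations :: "(nat list \<Rightarrow> nat) \<Rightarrow> nat \<Rightarrow> nat list set" where
  "observations N L \<equiv> units N (Suc L)"

definition hierarchical_design :: "nat \<Rightarrow> (nat list \<Rightarrow> nat) \<Rightarrow> bool" where
  "hierarchical_design L N \<longleftrightarrow> (\<forall>l\<in>{1..L}. \<forall>i\<in>units N l. N i > 0)"

text \<open>
  The tuple of values attached to the proper ancestors of \<open>i\<close>: the argument of the kernel \<open>G\<^sub>l\<close>
  if \<open>i\<close> is a unit of level \<open>l\<close>, and \<open>\<theta>\<^sub>i\<close> (or \<open>w\<^sub>i\<close>), indexed by \<open>{1..L}\<close>, if \<open>i\<close> is an observation.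
\<close>

definition ancestors :: "(nat list \<Rightarrow> 'a) \<Rightarrow> nat list \<Rightarrow> nat \<Rightarrow> 'a" where
  "ancestors \<theta> i = (\<lambda>m\<in>{1..<length i}. \<theta> (take m i))"


section \<open>Nested models and compact denseness\<close>

text \<open>
  A nested model is identified with its joint distribution functions: \<open>m N y x\<close> is the value at \<open>y\<close>
  given the covariates \<open>x\<close> under the design \<open>N\<close>.  Only the coordinates of \<open>y\<close> and \<open>x\<close> at
  observations matter.
\<close>

type_synonym ('k, 'p) nested_model =
  "(nat list \<Rightarrow> nat) \<Rightarrow> (nat list \<Rightarrow> real ^ 'k) \<Rightarrow> (nat list \<Rightarrow> real ^ 'p) \<Rightarrow> real"

definition compactly_dense ::
    "nat \<Rightarrow> (real ^ 'p) set \<Rightarrow> ('k::finite, 'p::finite) nested_model set \<Rightarrow> ('k::finite, 'p::finite) nested_model set \<Rightarrow> bool" where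
  "compactly_dense L X \<M>\<^sub>1 \<M>\<^sub>2 \<longleftrightarrow>
     (\<forall>m\<in>\<M>\<^sub>2. \<exists>s. (\<forall>n::nat. s n \<in> \<M>\<^sub>1) \<and>
        (\<forall>N X'. hierarchical_design L N \<and> compact X' \<and> X' \<subseteq> X \<longrightarrow>
           uniform_limit {(y, x). \<forall>i\<in>observations N L. x i \<in> X'}
             (\<lambda>n (y, x). s n N y x) (\<lambda>(y, x). m N y x) sequentially))"


section \<open>Generalized nested mixed effects models\<close>

definition factor_space ::
    "(nat \<Rightarrow> 'a metric) \<Rightarrow> nat list set \<Rightarrow> (nat list \<Rightarrow> 'a) measure" where
  "factor_space \<Theta> I = (\<Pi>\<^sub>M i\<in>I. metric_borel (\<Theta> (length i)))"

text \<open>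
  The joint law of the factors of all units of levels \<open>1, \<dots>, l\<close>: conditionally on the factors up to
  level \<open>l\<close>, the factors at level \<open>l + 1\<close> are independent, the one of unit \<open>i\<close> having the law
  \<open>G\<^sub>l\<^sub>+\<^sub>1(\<cdot> | \<theta>\<^sub>i\<^sub>1, \<dots>, \<theta>\<^sub>i\<^sub>l)\<close>.
\<close>

primrec factor_law ::
    "(nat \<Rightarrow> 'a metric) \<Rightarrow> (nat \<Rightarrow> (nat \<Rightarrow> 'a) \<Rightarrow> 'a measure) \<Rightarrow> (nat list \<Rightarrow> nat) \<Rightarrow>
     nat \<Rightarrow> (nat list \<Rightarrow> 'a) measure" where
  "factor_law \<Theta> G N 0 = return (factor_space \<Theta> {}) (\<lambda>_. undefined)"
| "factor_law \<Theta> G N (Suc l) =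
     factor_law \<Theta> G N l \<bind>
       (\<lambda>\<theta>. distr (\<Pi>\<^sub>M i\<in>units N (Suc l). G (Suc l) (ancestors \<theta> i))
               (factor_space \<Theta> (units_upto N (Suc l)))
               (\<lambda>\<eta>. merge (units_upto N l) (units N (Suc l)) (\<theta>, \<eta>)))"

definition gen_joint ::
    "nat \<Rightarrow> (nat \<Rightarrow> 'a metric) \<Rightarrow> (nat \<Rightarrow> (nat \<Rightarrow> 'a) \<Rightarrow> 'a measure) \<Rightarrow>
     (real ^ 'p \<Rightarrow> (nat \<Rightarrow> 'a) \<Rightarrow> (real ^ 'k) measure) \<Rightarrow> ('k::finite, 'p::finite) nested_model" where
  "gen_joint L \<Theta> G H N y x =
     (\<integral>\<theta>. (\<Prod>i\<in>observations N L. dist_fun (H (x i) (ancestors \<theta> i)) (y i))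
        \<partial>factor_law \<Theta> G N L)"

text \<open>
  For \<open>l = 1\<close> the kernel condition ranges over the one-point space \<open>PiM {}\<close>, so \<open>G 1\<close> amounts to a
  single probability measure.  The factor spaces may have different carriers inside the type \<open>'a\<close>
  (e.g. a sum type); the class is indexed by that type.
\<close>

definition gen_params ::
    "nat \<Rightarrow> (real ^ 'p) set \<Rightarrow> (nat \<Rightarrow> 'a metric) \<Rightarrow> (nat \<Rightarrow> (nat \<Rightarrow> 'a) \<Rightarrow> 'a measure) \<Rightarrow>
     (real ^ 'p \<Rightarrow> (nat \<Rightarrow> 'a) \<Rightarrow> (real ^ 'k) measure) \<Rightarrow> bool" where
  "gen_params L X \<Theta> G H \<longleftrightarrow>
     (\<forall>l\<in>{1..L}. mcomplete_of (\<Theta> l) \<and> separable_space (mtopology_of (\<Theta> l))) \<and>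
     (\<forall>l\<in>{1..L}. G l \<in> (\<Pi>\<^sub>M m\<in>{1..<l}. metric_borel (\<Theta> m)) \<rightarrow>\<^sub>M prob_algebra (metric_borel (\<Theta> l))) \<and>
     (\<forall>x\<in>X. \<forall>\<theta>\<in>\<Pi>\<^sub>E l\<in>{1..L}. mspace (\<Theta> l). prob_space (H x \<theta>) \<and> sets (H x \<theta>) = sets borel) \<and>
     continuous_map
       (prod_topology euclidean
         (prod_topology (top_of_set X) (product_topology (\<lambda>l. mtopology_of (\<Theta> l)) {1..L})))
       euclideanreal (\<lambda>(y, x, \<theta>). dist_fun (H x \<theta>) y)"

definition gen_models ::
    "'a itself \<Rightarrow> nat \<Rightarrow> (real ^ 'p) set \<Rightarrow> ('k::finite, 'p::finite) nested_model set" where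
  "gen_models (_ :: 'a itself) L X =
     {gen_joint L \<Theta> G H | (\<Theta> :: nat \<Rightarrow> 'a metric) G H. gen_params L X \<Theta> G H}"


section \<open>Nested mixed mixture-of-experts models\<close>

text \<open>Vectors in \<open>\<real>\<^sup>L\<close> are functions read on \<open>{1..L}\<close>; components of the mixture are \<open>{1..g}\<close>.\<close>

definition gate ::
    "nat \<Rightarrow> nat \<Rightarrow> (nat \<Rightarrow> real) \<Rightarrow> (nat \<Rightarrow> real ^ 'p) \<Rightarrow> (nat \<Rightarrow> nat \<Rightarrow> real) \<Rightarrow>
     nat \<Rightarrow> real ^ 'p \<Rightarrow> (nat \<Rightarrow> real) \<Rightarrow> real" where
  "gate L g \<alpha>\<^sub>0 \<alpha> \<beta> j x w =
     exp (\<alpha>\<^sub>0 j + \<alpha> j \<bullet> x + (\<Sum>l=1..L. \<beta> j l * w l)) /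
     (\<Sum>j'=1..g. exp (\<alpha>\<^sub>0 j' + \<alpha> j' \<bullet> x + (\<Sum>l=1..L. \<beta> j' l * w l)))"

definition mmoe_dist_funs ::
    "nat \<Rightarrow> ('s \<Rightarrow> (real ^ 'k) measure) \<Rightarrow> 's set \<Rightarrow>
     (real ^ 'k \<Rightarrow> real ^ 'p \<Rightarrow> (nat \<Rightarrow> real) \<Rightarrow> real) set" where
  "mmoe_dist_funs L F\<^sub>0 \<Psi>\<^sub>0 =
     {\<lambda>y x w. \<Sum>j=1..g. gate L g \<alpha>\<^sub>0 \<alpha> \<beta> j x w * dist_fun (F\<^sub>0 (\<psi> j)) y
       | g \<alpha>\<^sub>0 \<alpha> \<beta> \<psi>. g \<ge> 1 \<and> (\<forall>j\<in>{1..g}. \<psi> j \<in> \<Psi>\<^sub>0)}"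

definition mmoe_joint ::
    "nat \<Rightarrow> (nat \<Rightarrow> real measure) \<Rightarrow> (real ^ 'k \<Rightarrow> real ^ 'p \<Rightarrow> (nat \<Rightarrow> real) \<Rightarrow> real) \<Rightarrow>
     ('k::finite, 'p::finite) nested_model" where
  "mmoe_joint L \<Phi> F N y x =
     (\<integral>w. (\<Prod>i\<in>observations N L. F (y i) (x i) (ancestors w i))
        \<partial>(\<Pi>\<^sub>M i\<in>units_upto N L. \<Phi> (length i)))"

definition mmoe_models ::
    "nat \<Rightarrow> ('s \<Rightarrow> (real ^ 'k) measure) \<Rightarrow> 's set \<Rightarrow> (nat \<Rightarrow> real measure) \<Rightarrow>
     ('k::finite, 'p::finite) nested_model set" where
  "mmoe_models L F\<^sub>0 \<Psi>\<^sub>0 \<Phi> = mmoe_joint L \<Phi> ` mmoe_dist_funs L F\<^sub>0 \<Psi>\<^sub>0"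

end

theory Submission
  imports Defs
begin

text \<open>
  Each factor is a measurable function of its ancestors and of one random effect: a Polish space is a
  measurable retract of the real line, where kernels are realised by quantile functions, and
  \<open>\<Phi>\<^sub>l(w)\<close> is uniform because \<open>\<Phi>\<^sub>l\<close> is continuous.  Hence the target model has the form
  \<open>H(\<cdot> | x, T(w))\<close> with independent random effects \<open>w\<close> and measurable \<open>T\<close>.  Up to small measure, \<open>w\<close>
  lies in a compact set on which \<open>T\<close> is nearly locally constant.  Take finite nets of centers there and
  in \<open>X\<close>; a sharp softmax selects the centers near \<open>(x, w)\<close>, and at each center the law \<open>H\<close> is
  approximated by a finite mixture of nearly degenerate experts.  The resulting MMoE functions converge
  to \<open>H(y | x, T(w))\<close> for almost every \<open>w\<close>, locally uniformly in \<open>x\<close> and, by Polya's argument, uniformly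
  in \<open>y\<close>.  Dominated convergence and a telescoping bound for products give the joint distribution
  functions.
\<close>

section \<open>Polish spaces as measurable retracts of the real line\<close>

text \<open>The obstacle is that gates are smooth functions of scores affine in
  \<open>(x, w)\<close>, whereas \<open>T\<close> is merely measurable with values in abstract
  metric spaces. \<open>T\<close> is therefore seen only through countably many preimages of balls,
  at stage \<open>n\<close> through the first \<open>n\<close> of them, on a compact set whose
  complement has measure below \<open>(1/2) ^ n\<close>. These bounds are summable, so
  Borel-Cantelli turns small exceptional sets into convergence for almost every \<open>w\<close>.
  Experts may have jumps in \<open>y\<close>; hence each approximation is bounded by the target at
  \<open>y\<close> shifted by a small vector, and the shift vanishes in the limit because
  \<open>H\<close> is continuous in \<open>y\<close>. The sequence is independent of the design
  because it is chosen for one branch of random effects: the effects above any observation of any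
  design have the law \<open>PiM {1..L} \<Phi>\<close>.\<close>

lemma openin_subset_mspace: "{U. openin (mtopology_of m) U} \<subseteq> Pow (mspace m)"
  by (metis (no_types, lifting) CollectD PowI openin_subset subsetI topspace_mtopology_of)

lemma space_metric_borel [simp]: "space (metric_borel m) = mspace m"
  unfolding metric_borel_def by (rule space_measure_of[OF openin_subset_mspace])

lemma sets_metric_borel:
  "sets (metric_borel m) = sigma_sets (mspace m) {U. openin (mtopology_of m) U}"
  unfolding metric_borel_def by (rule sets_measure_of[OF openin_subset_mspace])

lemma openin_sets_metric_borel: "openin (mtopology_of m) U \<Longrightarrow> U \<in> sets (metric_borel m)"
  by (auto simp: sets_metric_borel)

lemma openin_mtopology_of_ball:
  "openin (mtopology_of m) {y \<in> mspace m. mdist m x y < r}" if "x \<in> mspace m"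
proof -
  interpret Metric_space "mspace m" "mdist m" by (rule Metric_space_mspace_mdist)
  have "{y \<in> mspace m. mdist m x y < r} = mball x r"
    using that by (auto simp: mball_def)
  then show ?thesis by (simp add: mtopology_of_def)
qed

lemma openin_mtopology_of_iff:
  "openin (mtopology_of m) U \<longleftrightarrow>
     U \<subseteq> mspace m \<and> (\<forall>x\<in>U. \<exists>r>0. \<forall>y\<in>mspace m. mdist m x y < r \<longrightarrow> y \<in> U)"
proof -
  interpret Metric_space "mspace m" "mdist m" by (rule Metric_space_mspace_mdist)
  have "{y. x \<in> mspace m \<and> y \<in> mspace m \<and> mdist m x y < r} \<subseteq> U \<longleftrightarrow>
      (\<forall>y\<in>mspace m. mdist m x y < r \<longrightarrow> y \<in> U)" if "x \<in> mspace m" for x r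
    using that by blast
  then show ?thesis
    unfolding mtopology_of_def openin_mtopology mball_def by (meson subsetD)
qed

lemma pred_mdist_metric_borel:
  assumes "x \<in> mspace m"
  shows "Measurable.pred (metric_borel m) (\<lambda>y. mdist m x y < r)"
  using openin_sets_metric_borel[OF openin_mtopology_of_ball[OF assms]] by (simp add: pred_def)

text \<open>An enumeration rather than a countable set: a \<open>LEAST\<close> index then selects an
  approximating point measurably.\<close>

definition dense_sequence :: "'a metric \<Rightarrow> (nat \<Rightarrow> 'a) \<Rightarrow> bool" where
  "dense_sequence m s \<longleftrightarrow>
     range s \<subseteq> mspace m \<and> (\<forall>x\<in>mspace m. \<forall>e>0. \<exists>k. mdist m (s k) x < e)"

lemma dense_sequence_exists:
  fixes m :: "'a metric"
  assumes "separable_space (mtopology_of m)" "mspace m \<noteq> {}"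
  shows "\<exists>s. dense_sequence m s"
proof -
  interpret Metric_space "mspace m" "mdist m" by (rule Metric_space_mspace_mdist)
  obtain C where C: "countable C" "C \<subseteq> mspace m" "(mtopology_of m) closure_of C = mspace m"
    using assms(1) unfolding separable_space_def by auto
  have *: "\<exists>y\<in>C. mdist m y x < e" if "x \<in> mspace m" "0 < e" for x e
  proof -
    have "x \<in> mtopology closure_of C" using C(3) that by (simp add: mtopology_of_def)
    then show ?thesis using that by (auto simp: metric_closure_of mball_def commute)
  qed
  have "C \<noteq> {}" using * assms(2) by (metis all_not_in_conv zero_less_one)
  then have "range (from_nat_into C) = C" using C(1) by (rule range_from_nat_into)
  then have "dense_sequence m (from_nat_into C)"
    unfolding dense_sequence_def using C(2) * by (metis rangeE)
  then show ?thesis by blast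
qed

section \<open>Real codes of bit sequences\<close>

definition ternary_encode :: "(nat \<Rightarrow> bool) \<Rightarrow> real" where
  "ternary_encode b = (\<Sum>i. of_bool (b i) * (1/3) ^ Suc i)"

definition ternary_decode :: "real \<Rightarrow> nat \<Rightarrow> bool" where
  "ternary_decode x i \<longleftrightarrow> \<lfloor>3 ^ Suc i * x\<rfloor> mod 3 = 1"

text \<open>After scaling by \<open>3 ^ Suc i\<close>, the digits before \<open>i\<close> contribute
  a multiple of 3, digit \<open>i\<close> becomes the unit digit, and the tail lies in [0, 1/2], so
  the floor removes it. Digits 0 and 1 in base 3 leave this gap; in base 2 a tail of ones would
  carry into digit \<open>i\<close>.\<close>

lemma ternary_decode_encode [simp]: "ternary_decode (ternary_encode b) i = b i"
proof -
  let ?f = "\<lambda>i. of_bool (b i) * (1/3::real) ^ Suc i"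
  have sg: "summable (\<lambda>j. (1/3::real) ^ Suc j)"
    by (subst summable_Suc_iff) (rule summable_geometric, simp)
  have sf: "summable ?f" by (rule summable_comparison_test'[OF sg, of 0]) auto
  define t where "t = (\<Sum>j. ?f (j + Suc i))"
  have t0: "0 \<le> t" unfolding t_def by (intro suminf_nonneg summable_ignore_initial_segment sf) auto
  have "t \<le> (\<Sum>j. (1/3) ^ Suc (Suc i) * (1/3::real) ^ j)"
    unfolding t_def
    by (intro suminf_le summable_ignore_initial_segment sf summable_mult summable_geometric)
       (auto simp: power_add)
  also have "\<dots> = (1/3) ^ Suc (Suc i) * (3/2)"
    by (subst suminf_mult) (auto simp: suminf_geometric intro!: summable_geometric)
  finally have t1: "3 ^ Suc i * t \<le> 1/2" by (simp add: field_simps power_divide)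
  have "ternary_encode b = t + (\<Sum>j<Suc i. ?f j)"
    unfolding ternary_encode_def t_def by (rule suminf_split_initial_segment[OF sf])
  then have "3 ^ Suc i * ternary_encode b = 3 ^ Suc i * t + (\<Sum>j<Suc i. 3 ^ Suc i * ?f j)"
    by (simp add: distrib_left sum_distrib_left)
  also have "(\<Sum>j<Suc i. 3 ^ Suc i * ?f j) = (\<Sum>j<Suc i. of_int (of_bool (b j) * 3 ^ (i - j)))"
  proof (rule sum.cong)
    fix j assume "j \<in> {..<Suc i}"
    then have "(3::real) ^ Suc i = 3 ^ (i - j) * 3 ^ Suc j" by (simp flip: power_add)
    then show "3 ^ Suc i * ?f j = of_int (of_bool (b j) * 3 ^ (i - j))"
      by (auto simp: field_simps power_divide)
  qed simp
  finally have "3 ^ Suc i * ternary_encode b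
      = 3 ^ Suc i * t + of_int (\<Sum>j<Suc i. of_bool (b j) * 3 ^ (i - j))" by simp
  then have fl: "\<lfloor>3 ^ Suc i * ternary_encode b\<rfloor> = (\<Sum>j<Suc i. of_bool (b j) * 3 ^ (i - j))"
    using t0 t1 by (simp add: floor_eq_iff)
  have "(3::int) dvd (\<Sum>j<i. of_bool (b j) * 3 ^ (i - j))"
    by (intro dvd_sum dvd_mult dvd_power) auto
  then obtain c where c: "(\<Sum>j<i. of_bool (b j) * 3 ^ (i - j)) = 3 * (c::int)" by (rule dvdE)
  have "(\<Sum>j<Suc i. of_bool (b j) * 3 ^ (i - j)) = 3 * c + of_bool (b i)"
    unfolding sum.lessThan_Suc c by simp
  then have "\<lfloor>3 ^ Suc i * ternary_encode b\<rfloor> mod 3 = of_bool (b i)"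
    unfolding fl by (cases "b i") simp_all
  then show ?thesis unfolding ternary_decode_def by (cases "b i") simp_all
qed

lemma pred_ternary_decode [measurable]: "Measurable.pred borel (\<lambda>x. ternary_decode x i)"
proof -
  have "(\<lambda>x::real. \<lfloor>3 ^ Suc i * x\<rfloor>) \<in> borel \<rightarrow>\<^sub>M count_space UNIV"
    by (rule measurable_compose[OF _ measurable_real_floor]) (intro borel_measurable_times borel_measurable_const measurable_ident_sets refl)
  then have "(\<lambda>x::real. \<lfloor>3 ^ Suc i * x\<rfloor> mod 3 = 1) \<in> borel \<rightarrow>\<^sub>M count_space UNIV"
    by (rule measurable_compose[where g = "\<lambda>z. z mod 3 = 1"]) simp
  then show ?thesis unfolding ternary_decode_def .
qed

lemma measurable_ternary_encode:
  assumes [measurable]: "\<And>i. Measurable.pred M (\<lambda>x. b x i)"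
  shows "(\<lambda>x. ternary_encode (b x)) \<in> borel_measurable M"
  unfolding ternary_encode_def of_bool_def
  by (intro borel_measurable_suminf borel_measurable_times measurable_If borel_measurable_const)
     (use assms in \<open>auto simp: pred_def\<close>)

text \<open>A Polish space is a measurable retract of the real line: the point \<open>x\<close> is recovered from the
  bits \<open>d (s k, x) < 2\<^sup>-\<^sup>n\<close>, with \<open>s\<close> a dense sequence.\<close>

lemma polish_measurable_retract:
  assumes compl: "mcomplete_of m" and sep: "separable_space (mtopology_of m)"
    and ne: "mspace m \<noteq> {}"
  obtains e :: "'a \<Rightarrow> real" and r :: "real \<Rightarrow> 'a"
  where "e \<in> metric_borel m \<rightarrow>\<^sub>M borel" "r \<in> borel \<rightarrow>\<^sub>M metric_borel m"
    "\<And>x. x \<in> mspace m \<Longrightarrow> r (e x) = x"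
proof -
  interpret Metric_space "mspace m" "mdist m" by (rule Metric_space_mspace_mdist)
  obtain s where "dense_sequence m s" using dense_sequence_exists[OF sep ne] by blast
  then have s: "range s \<subseteq> mspace m"
    and dense: "\<And>x e. x \<in> mspace m \<Longrightarrow> 0 < e \<Longrightarrow> \<exists>k. mdist m (s k) x < e"
    unfolding dense_sequence_def by blast+
  have sk: "s k \<in> mspace m" for k using s by auto
  define e where "e x = ternary_encode (\<lambda>i. case prod_decode i of (n, k) \<Rightarrow> mdist m (s k) x < (1/2) ^ n)" for x
  have e_bit: "ternary_decode (e x) (prod_encode (n, k)) \<longleftrightarrow> mdist m (s k) x < (1/2) ^ n" for x n k
    by (simp add: e_def)
  have e_meas: "e \<in> metric_borel m \<rightarrow>\<^sub>M borel"
    unfolding e_def case_prod_beta by (intro measurable_ternary_encode pred_mdist_metric_borel sk)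
  \<comment> \<open>Meaningful for every real \<open>t\<close>, code or not: where no bit is set,
    \<open>LEAST\<close> returns a fixed index, and measurability is preserved.\<close>
  define idx where "idx t n = (LEAST k. ternary_decode t (prod_encode (n, k)))" for t n
  have [measurable]: "(\<lambda>t. idx t n) \<in> borel \<rightarrow>\<^sub>M count_space UNIV" for n
    unfolding idx_def by measurable
  \<comment> \<open>For the code of a point, consecutive centers are closer than
    \<open>(1/2) ^ n + (1/2) ^ Suc n\<close>, hence the factor 2. Other reals are filtered out,
    since their centers need not converge.\<close>
  define good where "good t \<longleftrightarrow> (\<forall>n. mdist m (s (idx t n)) (s (idx t (Suc n))) < 2 * (1/2) ^ n)" for t
  have [measurable]: "Measurable.pred borel good" unfolding good_def by measurable
  have "\<exists>l\<in>mspace m. \<forall>n. mdist m (s (idx t n)) l \<le> 4 * (1/2) ^ n" if g: "good t" for t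
  proof -
    \<comment> \<open>The subtracted term lets the induction close: the steps from \<open>n\<close>
      on form a geometric series with total \<open>4 * (1/2) ^ n\<close>.\<close>
    have step: "mdist m (s (idx t n)) (s (idx t (n + p))) \<le> 4 * (1/2) ^ n - 4 * (1/2) ^ (n + p)" for n p
    proof (induction p)
      case (Suc p)
      have "mdist m (s (idx t n)) (s (idx t (n + Suc p)))
          \<le> mdist m (s (idx t n)) (s (idx t (n + p))) + mdist m (s (idx t (n + p))) (s (idx t (Suc (n + p))))"
        using triangle[OF sk sk sk] by simp
      also have "\<dots> \<le> (4 * (1/2) ^ n - 4 * (1/2) ^ (n + p)) + 2 * (1/2) ^ (n + p)"
        using Suc g unfolding good_def by (intro add_mono) (auto intro: less_imp_le)
      finally show ?case by simp
    qed (simp add: sk)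
    have step': "mdist m (s (idx t n)) (s (idx t n')) \<le> 4 * (1/2) ^ n" if "n \<le> n'" for n n'
    proof -
      have "mdist m (s (idx t n)) (s (idx t n')) \<le> 4 * (1/2) ^ n - 4 * (1/2) ^ n'"
        using step[of n "n' - n"] that by simp
      also have "\<dots> \<le> 4 * (1/2) ^ n" by simp
      finally show ?thesis .
    qed
    have "MCauchy (\<lambda>n. s (idx t n))"
      unfolding MCauchy_def
    proof safe
      fix \<epsilon> :: real assume "0 < \<epsilon>"
      then obtain N where N: "(1/2::real) ^ N < \<epsilon> / 4"
        using real_arch_pow_inv[of "\<epsilon>/4" "1/2"] by auto
      have *: "mdist m (s (idx t n)) (s (idx t n')) < \<epsilon>" if "N \<le> n" "n \<le> n'" for n n'
      proof -
        have "(1/2::real) ^ n \<le> (1/2) ^ N" using that by (intro power_decreasing) auto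
        then show ?thesis using step'[OF that(2)] N by linarith
      qed
      show "\<exists>N. \<forall>n n'. N \<le> n \<longrightarrow> N \<le> n' \<longrightarrow> mdist m (s (idx t n)) (s (idx t n')) < \<epsilon>"
        using * by (metis commute nle_le)
    qed (use sk in auto)
    then obtain l where l: "limitin mtopology (\<lambda>n. s (idx t n)) l sequentially"
      using compl unfolding mcomplete_of_def mcomplete_def by blast
    then have lm: "l \<in> mspace m" by (rule limitin_mspace)
    have "mdist m (s (idx t n)) l \<le> 4 * (1/2) ^ n" for n
    proof (rule field_le_epsilon)
      fix \<epsilon> :: real assume "0 < \<epsilon>"
      then obtain N where "\<forall>n\<ge>N. mdist m (s (idx t n)) l < \<epsilon>"
        using l unfolding limit_metric_sequentially by blast
      then have "mdist m (s (idx t (max n N))) l < \<epsilon>" by simp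
      then show "mdist m (s (idx t n)) l \<le> 4 * (1/2) ^ n + \<epsilon>"
        using triangle[OF sk[of "idx t n"] sk[of "idx t (max n N)"] lm] step'[of n "max n N"] by simp
    qed
    with lm show ?thesis by blast
  qed
  then obtain lim where lim: "\<And>t. good t \<Longrightarrow> lim t \<in> mspace m"
      "\<And>t n. good t \<Longrightarrow> mdist m (s (idx t n)) (lim t) \<le> 4 * (1/2) ^ n"
    by metis
  define r where "r t = (if good t then lim t else s 0)" for t
  have r_meas: "r \<in> borel \<rightarrow>\<^sub>M metric_borel m"
    unfolding metric_borel_def
  proof (rule measurable_measure_of)
    show "r \<in> space borel \<rightarrow> mspace m" using lim(1) sk by (auto simp: r_def)
    fix U assume "U \<in> {U. openin (mtopology_of m) U}"
    then have U: "openin (mtopology_of m) U" by simp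
    then have Um: "U \<subseteq> mspace m" using openin_subset by fastforce
    \<comment> \<open>\<open>R n k\<close> is a condition on two natural numbers, so membership of
      the limit in \<open>U\<close> becomes a countable union of measurable events. The factor 5
      strictly exceeds the error factor 4 of the limit, and \<open>\<rho> / 9\<close> below pays for
      4 + 5.\<close>
    define R where "R n k \<longleftrightarrow> (\<forall>y\<in>mspace m. mdist m (s k) y < 5 * (1/2) ^ n \<longrightarrow> y \<in> U)" for n k
    have *: "lim t \<in> U \<longleftrightarrow> (\<exists>n. R n (idx t n))" if g: "good t" for t
    proof
      assume "lim t \<in> U"
      then obtain \<rho> where \<rho>: "\<rho> > 0" "\<And>y. y \<in> mspace m \<Longrightarrow> mdist m (lim t) y < \<rho> \<Longrightarrow> y \<in> U"
        using U unfolding openin_mtopology_of_iff by blast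
      obtain n where n: "(1/2::real) ^ n < \<rho> / 9"
        using real_arch_pow_inv[of "\<rho>/9" "1/2"] \<rho> by auto
      have "R n (idx t n)" unfolding R_def
      proof safe
        fix y assume y: "y \<in> mspace m" "mdist m (s (idx t n)) y < 5 * (1/2) ^ n"
        have "mdist m (lim t) y \<le> mdist m (s (idx t n)) (lim t) + mdist m (s (idx t n)) y"
          using triangle[OF lim(1)[OF g] sk y(1)] by (metis commute)
        then show "y \<in> U" using y n lim(2)[OF g, of n] \<rho>(2) by force
      qed
      then show "\<exists>n. R n (idx t n)" ..
    next
      assume "\<exists>n. R n (idx t n)"
      then obtain n where n: "R n (idx t n)" ..
      have "(0::real) < (1/2) ^ n" by simp
      then have "mdist m (s (idx t n)) (lim t) < 5 * (1/2) ^ n"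
        using lim(2)[OF g, of n] by linarith
      then show "lim t \<in> U" using n lim(1)[OF g] unfolding R_def by blast
    qed
    have "r -` U \<inter> space borel = {t. if good t then \<exists>n. R n (idx t n) else s 0 \<in> U}"
      using * by (auto simp: r_def split: if_splits)
    also have "\<dots> \<in> sets borel" by measurable
    finally show "r -` U \<inter> space borel \<in> sets borel" .
  qed (rule openin_subset_mspace)
  have "r (e x) = x" if x: "x \<in> mspace m" for x
  proof -
    have ix: "mdist m (s (idx (e x) n)) x < (1/2) ^ n" for n
    proof -
      have "\<exists>k. ternary_decode (e x) (prod_encode (n, k))"
        using dense[OF x, of "(1/2) ^ n"] by (auto simp: e_bit)
      then have "ternary_decode (e x) (prod_encode (n, idx (e x) n))"
        unfolding idx_def by (rule LeastI_ex)
      then show ?thesis by (simp add: e_bit)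
    qed
    have g: "good (e x)"
      unfolding good_def
    proof
      fix n
      have "mdist m (s (idx (e x) n)) (s (idx (e x) (Suc n)))
          \<le> mdist m (s (idx (e x) n)) x + mdist m (s (idx (e x) (Suc n))) x"
        using triangle[OF sk x sk] by (metis commute)
      also have "\<dots> < (1/2) ^ n + (1/2) ^ Suc n" using ix by (intro add_strict_mono)
      also have "\<dots> \<le> 2 * (1/2) ^ n" by simp
      finally show "mdist m (s (idx (e x) n)) (s (idx (e x) (Suc n))) < 2 * (1/2) ^ n" .
    qed
    have "mdist m (lim (e x)) x \<le> \<epsilon>" if "0 < \<epsilon>" for \<epsilon>
    proof -
      obtain n where n: "(1/2::real) ^ n < \<epsilon> / 5"
        using real_arch_pow_inv[of "\<epsilon>/5" "1/2"] \<open>0 < \<epsilon>\<close> by auto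
      have "mdist m (lim (e x)) x \<le> mdist m (s (idx (e x) n)) (lim (e x)) + mdist m (s (idx (e x) n)) x"
        using triangle[OF lim(1)[OF g] sk x] by (metis commute)
      then show ?thesis using ix[of n] lim(2)[OF g, of n] n by linarith
    qed
    then have "mdist m (lim (e x)) x \<le> 0" by (meson field_le_epsilon dense_ge)
    then show ?thesis using g lim(1)[OF g] x nonneg[of "lim (e x)" x] zero[of "lim (e x)" x] by (simp add: r_def)
  qed
  with e_meas r_meas show ?thesis by (rule that)
qed


section \<open>Randomization of kernels\<close>

text \<open>Every level in (0, 1) is attained, by the intermediate value theorem. A half-line at
  level \<open>c\<close> bounds the set from below. From above it is bounded by half-lines at levels
  \<open>d > c\<close>, because \<open>cdf M\<close> may stay constant at level \<open>c\<close> and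
  the set may then exceed the first half-line.\<close>

lemma measure_cdf_le:
  assumes "real_distribution M" and cont: "continuous_on UNIV (cdf M)" and c: "0 \<le> c" "c < 1"
  shows "measure M {w. cdf M w \<le> c} = c"
proof -
  interpret real_distribution M by fact
  interpret cdf_distribution M by standard
  have [measurable]: "cdf M \<in> borel_measurable borel" by simp
  have S: "{w. cdf M w \<le> c} \<in> sets M" by simp
  have ivt: "\<exists>w. cdf M w = d" if d: "0 < d" "d < 1" for d
  proof -
    obtain a where a: "cdf M a < d"
      using order_tendstoD(2)[OF cdf_lim_at_bot d(1)] by (auto simp: eventually_at_bot_linorder)
    obtain b where b: "d < cdf M b"
      using order_tendstoD(1)[OF cdf_lim_at_top_prob d(2)] by (auto simp: eventually_at_top_linorder)
    have "a \<le> b" using a b cdf_nondecreasing[of b a] by linarith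
    then show ?thesis
      using IVT'[of "cdf M" a d b] a b continuous_on_subset[OF assms(2), of "{a..b}"] by auto
  qed
  have "c \<le> measure M {w. cdf M w \<le> c}"
  proof (cases "c = 0")
    case False
    then obtain w where w: "cdf M w = c" using ivt[of c] c by auto
    have "{..w} \<subseteq> {w. cdf M w \<le> c}" using w cdf_nondecreasing by blast
    then have "measure M {..w} \<le> measure M {w. cdf M w \<le> c}" by (intro finite_measure_mono S)
    then show ?thesis using w by (simp add: cdf_def)
  qed simp
  moreover have "measure M {w. cdf M w \<le> c} \<le> d" if d: "c < d" "d < 1" for d
  proof -
    obtain w where w: "cdf M w = d" using ivt[of d] c d by auto
    have "{w. cdf M w \<le> c} \<subseteq> {..w}" proof
      fix v assume "v \<in> {w. cdf M w \<le> c}"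
      then have "\<not> w \<le> v" using w d cdf_nondecreasing[of w v] by auto
      then show "v \<in> {..w}" by simp
    qed
    then have "measure M {w. cdf M w \<le> c} \<le> measure M {..w}" by (intro finite_measure_mono) auto
    then show ?thesis using w by (simp add: cdf_def)
  qed
  then have "measure M {w. cdf M w \<le> c} \<le> c" using c(2) dense_ge_bounded by blast
  ultimately show ?thesis by simp
qed

text \<open>The infimum that defines a quantile is well behaved only at levels strictly between 0
  and 1; this discards the other levels.\<close>

lemma AE_cdf_in_Ioo:
  assumes "real_distribution M" and cont: "continuous_on UNIV (cdf M)"
  shows "AE w in M. 0 < cdf M w \<and> cdf M w < 1"
proof -
  interpret real_distribution M by fact
  interpret cdf_distribution M by standard
  have [measurable]: "cdf M \<in> borel_measurable borel" by simp
  have "prob {w. cdf M w \<le> 0} = 0" by (rule measure_cdf_le[OF assms]) auto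
  then have "AE w in M. \<not> cdf M w \<le> 0"
    by (intro AE_I[where N = "{w. cdf M w \<le> 0}"]) (auto simp: emeasure_eq_measure)
  moreover have "prob {w. cdf M w < 1} = 1"
  proof (rule antisym)
    show "1 \<le> prob {w. cdf M w < 1}"
    proof (rule dense_le_bounded[of 0])
      fix c :: real assume c: "0 < c" "c < 1"
      then have "c = prob {w. cdf M w \<le> c}" using measure_cdf_le[OF assms] by simp
      also have "\<dots> \<le> prob {w. cdf M w < 1}" using c by (intro finite_measure_mono) auto
      finally show "c \<le> prob {w. cdf M w < 1}" .
    qed simp
  qed simp
  then have "AE w in M. w \<in> {w. cdf M w < 1}" by (rule prob_eq_1[THEN iffD1, rotated]) simp
  ultimately show ?thesis by eventually_elim auto
qed

text \<open>Joint measurability in the parameter and the level is the delicate point. Almost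
  everywhere, \<open>Q a w \<le> t\<close> is equivalent to
  \<open>cdf \<Phi> w \<le> cdf (\<mu> a) t\<close>, a condition measurable in \<open>(a, w)\<close>
  for each \<open>t\<close>. The embedding \<open>e\<close> and the retraction \<open>r\<close>
  carry the construction to the real line and back.\<close>

lemma kernel_randomization:
  fixes m :: "'a metric"
  assumes \<kappa>[measurable]: "\<kappa> \<in> M \<rightarrow>\<^sub>M prob_algebra (metric_borel m)"
    and compl: "mcomplete_of m" and sep: "separable_space (mtopology_of m)"
    and \<Phi>: "real_distribution \<Phi>" and cont: "continuous_on UNIV (cdf \<Phi>)"
  obtains \<tau> where "(\<lambda>(a, w). \<tau> a w) \<in> M \<Otimes>\<^sub>M borel \<rightarrow>\<^sub>M metric_borel m"
    "\<And>a. a \<in> space M \<Longrightarrow> distr \<Phi> (metric_borel m) (\<tau> a) = \<kappa> a"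
\<comment> \<open>Without a parameter, no kernel value witnesses that \<open>mspace m\<close> is
  nonempty, as the retraction requires.\<close>
proof (cases "space M = {}")
  case True
  have "(\<lambda>(a, w). undefined) \<in> M \<Otimes>\<^sub>M borel \<rightarrow>\<^sub>M metric_borel m"
    by (auto intro!: measurableI simp: space_pair_measure True)
  then show ?thesis using that[of "\<lambda>_ _. undefined"] True by auto
next
  case False
  have \<kappa>D: "prob_space (\<kappa> a)" "sets (\<kappa> a) = sets (metric_borel m)" "space (\<kappa> a) = mspace m"
    if "a \<in> space M" for a
    using measurable_space[OF \<kappa> that] sets_eq_imp_space_eq[of "\<kappa> a" "metric_borel m"]
    by (auto simp: space_prob_algebra)
  then have ne: "mspace m \<noteq> {}" using False prob_space.not_empty by fastforce
  obtain e :: "'a \<Rightarrow> real" and r :: "real \<Rightarrow> 'a" where e: "e \<in> metric_borel m \<rightarrow>\<^sub>M borel"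
    and r: "r \<in> borel \<rightarrow>\<^sub>M metric_borel m" and re: "\<And>x. x \<in> mspace m \<Longrightarrow> r (e x) = x"
    using polish_measurable_retract[OF compl sep ne] by blast
  note [measurable] = e r
  interpret P: real_distribution \<Phi> by fact
  interpret P: cdf_distribution \<Phi> by standard
  define \<mu> where "\<mu> a = distr (\<kappa> a) borel e" for a
  have e': "e \<in> \<kappa> a \<rightarrow>\<^sub>M borel" if "a \<in> space M" for a
    using e measurable_cong_sets[OF \<kappa>D(2)[OF that] refl] by blast
  have \<mu>: "real_distribution (\<mu> a)" if "a \<in> space M" for a
    unfolding \<mu>_def using prob_space.real_distribution_distr[OF \<kappa>D(1)[OF that] e'[OF that]] .
  \<comment> \<open>The value 0 is a default for the levels 0 and 1, which occur with probability
    0.\<close>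
  define Q where "Q a w = (if 0 < cdf \<Phi> w \<and> cdf \<Phi> w < 1 then Inf {t. cdf \<Phi> w \<le> cdf (\<mu> a) t} else 0)" for a w
  have Q_le: "Q a w \<le> t \<longleftrightarrow> cdf \<Phi> w \<le> cdf (\<mu> a) t"
    if "a \<in> space M" "0 < cdf \<Phi> w" "cdf \<Phi> w < 1" for a w t
  proof -
    interpret real_distribution "\<mu> a" using \<mu>[OF that(1)] .
    interpret cdf_distribution "\<mu> a" by standard
    show ?thesis using pseudoinverse[of "cdf \<Phi> w" t] that unfolding Q_def by simp
  qed
  have [measurable]: "(\<lambda>a. cdf (\<mu> a) t) \<in> borel_measurable M" for t
  proof -
    have "cdf (\<mu> a) t = measure (\<kappa> a) (e -` {..t} \<inter> space (metric_borel m))" if "a \<in> space M" for a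
      unfolding cdf_def \<mu>_def using that by (subst measure_distr[OF e']) (auto simp: \<kappa>D)
    moreover have "(\<lambda>a. measure (\<kappa> a) (e -` {..t} \<inter> space (metric_borel m))) \<in> borel_measurable M"
      by (rule measurable_compose[OF \<kappa> measurable_measure_prob_algebra]) measurable
    ultimately show ?thesis by (simp cong: measurable_cong)
  qed
  have [measurable]: "cdf \<Phi> \<in> borel_measurable borel" by simp
  have Q_meas: "(\<lambda>(a, w). Q a w) \<in> M \<Otimes>\<^sub>M borel \<rightarrow>\<^sub>M borel"
    unfolding borel_measurable_iff_le
  proof
    fix t
    have "{x \<in> space (M \<Otimes>\<^sub>M borel). (case x of (a, w) \<Rightarrow> Q a w) \<le> t} =
      {x \<in> space (M \<Otimes>\<^sub>M borel). if 0 < cdf \<Phi> (snd x) \<and> cdf \<Phi> (snd x) < 1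
         then cdf \<Phi> (snd x) \<le> cdf (\<mu> (fst x)) t else 0 \<le> t}"
      using Q_le by (auto simp: space_pair_measure Q_def[of _ w for w] split: if_splits)
    also have "\<dots> \<in> sets (M \<Otimes>\<^sub>M borel)" by measurable
    finally show "{x \<in> space (M \<Otimes>\<^sub>M borel). (case x of (a, w) \<Rightarrow> Q a w) \<le> t} \<in> sets (M \<Otimes>\<^sub>M borel)" .
  qed
  show ?thesis
  proof (rule that[of "\<lambda>a w. r (Q a w)"])
    show "(\<lambda>(a, w). r (Q a w)) \<in> M \<Otimes>\<^sub>M borel \<rightarrow>\<^sub>M metric_borel m"
      using measurable_compose[OF Q_meas r] by (simp add: case_prod_beta)
  next
    fix a assume a: "a \<in> space M"
    have Qa: "Q a \<in> borel_measurable borel"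
      using measurable_compose[OF measurable_Pair1'[OF a] Q_meas] by simp
    then have Qa': "Q a \<in> \<Phi> \<rightarrow>\<^sub>M borel" by simp
    interpret m: real_distribution "\<mu> a" by (rule \<mu>[OF a])
    have "distr \<Phi> borel (Q a) = \<mu> a"
    proof (rule cdf_unique)
      show "real_distribution (distr \<Phi> borel (Q a))"
        by (rule P.real_distribution_distr[OF Qa'])
      show "cdf (distr \<Phi> borel (Q a)) = cdf (\<mu> a)"
      proof
        fix t
        have ae: "AE w in \<Phi>. (Q a w \<le> t) = (cdf \<Phi> w \<le> cdf (\<mu> a) t)"
          using AE_cdf_in_Ioo[OF \<Phi> cont] by eventually_elim (use Q_le a in auto)
        have "cdf (distr \<Phi> borel (Q a)) t = measure \<Phi> {w \<in> space \<Phi>. Q a w \<le> t}"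
          unfolding cdf_def by (subst measure_distr[OF Qa']) (auto intro!: arg_cong[where f = "measure \<Phi>"])
        also have "\<dots> = measure \<Phi> {w \<in> space \<Phi>. cdf \<Phi> w \<le> cdf (\<mu> a) t}"
          by (intro P.finite_measure_eq_AE) (use ae Qa' in \<open>auto simp: pred_def\<close>)
        also have "\<dots> = cdf (\<mu> a) t"
        \<comment> \<open>\<open>measure_cdf_le\<close> covers the levels below 1; at level 1 the
          event is the whole space.\<close>
        proof (cases "cdf (\<mu> a) t < 1")
          case True
          then show ?thesis using measure_cdf_le[OF \<Phi> cont m.cdf_nonneg True] by simp
        next
          case False
          then have "cdf (\<mu> a) t = 1" using m.cdf_bounded_prob[of t] by simp
          then show ?thesis using P.cdf_bounded_prob P.prob_space by simp
        qed
        finally show "cdf (distr \<Phi> borel (Q a)) t = cdf (\<mu> a) t" .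
      qed
    qed (rule \<mu>[OF a])
    then have "distr \<Phi> (metric_borel m) (\<lambda>w. r (Q a w)) = distr (\<mu> a) (metric_borel m) r"
      using distr_distr[OF r Qa'] by (simp add: comp_def)
    also have "\<dots> = distr (\<kappa> a) (metric_borel m) (\<lambda>x. r (e x))"
      unfolding \<mu>_def using distr_distr[OF r e'[OF a]] by (simp add: comp_def)
    also have "\<dots> = distr (\<kappa> a) (\<kappa> a) (\<lambda>x. x)"
      by (intro distr_cong) (use a \<kappa>D re in auto)
    also have "\<dots> = \<kappa> a" by (rule distr_id2) simp
    finally show "distr \<Phi> (metric_borel m) (\<lambda>w. r (Q a w)) = \<kappa> a" .
  qed
qed


section \<open>Factors as functions of independent random effects\<close>

lemma distr_PiM_finite:
  assumes fin: "finite I" and M: "\<And>i. i \<in> I \<Longrightarrow> prob_space (M i)"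
    and f: "\<And>i. i \<in> I \<Longrightarrow> f i \<in> M i \<rightarrow>\<^sub>M N i"
  shows "distr (PiM I M) (PiM I N) (\<lambda>x. \<lambda>i\<in>I. f i (x i)) = PiM I (\<lambda>i. distr (M i) (N i) (f i))"
proof -
  \<comment> \<open>\<open>product_prob_space\<close> asks for probability measures at all indices,
    so point masses fill the indices outside \<open>I\<close>.\<close>
  define M' where "M' i = (if i \<in> I then M i else return (count_space UNIV) undefined)" for i
  define D where "D i = (if i \<in> I then distr (M i) (N i) (f i) else return (count_space UNIV) undefined)" for i
  interpret M': product_prob_space M'
    by (rule product_prob_spaceI) (auto simp: M'_def M intro!: prob_space_return)
  interpret D: product_prob_space D
    by (rule product_prob_spaceI)
       (auto simp: D_def intro!: prob_space_return prob_space.prob_space_distr M f)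
  have PM: "PiM I M = PiM I M'" by (intro PiM_cong) (auto simp: M'_def)
  have F: "(\<lambda>x. \<lambda>i\<in>I. f i (x i)) \<in> PiM I M' \<rightarrow>\<^sub>M PiM I N"
  proof (rule measurable_restrict)
    fix i assume i: "i \<in> I"
    have "f i \<in> M' i \<rightarrow>\<^sub>M N i" using f[OF i] i by (simp add: M'_def)
    then show "(\<lambda>x. f i (x i)) \<in> PiM I M' \<rightarrow>\<^sub>M N i"
      by (rule measurable_compose[OF measurable_component_singleton[OF i]])
  qed
  have "distr (PiM I M') (PiM I N) (\<lambda>x. \<lambda>i\<in>I. f i (x i)) = PiM I D"
  proof (rule D.PiM_eqI[OF fin])
    show "sets (distr (PiM I M') (PiM I N) (\<lambda>x. \<lambda>i\<in>I. f i (x i))) = sets (PiM I D)"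
      by (simp add: D_def cong: sets_PiM_cong)
    fix A assume A: "\<And>i. i \<in> I \<Longrightarrow> A i \<in> sets (D i)"
    then have A': "A i \<in> sets (N i)" if "i \<in> I" for i using that by (fastforce simp: D_def)
    have vim: "f i -` A i \<inter> space (M' i) \<in> sets (M' i)" if "i \<in> I" for i
      using that A' f by (auto simp: M'_def)
    have "emeasure (distr (PiM I M') (PiM I N) (\<lambda>x. \<lambda>i\<in>I. f i (x i))) (Pi\<^sub>E I A)
        = emeasure (PiM I M') ((\<lambda>x. \<lambda>i\<in>I. f i (x i)) -` (Pi\<^sub>E I A) \<inter> space (PiM I M'))"
      by (rule emeasure_distr[OF F]) (intro sets_PiM_I_finite fin A')
    also have "(\<lambda>x. \<lambda>i\<in>I. f i (x i)) -` (Pi\<^sub>E I A) \<inter> space (PiM I M')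
        = (\<Pi>\<^sub>E i\<in>I. f i -` A i \<inter> space (M' i))"
      by (auto simp: space_PiM PiE_iff)
    also have "emeasure (PiM I M') \<dots> = (\<Prod>i\<in>I. emeasure (M' i) (f i -` A i \<inter> space (M' i)))"
      by (intro M'.emeasure_PiM fin vim)
    also have "\<dots> = (\<Prod>i\<in>I. emeasure (D i) (A i))"
      using A' f by (intro prod.cong refl) (simp add: D_def M'_def emeasure_distr)
    finally show "emeasure (distr (PiM I M') (PiM I N) (\<lambda>x. \<lambda>i\<in>I. f i (x i))) (Pi\<^sub>E I A)
        = (\<Prod>i\<in>I. emeasure (D i) (A i))" .
  qed
  also have "PiM I D = PiM I (\<lambda>i. distr (M i) (N i) (f i))"
    by (intro PiM_cong) (auto simp: D_def)
  finally show ?thesis by (simp add: PM)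
qed

text \<open>Because \<open>P\<close> does not depend on \<open>w\<close>, drawing \<open>w\<close>
  and then \<open>v\<close> amounts to one draw from the product measure. This turns a conditional
  level of \<open>factor_law\<close> into a function of independent effects.\<close>

lemma bind_distr_eq_distr_pair:
  assumes M: "prob_space M" and P: "prob_space P" and g: "g \<in> M \<Otimes>\<^sub>M P \<rightarrow>\<^sub>M N"
  shows "M \<bind> (\<lambda>w. distr P N (\<lambda>v. g (w, v))) = distr (M \<Otimes>\<^sub>M P) N g"
proof -
  interpret M: prob_space M by fact
  interpret P: prob_space P by fact
  have K: "(\<lambda>w. distr P N (\<lambda>v. g (w, v))) \<in> M \<rightarrow>\<^sub>M subprob_algebra N"
    by (rule measurable_distr2[where M = P])
       (use g P.M_in_subprob in \<open>auto simp: case_prod_beta\<close>)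
  show ?thesis
  proof (rule measure_eqI)
    show "sets (M \<bind> (\<lambda>w. distr P N (\<lambda>v. g (w, v)))) = sets (distr (M \<Otimes>\<^sub>M P) N g)"
      using M.not_empty by (subst sets_bind[of _ _ N]) auto
    then show "emeasure (M \<bind> (\<lambda>w. distr P N (\<lambda>v. g (w, v)))) A = emeasure (distr (M \<Otimes>\<^sub>M P) N g) A"
      if "A \<in> sets (M \<bind> (\<lambda>w. distr P N (\<lambda>v. g (w, v))))" for A
    proof -
      have A: "A \<in> sets N" using that \<open>sets _ = sets _\<close> by simp
      have "emeasure (M \<bind> (\<lambda>w. distr P N (\<lambda>v. g (w, v)))) A
          = (\<integral>\<^sup>+w. emeasure (distr P N (\<lambda>v. g (w, v))) A \<partial>M)"
        by (rule emeasure_bind[OF M.not_empty K A])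
      also have "\<dots> = (\<integral>\<^sup>+w. emeasure P (Pair w -` (g -` A \<inter> space (M \<Otimes>\<^sub>M P))) \<partial>M)"
      proof (rule nn_integral_cong)
        fix w assume w: "w \<in> space M"
        have "emeasure (distr P N (\<lambda>v. g (w, v))) A = emeasure P ((\<lambda>v. g (w, v)) -` A \<inter> space P)"
          by (rule emeasure_distr[OF measurable_compose[OF measurable_Pair1'[OF w] g] A])
        also have "(\<lambda>v. g (w, v)) -` A \<inter> space P = Pair w -` (g -` A \<inter> space (M \<Otimes>\<^sub>M P))"
          using w by (auto simp: space_pair_measure)
        finally show "emeasure (distr P N (\<lambda>v. g (w, v))) A
            = emeasure P (Pair w -` (g -` A \<inter> space (M \<Otimes>\<^sub>M P)))" .
      qed
      also have "\<dots> = emeasure (M \<Otimes>\<^sub>M P) (g -` A \<inter> space (M \<Otimes>\<^sub>M P))"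
        by (rule P.emeasure_pair_measure_alt[symmetric]) (rule measurable_sets[OF g A])
      also have "\<dots> = emeasure (distr (M \<Otimes>\<^sub>M P) N g) A"
        by (rule emeasure_distr[OF g A, symmetric])
      finally show ?thesis .
    qed
  qed
qed

section \<open>Labels and their ancestors\<close>

lemma finite_units [simp]: "finite (units N l)"
proof (induction l)
  case (Suc l)
  have "units N (Suc l) = (\<Union>i\<in>units N l. (\<lambda>j. i @ [j]) ` {1..N i})" by auto
  then show ?case using Suc by simp
qed simp

lemma length_units: "i \<in> units N l \<Longrightarrow> length i = l"
  by (induction l arbitrary: i) auto

lemma take_units: "i \<in> units N l \<Longrightarrow> m \<le> l \<Longrightarrow> take m i \<in> units N m"
proof (induction l arbitrary: i)
  case (Suc l)
  then obtain i' j where i: "i = i' @ [j]" "i' \<in> units N l" by auto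
  show ?case
  proof (cases "m = Suc l")
    case True
    then show ?thesis using Suc.prems length_units[OF Suc.prems(1)] by simp
  next
    case False
    then show ?thesis using Suc i length_units[OF i(2)] by simp
  qed
qed simp

lemma finite_units_upto [simp]: "finite (units_upto N l)"
  by (simp add: units_upto_def)

lemma units_upto_0 [simp]: "units_upto N 0 = {}"
  by (simp add: units_upto_def)

lemma units_upto_Suc: "units_upto N (Suc l) = units_upto N l \<union> units N (Suc l)"
  unfolding units_upto_def by (auto simp: atLeastAtMostSuc_conv simp del: units.simps)

lemma length_units_upto: "i \<in> units_upto N l \<Longrightarrow> length i \<in> {1..l}"
  unfolding units_upto_def by (metis UN_iff length_units)

lemma units_upto_disjoint: "units_upto N l \<inter> units N (Suc l) = {}"
proof -
  have "i \<notin> units N (Suc l)" if "i \<in> units_upto N l" for i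
    using length_units_upto[OF that] length_units[of i N "Suc l"] by fastforce
  then show ?thesis by blast
qed

lemma take_units_upto:
  "i \<in> units N n \<Longrightarrow> m \<le> n \<Longrightarrow> m \<in> {1..l} \<Longrightarrow> take m i \<in> units_upto N l"
  using take_units[of i N n m] by (auto simp: units_upto_def simp del: units.simps)

lemma measurable_ancestors:
  assumes i: "i \<in> units N (Suc l)"
  shows "(\<lambda>\<theta>. ancestors \<theta> i) \<in> (\<Pi>\<^sub>M i\<in>units_upto N l. M (length i)) \<rightarrow>\<^sub>M PiM {1..<Suc l} M"
  unfolding ancestors_def length_units[OF i]
proof (rule measurable_restrict)
  fix m assume m: "m \<in> {1..<Suc l}"
  then have "take m i \<in> units_upto N l" using take_units_upto[OF i, of m l] by simp
  then have "(\<lambda>\<theta>. \<theta> (take m i)) \<in> (\<Pi>\<^sub>M i\<in>units_upto N l. M (length i)) \<rightarrow>\<^sub>M M (length (take m i))"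
    by (rule measurable_component_singleton)
  then show "(\<lambda>\<theta>. \<theta> (take m i)) \<in> (\<Pi>\<^sub>M i\<in>units_upto N l. M (length i)) \<rightarrow>\<^sub>M M m"
    using length_units[OF i] m by simp
qed

text \<open>Prefixes of different lengths are different units, so the effects along a branch are
  distinct coordinates of the product measure. Their joint law does not depend on the design, and
  therefore one approximating sequence can serve all designs.\<close>

lemma distr_ancestors:
  fixes M :: "nat \<Rightarrow> 'a measure"
  assumes i: "i \<in> units N (Suc l)" and M: "\<And>m. prob_space (M m)"
  shows "distr (\<Pi>\<^sub>M i\<in>units_upto N l. M (length i)) (PiM {1..l} M) (\<lambda>w. ancestors w i) = PiM {1..l} M"
proof -
  have len: "length (take m i) = m" if "m \<in> {1..l}" for m using length_units[OF i] that by simp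
  have "inj_on (\<lambda>m. take m i) {1..l}" by (rule inj_on_inverseI[of _ length]) (rule len)
  moreover have "(\<lambda>m. take m i) \<in> {1..l} \<rightarrow> units_upto N l"
    using take_units_upto[OF i, of _ l] by auto
  ultimately have D: "distr (\<Pi>\<^sub>M i\<in>units_upto N l. M (length i)) (\<Pi>\<^sub>M m\<in>{1..l}. M (length (take m i)))
      (\<lambda>w. \<lambda>m\<in>{1..l}. w (take m i)) = (\<Pi>\<^sub>M m\<in>{1..l}. M (length (take m i)))"
    by (intro distr_PiM_reindex M)
  have eq: "(\<Pi>\<^sub>M m\<in>{1..l}. M (length (take m i))) = PiM {1..l} M"
    by (intro PiM_cong refl) (simp only: len)
  have "(\<lambda>w :: nat list \<Rightarrow> 'a. \<lambda>m\<in>{1..l}. w (take m i)) = (\<lambda>w. ancestors w i)"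
    unfolding ancestors_def length_units[OF i] atLeastLessThanSuc_atLeastAtMost ..
  with D show ?thesis unfolding eq by (simp only:)
qed

section \<open>Factors along one branch and over a whole design\<close>

primrec latent :: "(nat \<Rightarrow> (nat \<Rightarrow> 'a) \<Rightarrow> real \<Rightarrow> 'a) \<Rightarrow> nat \<Rightarrow> (nat \<Rightarrow> real) \<Rightarrow> nat \<Rightarrow> 'a" where
  "latent \<tau> 0 w = (\<lambda>_. undefined)"
| "latent \<tau> (Suc l) w = (latent \<tau> l w)(Suc l := \<tau> (Suc l) (latent \<tau> l w) (w (Suc l)))"

text \<open>Starting from the function that is \<open>undefined\<close> everywhere makes
  \<open>latent \<tau> l w\<close> a point of the product space over \<open>{1..l}\<close>, on which
  the kernel of level \<open>Suc l\<close> acts.\<close>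

lemma latent_extensional: "latent \<tau> l w \<in> extensional {1..l}"
  by (induction l) (auto simp: extensional_def)

lemma latent_cong: "(\<And>m. m \<in> {1..l} \<Longrightarrow> w m = w' m) \<Longrightarrow> latent \<tau> l w = latent \<tau> l w'"
  by (induction l) auto

lemma latent_level: "m \<le> l \<Longrightarrow> 1 \<le> m \<Longrightarrow> latent \<tau> l w m = latent \<tau> m w m"
  by (induction l) (auto simp: le_Suc_eq)

text \<open>The effects enter through a map \<open>g\<close> so that the lemma serves both a single
  branch and the branches read off from the prefixes of a label.\<close>

lemma measurable_latent:
  assumes \<tau>: "\<And>m. m \<in> {1..l} \<Longrightarrow> (\<lambda>(a, w). \<tau> m a w) \<in> PiM {1..<m} \<Theta> \<Otimes>\<^sub>M borel \<rightarrow>\<^sub>M \<Theta> m"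
    and g: "\<And>m. m \<in> {1..l} \<Longrightarrow> (\<lambda>x. g x m) \<in> borel_measurable M"
  shows "(\<lambda>x. latent \<tau> l (g x)) \<in> M \<rightarrow>\<^sub>M PiM {1..l} \<Theta>"
  using assms
proof (induction l)
  case 0
  then show ?case by (auto intro!: measurableI simp: space_PiM PiM_empty)
next
  case (Suc l)
  have IH: "(\<lambda>x. latent \<tau> l (g x)) \<in> M \<rightarrow>\<^sub>M PiM {1..l} \<Theta>"
    using Suc by (intro Suc.IH) auto
  have "(\<lambda>x. (latent \<tau> l (g x), g x (Suc l))) \<in> M \<rightarrow>\<^sub>M PiM {1..<Suc l} \<Theta> \<Otimes>\<^sub>M borel"
    using IH Suc.prems(2)[of "Suc l"] by (intro measurable_Pair) (auto simp: atLeastLessThanSuc_atLeastAtMost)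
  from measurable_compose[OF this Suc.prems(1)[of "Suc l"]]
  have "(\<lambda>x. \<tau> (Suc l) (latent \<tau> l (g x)) (g x (Suc l))) \<in> M \<rightarrow>\<^sub>M \<Theta> (Suc l)" by simp
  then have "(\<lambda>x. (latent \<tau> l (g x))(Suc l := \<tau> (Suc l) (latent \<tau> l (g x)) (g x (Suc l))))
      \<in> M \<rightarrow>\<^sub>M PiM {1..Suc l} \<Theta>"
    by (intro measurable_fun_upd[OF _ IH]) (auto simp: atLeastAtMostSuc_conv)
  then show ?case by (simp only: latent.simps)
qed

text \<open>Each unit recomputes its whole branch from the effects of its prefixes. Units with a
  common ancestor read the same effects there, so they agree on its factor.\<close>

definition latent_field ::
    "(nat \<Rightarrow> (nat \<Rightarrow> 'a) \<Rightarrow> real \<Rightarrow> 'a) \<Rightarrow> (nat list \<Rightarrow> nat) \<Rightarrow> nat \<Rightarrow> (nat list \<Rightarrow> real) \<Rightarrow> nat list \<Rightarrow> 'a" where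
  "latent_field \<tau> N l w =
     (\<lambda>i\<in>units_upto N l. latent \<tau> (length i) (\<lambda>m. w (take m i)) (length i))"

lemma ancestors_latent_field:
  assumes "i \<in> units N (Suc l)"
  shows "ancestors (latent_field \<tau> N l w) i = latent \<tau> l (\<lambda>m. w (take m i))"
proof
  fix m
  show "ancestors (latent_field \<tau> N l w) i m = latent \<tau> l (\<lambda>m. w (take m i)) m"
  proof (cases "m \<in> {1..l}")
    case True
    then have "take m i \<in> units_upto N l"
      using assms by (intro take_units_upto[of i N "Suc l"]) (auto simp del: units.simps)
    moreover have "length (take m i) = m" using True length_units[OF assms] by simp
    moreover have "latent \<tau> m (\<lambda>m'. w (take m' (take m i))) = latent \<tau> m (\<lambda>m'. w (take m' i))"
      by (rule latent_cong) (simp add: min_def)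
    ultimately show ?thesis
      using True length_units[OF assms] latent_level[of m l \<tau> "\<lambda>m. w (take m i)"]
      by (simp add: ancestors_def latent_field_def)
  next
    case False
    then show ?thesis
      using length_units[OF assms] latent_extensional[of \<tau> l "\<lambda>m. w (take m i)"]
      by (auto simp: ancestors_def extensional_def)
  qed
qed

lemma measurable_latent_field:
  assumes \<tau>: "\<And>m. m \<in> {1..l} \<Longrightarrow>
      (\<lambda>(a, w). \<tau> m a w) \<in> (\<Pi>\<^sub>M k\<in>{1..<m}. metric_borel (\<Theta> k)) \<Otimes>\<^sub>M borel \<rightarrow>\<^sub>M metric_borel (\<Theta> m)"
    and \<Phi>: "\<And>m. sets (\<Phi> m) = sets borel"
  shows "latent_field \<tau> N l \<in> (\<Pi>\<^sub>M i\<in>units_upto N l. \<Phi> (length i)) \<rightarrow>\<^sub>M factor_space \<Theta> (units_upto N l)"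
  unfolding latent_field_def factor_space_def
proof (rule measurable_restrict)
  fix i assume i: "i \<in> units_upto N l"
  define n where "n = length i"
  have n: "n \<in> {1..l}" "i \<in> units N n"
    using length_units_upto[OF i] i length_units by (auto simp: n_def units_upto_def simp del: units.simps)
  have c: "(\<lambda>w. w (take m i)) \<in> borel_measurable (\<Pi>\<^sub>M i\<in>units_upto N l. \<Phi> (length i))" if "m \<in> {1..n}" for m
  proof -
    have "take m i \<in> units_upto N l" using that n by (intro take_units_upto) auto
    then have "(\<lambda>w. w (take m i)) \<in> (\<Pi>\<^sub>M i\<in>units_upto N l. \<Phi> (length i)) \<rightarrow>\<^sub>M \<Phi> (length (take m i))"
      by (rule measurable_component_singleton)
    then show ?thesis using measurable_cong_sets[OF refl \<Phi>] by blast
  qed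
  have "(\<lambda>w. latent \<tau> n (\<lambda>m. w (take m i))) \<in> (\<Pi>\<^sub>M i\<in>units_upto N l. \<Phi> (length i))
      \<rightarrow>\<^sub>M (\<Pi>\<^sub>M k\<in>{1..n}. metric_borel (\<Theta> k))"
    using n by (intro measurable_latent \<tau> c) auto
  moreover have "n \<in> {1..n}" using n by simp
  ultimately have "(\<lambda>w. latent \<tau> n (\<lambda>m. w (take m i)) n)
      \<in> (\<Pi>\<^sub>M i\<in>units_upto N l. \<Phi> (length i)) \<rightarrow>\<^sub>M metric_borel (\<Theta> n)"
    by (rule measurable_compose[OF _ measurable_component_singleton])
  then show "(\<lambda>w. latent \<tau> (length i) (\<lambda>m. w (take m i)) (length i))
      \<in> (\<Pi>\<^sub>M i\<in>units_upto N l. \<Phi> (length i)) \<rightarrow>\<^sub>M metric_borel (\<Theta> (length i))"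
    unfolding n_def .
qed

lemma merge_apply:
  "i \<in> I \<Longrightarrow> merge I J (x, y) i = x i" "i \<notin> I \<Longrightarrow> i \<in> J \<Longrightarrow> merge I J (x, y) i = y i"
  by (auto simp: merge_def)

text \<open>Units up to level \<open>l\<close> read only effects of prefixes, which the merge leaves
  unchanged; a new unit reads the old field at its ancestors and one new effect. This identity
  drives the induction over levels.\<close>

lemma latent_field_merge:
  "merge (units_upto N l) (units N (Suc l))
     (latent_field \<tau> N l w, \<lambda>i\<in>units N (Suc l). \<tau> (Suc l) (ancestors (latent_field \<tau> N l w) i) (v i))
   = latent_field \<tau> N (Suc l) (merge (units_upto N l) (units N (Suc l)) (w, v))"
proof
  let ?U = "units_upto N l" and ?u = "units N (Suc l)"
  fix i
  note [simp del] = units.simps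
  consider "i \<in> ?U" | "i \<in> ?u" "i \<notin> ?U" | "i \<notin> ?U" "i \<notin> ?u" by blast
  then show "merge ?U ?u (latent_field \<tau> N l w, \<lambda>i\<in>?u. \<tau> (Suc l) (ancestors (latent_field \<tau> N l w) i) (v i)) i
    = latent_field \<tau> N (Suc l) (merge ?U ?u (w, v)) i"
  proof cases
    case 1
    then have n: "i \<in> units N (length i)" "length i \<le> l"
      using length_units length_units_upto[OF 1] by (auto simp: units_upto_def)
    have "latent \<tau> (length i) (\<lambda>m. w (take m i)) = latent \<tau> (length i) (\<lambda>m. merge ?U ?u (w, v) (take m i))"
    proof (rule latent_cong)
      fix m assume "m \<in> {1..length i}"
      then have "take m i \<in> ?U" using n by (intro take_units_upto[of i N "length i"]) auto
      then show "w (take m i) = merge ?U ?u (w, v) (take m i)" by (simp add: merge_apply)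
    qed
    then show ?thesis using 1 by (simp add: merge_apply latent_field_def units_upto_Suc)
  next
    case 2
    have "latent \<tau> l (\<lambda>m. w (take m i)) = latent \<tau> l (\<lambda>m. merge ?U ?u (w, v) (take m i))"
    proof (rule latent_cong)
      fix m assume "m \<in> {1..l}"
      then have "take m i \<in> ?U" using 2 by (intro take_units_upto[of i N "Suc l"]) auto
      then show "w (take m i) = merge ?U ?u (w, v) (take m i)" by (simp add: merge_apply)
    qed
    then have "latent_field \<tau> N (Suc l) (merge ?U ?u (w, v)) i = \<tau> (Suc l) (latent \<tau> l (\<lambda>m. w (take m i))) (v i)"
      using 2 length_units[OF 2(1)] by (simp add: merge_apply latent_field_def units_upto_Suc)
    then show ?thesis
      using 2 by (simp add: merge_apply ancestors_latent_field)
  next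
    case 3
    then show ?thesis by (simp add: merge_def latent_field_def units_upto_Suc)
  qed
qed

text \<open>Every factor is a function of the random effects of the unit and of its ancestors, so the
  dependent factors become functions of independent random effects.\<close>

proposition factor_law_eq_distr:
  fixes \<Theta> :: "nat \<Rightarrow> 'a metric"
  assumes \<tau>: "\<And>m. m \<in> {1..l} \<Longrightarrow>
      (\<lambda>(a, w). \<tau> m a w) \<in> (\<Pi>\<^sub>M k\<in>{1..<m}. metric_borel (\<Theta> k)) \<Otimes>\<^sub>M borel \<rightarrow>\<^sub>M metric_borel (\<Theta> m)"
    and G: "\<And>m a. m \<in> {1..l} \<Longrightarrow> a \<in> space (\<Pi>\<^sub>M k\<in>{1..<m}. metric_borel (\<Theta> k)) \<Longrightarrow>
      distr (\<Phi> m) (metric_borel (\<Theta> m)) (\<tau> m a) = G m a"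
    and \<Phi>: "\<And>m. real_distribution (\<Phi> m)"
  shows "factor_law \<Theta> G N l =
    distr (\<Pi>\<^sub>M i\<in>units_upto N l. \<Phi> (length i)) (factor_space \<Theta> (units_upto N l)) (latent_field \<tau> N l)"
  using \<tau> G
proof (induction l)
  case 0
  have "prob_space (\<Pi>\<^sub>M i::nat list\<in>{}. \<Phi> (length i))" by (rule prob_space_PiM) auto
  then have "distr (\<Pi>\<^sub>M i::nat list\<in>{}. \<Phi> (length i)) (factor_space \<Theta> {}) (\<lambda>_. \<lambda>_. undefined)
      = return (factor_space \<Theta> {}) (\<lambda>_. undefined)"
    by (intro prob_space.distr_const) (auto simp: factor_space_def space_PiM)
  moreover have "latent_field \<tau> N 0 = (\<lambda>_ _. undefined)"
    by (auto simp: latent_field_def fun_eq_iff)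
  ultimately show ?case by simp
next
  case (Suc l)
  note [simp del] = units.simps
  interpret \<Phi>: real_distribution "\<Phi> m" for m by (rule \<Phi>)
  let ?U = "units_upto N l" and ?u = "units N (Suc l)"
  let ?P = "\<lambda>I. \<Pi>\<^sub>M i\<in>I. \<Phi> (length i)"
  let ?S = "factor_space \<Theta> ?U" and ?S' = "factor_space \<Theta> (units_upto N (Suc l))"
  let ?mb = "metric_borel (\<Theta> (Suc l))"
  interpret P: product_prob_space "\<lambda>i::nat list. \<Phi> (length i)"
    by (rule product_prob_spaceI) (rule \<Phi>.prob_space_axioms)
  have PU: "prob_space (?P I)" for I by (rule prob_space_PiM) (rule \<Phi>.prob_space_axioms)
  have lf: "latent_field \<tau> N l \<in> ?P ?U \<rightarrow>\<^sub>M ?S"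
    using Suc.prems by (intro measurable_latent_field) auto
  have lf': "latent_field \<tau> N (Suc l) \<in> ?P (units_upto N (Suc l)) \<rightarrow>\<^sub>M ?S'"
    using Suc.prems by (intro measurable_latent_field) auto
  have anc: "(\<lambda>\<theta>. ancestors \<theta> i) \<in> ?S \<rightarrow>\<^sub>M (\<Pi>\<^sub>M k\<in>{1..<Suc l}. metric_borel (\<Theta> k))" if "i \<in> ?u" for i
    unfolding factor_space_def by (rule measurable_ancestors[OF that])
  have \<tau>S: "(\<lambda>(a, w). \<tau> (Suc l) a w) \<in> (\<Pi>\<^sub>M k\<in>{1..<Suc l}. metric_borel (\<Theta> k)) \<Otimes>\<^sub>M borel \<rightarrow>\<^sub>M ?mb"
    by (rule Suc.prems(1)) simp
  define h where "h \<theta> v = merge ?U ?u (\<theta>, \<lambda>i\<in>?u. \<tau> (Suc l) (ancestors \<theta> i) (v i))" for \<theta> v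
  have merge_meas: "merge ?U ?u \<in> ?S \<Otimes>\<^sub>M factor_space \<Theta> ?u \<rightarrow>\<^sub>M ?S'"
    unfolding factor_space_def units_upto_Suc by (rule measurable_merge)
  have h: "(\<lambda>(\<theta>, v). h \<theta> v) \<in> ?S \<Otimes>\<^sub>M ?P ?u \<rightarrow>\<^sub>M ?S'"
  proof -
    have "(\<lambda>x. \<lambda>i\<in>?u. \<tau> (Suc l) (ancestors (fst x) i) (snd x i)) \<in> ?S \<Otimes>\<^sub>M ?P ?u \<rightarrow>\<^sub>M factor_space \<Theta> ?u"
      unfolding factor_space_def[of \<Theta> ?u]
    proof (rule measurable_restrict)
      fix i assume i: "i \<in> ?u"
      have "(\<lambda>x. snd x i) \<in> ?S \<Otimes>\<^sub>M ?P ?u \<rightarrow>\<^sub>M \<Phi> (length i)"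
        by (rule measurable_compose[OF measurable_snd measurable_component_singleton[OF i]])
      then have sb: "(\<lambda>x. snd x i) \<in> borel_measurable (?S \<Otimes>\<^sub>M ?P ?u)"
        using measurable_cong_sets[OF refl \<Phi>.events_eq_borel] by blast
      have "(\<lambda>x. (ancestors (fst x) i, snd x i)) \<in> ?S \<Otimes>\<^sub>M ?P ?u
          \<rightarrow>\<^sub>M (\<Pi>\<^sub>M k\<in>{1..<Suc l}. metric_borel (\<Theta> k)) \<Otimes>\<^sub>M borel"
        by (intro measurable_Pair measurable_compose[OF measurable_fst anc[OF i]] sb)
      from measurable_compose[OF this \<tau>S]
      show "(\<lambda>x. \<tau> (Suc l) (ancestors (fst x) i) (snd x i)) \<in> ?S \<Otimes>\<^sub>M ?P ?u
          \<rightarrow>\<^sub>M metric_borel (\<Theta> (length i))"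
        unfolding length_units[OF i] case_prod_conv .
    qed
    then have "(\<lambda>x. (fst x, \<lambda>i\<in>?u. \<tau> (Suc l) (ancestors (fst x) i) (snd x i)))
        \<in> ?S \<Otimes>\<^sub>M ?P ?u \<rightarrow>\<^sub>M ?S \<Otimes>\<^sub>M factor_space \<Theta> ?u"
      by (intro measurable_Pair measurable_fst)
    from measurable_compose[OF this merge_meas] show ?thesis
      by (simp add: h_def case_prod_beta)
  qed
  define K where "K \<theta> = distr (?P ?u) ?S' (h \<theta>)" for \<theta>
  have K: "K \<in> ?S \<rightarrow>\<^sub>M subprob_algebra ?S'"
    unfolding K_def by (intro measurable_distr2[OF h] measurable_const prob_space.M_in_subprob PU)
  \<comment> \<open>Each kernel value is an image of some \<open>\<Phi> (length i)\<close> under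
    \<open>\<tau>\<close>, so the product of the kernels is the coordinatewise image of a product
    measure that is free of \<open>\<theta>\<close>.\<close>
  have K_eq: "distr (\<Pi>\<^sub>M i\<in>?u. G (Suc l) (ancestors \<theta> i)) ?S' (\<lambda>\<eta>. merge ?U ?u (\<theta>, \<eta>)) = K \<theta>"
    if \<theta>: "\<theta> \<in> space ?S" for \<theta>
  proof -
    have a: "ancestors \<theta> i \<in> space (\<Pi>\<^sub>M k\<in>{1..<Suc l}. metric_borel (\<Theta> k))" if "i \<in> ?u" for i
      using measurable_space[OF anc[OF that] \<theta>] .
    have \<tau>a: "\<tau> (Suc l) (ancestors \<theta> i) \<in> \<Phi> (length i) \<rightarrow>\<^sub>M ?mb" if "i \<in> ?u" for i
      using measurable_compose[OF measurable_Pair1'[OF a[OF that]] \<tau>S] by simp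
    have fs: "factor_space \<Theta> ?u = (\<Pi>\<^sub>M i\<in>?u. ?mb)"
      unfolding factor_space_def by (intro PiM_cong) (auto simp: length_units)
    have "(\<Pi>\<^sub>M i\<in>?u. G (Suc l) (ancestors \<theta> i))
        = (\<Pi>\<^sub>M i\<in>?u. distr (\<Phi> (length i)) ?mb (\<tau> (Suc l) (ancestors \<theta> i)))"
    proof (intro PiM_cong refl)
      fix i assume i: "i \<in> ?u"
      show "G (Suc l) (ancestors \<theta> i) = distr (\<Phi> (length i)) ?mb (\<tau> (Suc l) (ancestors \<theta> i))"
        unfolding length_units[OF i] by (rule Suc.prems(2)[OF _ a[OF i], symmetric]) simp
    qed
    also have "\<dots> = distr (?P ?u) (factor_space \<Theta> ?u) (\<lambda>v. \<lambda>i\<in>?u. \<tau> (Suc l) (ancestors \<theta> i) (v i))"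
      unfolding fs by (intro distr_PiM_finite[symmetric] finite_units \<Phi>.prob_space_axioms \<tau>a)
    finally have eq: "(\<Pi>\<^sub>M i\<in>?u. G (Suc l) (ancestors \<theta> i)) = \<dots>" .
    have m1: "(\<lambda>\<eta>. merge ?U ?u (\<theta>, \<eta>)) \<in> factor_space \<Theta> ?u \<rightarrow>\<^sub>M ?S'"
      by (rule measurable_compose[OF measurable_Pair1'[OF \<theta>] merge_meas])
    have m2: "(\<lambda>v. \<lambda>i\<in>?u. \<tau> (Suc l) (ancestors \<theta> i) (v i)) \<in> ?P ?u \<rightarrow>\<^sub>M factor_space \<Theta> ?u"
      unfolding fs
    proof (rule measurable_restrict)
      fix i assume i: "i \<in> ?u"
      show "(\<lambda>v. \<tau> (Suc l) (ancestors \<theta> i) (v i)) \<in> ?P ?u \<rightarrow>\<^sub>M ?mb"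
        using \<tau>a[OF i] by (rule measurable_compose[OF measurable_component_singleton[OF i]])
    qed
    show ?thesis
      unfolding eq K_def by (subst distr_distr[OF m1 m2]) (simp add: comp_def h_def[abs_def])
  qed
  have IH: "factor_law \<Theta> G N l = distr (?P ?U) ?S (latent_field \<tau> N l)"
    using Suc.prems by (intro Suc.IH) auto
  have "factor_law \<Theta> G N (Suc l) = distr (?P ?U) ?S (latent_field \<tau> N l) \<bind> K"
    unfolding factor_law.simps IH by (intro bind_cong refl K_eq) simp
  also have "\<dots> = ?P ?U \<bind> (\<lambda>w. K (latent_field \<tau> N l w))"
    by (rule bind_distr[OF lf K]) (rule prob_space.not_empty[OF PU])
  \<comment> \<open>The kernel at the old field produces the new field at the merged effects. What
    remains is a bind of two fixed measures, that is, an image of their product.\<close>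
  also have "\<dots> = ?P ?U \<bind> (\<lambda>w. distr (?P ?u) ?S' (\<lambda>v. latent_field \<tau> N (Suc l) (merge ?U ?u (w, v))))"
    unfolding K_def h_def[abs_def] latent_field_merge ..
  also have "\<dots> = distr (?P ?U \<Otimes>\<^sub>M ?P ?u) ?S' (\<lambda>x. latent_field \<tau> N (Suc l) (merge ?U ?u x))"
    by (rule bind_distr_eq_distr_pair[OF PU PU])
       (rule measurable_compose[OF measurable_merge lf'[unfolded units_upto_Suc], folded units_upto_Suc])
  also have "\<dots> = distr (distr (?P ?U \<Otimes>\<^sub>M ?P ?u) (?P (?U \<union> ?u)) (merge ?U ?u)) ?S' (latent_field \<tau> N (Suc l))"
  proof -
    have "latent_field \<tau> N (Suc l) \<in> ?P (?U \<union> ?u) \<rightarrow>\<^sub>M ?S'"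
      using lf' unfolding units_upto_Suc .
    from distr_distr[OF this measurable_merge] show ?thesis unfolding comp_def by (rule sym)
  qed
  also have "distr (?P ?U \<Otimes>\<^sub>M ?P ?u) (?P (?U \<union> ?u)) (merge ?U ?u) = ?P (units_upto N (Suc l))"
    unfolding units_upto_Suc by (rule P.distr_merge) (auto simp: units_upto_disjoint)
  finally show ?case .
qed


section \<open>Continuous functions on products of metric spaces\<close>

text \<open>Continuity refers to the product topology, measurability to the product of the Borel
  \<sigma>-algebras; separability closes the gap. Rounding each coordinate to a dense sequence gives
  functions of finitely many natural numbers, hence measurable ones, and \<open>f\<close> is their
  pointwise limit.\<close>

lemma borel_measurable_continuous_map_product:
  fixes \<Theta> :: "nat \<Rightarrow> 'a metric" and f :: "(nat \<Rightarrow> 'a) \<Rightarrow> real"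
  assumes fin: "finite I" and sep: "\<And>l. l \<in> I \<Longrightarrow> separable_space (mtopology_of (\<Theta> l))"
    and f: "continuous_map (product_topology (\<lambda>l. mtopology_of (\<Theta> l)) I) euclideanreal f"
  shows "f \<in> borel_measurable (\<Pi>\<^sub>M l\<in>I. metric_borel (\<Theta> l))"
proof (cases "\<exists>l\<in>I. mspace (\<Theta> l) = {}")
  case True
  then have E: "space (\<Pi>\<^sub>M l\<in>I. metric_borel (\<Theta> l)) = {}"
    by (auto simp: space_PiM PiE_eq_empty_iff)
  show ?thesis unfolding measurable_def E by simp
next
  case False
  let ?M = "\<Pi>\<^sub>M l\<in>I. metric_borel (\<Theta> l)"
  define s where "s l = (SOME s. dense_sequence (\<Theta> l) s)" for l
  have ds: "dense_sequence (\<Theta> l) (s l)" if "l \<in> I" for l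
  proof -
    have "mspace (\<Theta> l) \<noteq> {}" using False that by blast
    then show ?thesis unfolding s_def by (rule someI_ex[OF dense_sequence_exists[OF sep[OF that]]])
  qed
  have s: "s l k \<in> mspace (\<Theta> l)" if "l \<in> I" for l k
    using ds[OF that] by (auto simp: dense_sequence_def)
  have dense: "\<exists>k. mdist (\<Theta> l) (s l k) x < e" if "l \<in> I" "x \<in> mspace (\<Theta> l)" "0 < e" for l x e
    using ds[OF that(1)] that(2,3) unfolding dense_sequence_def by blast
  define idx where "idx n l x = (LEAST k. mdist (\<Theta> l) (s l k) x < (1/2) ^ n)" for n :: nat and l x
  have idx: "mdist (\<Theta> l) (s l (idx n l x)) x < (1/2) ^ n" if "l \<in> I" "x \<in> mspace (\<Theta> l)" for n l x
  proof -
    have "(0::real) < (1/2) ^ n" by simp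
    from LeastI_ex[OF dense[OF that this]] show ?thesis unfolding idx_def .
  qed
  have idx_meas: "idx n l \<in> metric_borel (\<Theta> l) \<rightarrow>\<^sub>M count_space UNIV" if "l \<in> I" for n l
  proof -
    have "Measurable.pred (metric_borel (\<Theta> l)) (\<lambda>x. mdist (\<Theta> l) (s l k) x < (1/2) ^ n)" for k
      using s[OF that] by (intro pred_mdist_metric_borel)
    then show ?thesis unfolding idx_def[abs_def] by (rule measurable_Least)
  qed
  define g where "g n \<theta> = f (\<lambda>l\<in>I. s l (idx n l (\<theta> l)))" for n \<theta>
  have "g n \<in> borel_measurable ?M" for n
  proof -
    have "(\<lambda>\<theta>. \<lambda>l\<in>I. idx n l (\<theta> l)) \<in> ?M \<rightarrow>\<^sub>M (\<Pi>\<^sub>M l\<in>I. count_space UNIV)"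
    proof (rule measurable_restrict)
      fix l assume l: "l \<in> I"
      show "(\<lambda>\<theta>. idx n l (\<theta> l)) \<in> ?M \<rightarrow>\<^sub>M count_space UNIV"
        using idx_meas[OF l] by (rule measurable_compose[OF measurable_component_singleton[OF l]])
    qed
    \<comment> \<open>For finite \<open>I\<close> the product of the index spaces is again discrete,
      so every function of the indices is measurable.\<close>
    also have "(\<Pi>\<^sub>M l\<in>I. count_space (UNIV :: nat set)) = count_space (I \<rightarrow>\<^sub>E UNIV)"
      by (rule count_space_PiM_finite[OF fin]) simp
    finally have "(\<lambda>\<theta>. \<lambda>l\<in>I. idx n l (\<theta> l)) \<in> ?M \<rightarrow>\<^sub>M count_space (I \<rightarrow>\<^sub>E UNIV)" .
    then have "(\<lambda>\<theta>. (\<lambda>k. f (\<lambda>l\<in>I. s l (k l))) (\<lambda>l\<in>I. idx n l (\<theta> l))) \<in> borel_measurable ?M"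
      by (rule measurable_compose) simp
    also have "(\<lambda>\<theta>. (\<lambda>k. f (\<lambda>l\<in>I. s l (k l))) (\<lambda>l\<in>I. idx n l (\<theta> l))) = g n"
      by (auto simp: g_def fun_eq_iff intro!: arg_cong[where f = f])
    finally show ?thesis .
  qed
  then show ?thesis
  proof (rule borel_measurable_LIMSEQ_real[rotated])
    fix \<theta> assume "\<theta> \<in> space ?M"
    then have \<theta>: "\<theta> \<in> extensional I" "\<And>l. l \<in> I \<Longrightarrow> \<theta> l \<in> mspace (\<Theta> l)"
      by (auto simp: space_PiM PiE_iff)
    have "limitin (product_topology (\<lambda>l. mtopology_of (\<Theta> l)) I)
        (\<lambda>n. \<lambda>l\<in>I. s l (idx n l (\<theta> l))) \<theta> sequentially"
      unfolding limitin_componentwise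
    proof (intro conjI ballI)
      show "\<forall>\<^sub>F n in sequentially. (\<lambda>l\<in>I. s l (idx n l (\<theta> l)))
          \<in> topspace (product_topology (\<lambda>l. mtopology_of (\<Theta> l)) I)"
        using s by (intro always_eventually) auto
      fix l assume l: "l \<in> I"
      interpret Metric_space "mspace (\<Theta> l)" "mdist (\<Theta> l)" by (rule Metric_space_mspace_mdist)
      show "limitin (mtopology_of (\<Theta> l)) (\<lambda>n. (\<lambda>l\<in>I. s l (idx n l (\<theta> l))) l) (\<theta> l) sequentially"
        unfolding mtopology_of_def limitin_metric
      proof (intro conjI allI impI)
        fix \<epsilon> :: real assume "0 < \<epsilon>"
        then obtain n0 where n0: "(1/2::real) ^ n0 < \<epsilon>" using real_arch_pow_inv[of \<epsilon> "1/2"] by auto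
        show "\<forall>\<^sub>F n in sequentially. (\<lambda>l\<in>I. s l (idx n l (\<theta> l))) l \<in> mspace (\<Theta> l) \<and>
            mdist (\<Theta> l) ((\<lambda>l\<in>I. s l (idx n l (\<theta> l))) l) (\<theta> l) < \<epsilon>"
          using eventually_ge_at_top[of n0]
        proof eventually_elim
          case (elim n)
          have "(1/2::real) ^ n \<le> (1/2) ^ n0" using elim by (intro power_decreasing) auto
          moreover have "s l (idx n l (\<theta> l)) \<in> mspace (\<Theta> l)" using s[OF l] .
          moreover have "mdist (\<Theta> l) (s l (idx n l (\<theta> l))) (\<theta> l) < \<epsilon>"
            using idx[OF l \<theta>(2)[OF l], of n] n0 calculation(1) by linarith
          ultimately show ?case using l by simp
        qed
      qed (use \<theta> l in auto)
    qed (fact \<theta>(1))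
    from continuous_map_limit[OF f this]
    show "(\<lambda>n. g n \<theta>) \<longlonglongrightarrow> f \<theta>"
      by (simp add: g_def comp_def)
  qed
qed

text \<open>Continuity with a single metric radius: a basic neighbourhood involves one radius for
  \<open>y\<close>, one for \<open>x\<close> and finitely many for the coordinates of \<theta>, and
  their minimum serves for all.\<close>

lemma continuous_map_prod_product_nearby:
  fixes \<Theta> :: "nat \<Rightarrow> 'a metric" and X :: "'x::metric_space set" and h :: "'y::metric_space \<Rightarrow> 'x \<Rightarrow> (nat \<Rightarrow> 'a) \<Rightarrow> real"
  assumes fin: "finite I"
    and h: "continuous_map (prod_topology euclidean
         (prod_topology (top_of_set X) (product_topology (\<lambda>l. mtopology_of (\<Theta> l)) I)))
       euclideanreal (\<lambda>(y, x, \<theta>). h y x \<theta>)"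
    and x: "x \<in> X" and \<theta>: "\<theta> \<in> (\<Pi>\<^sub>E l\<in>I. mspace (\<Theta> l))" and \<epsilon>: "0 < \<epsilon>"
  obtains \<rho> where "0 < \<rho>" "\<And>y' x' \<theta>'. dist y' y < \<rho> \<Longrightarrow> x' \<in> X \<Longrightarrow> dist x' x < \<rho> \<Longrightarrow>
      \<theta>' \<in> (\<Pi>\<^sub>E l\<in>I. mspace (\<Theta> l)) \<Longrightarrow> (\<And>l. l \<in> I \<Longrightarrow> mdist (\<Theta> l) (\<theta> l) (\<theta>' l) < \<rho>) \<Longrightarrow>
      \<bar>h y' x' \<theta>' - h y x \<theta>\<bar> < \<epsilon>"
proof -
  let ?P = "product_topology (\<lambda>l. mtopology_of (\<Theta> l)) I"
  let ?T = "prod_topology euclidean (prod_topology (top_of_set X) ?P)"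
  define S where "S = {z \<in> topspace ?T. (\<lambda>(y, x, \<theta>). h y x \<theta>) z \<in> ball (h y x \<theta>) \<epsilon>}"
  have S: "openin ?T S" unfolding S_def by (rule openin_continuous_map_preimage[OF h]) simp
  have mem: "(y, x, \<theta>) \<in> S" using x \<theta> \<epsilon> by (simp add: S_def)
  have "\<exists>U V. openin euclidean U \<and> openin (prod_topology (top_of_set X) ?P) V \<and> y \<in> U \<and> (x, \<theta>) \<in> V \<and> U \<times> V \<subseteq> S"
    by (rule openin_prod_topology_alt[THEN iffD1, rule_format, OF S mem])
  then obtain U V where U: "open U" "y \<in> U" and V: "openin (prod_topology (top_of_set X) ?P) V"
      and mV: "(x, \<theta>) \<in> V" and UV: "U \<times> V \<subseteq> S"
    unfolding open_openin[symmetric] by blast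
  have "\<exists>V1 V2. openin (top_of_set X) V1 \<and> openin ?P V2 \<and> x \<in> V1 \<and> \<theta> \<in> V2 \<and> V1 \<times> V2 \<subseteq> V"
    by (rule openin_prod_topology_alt[THEN iffD1, rule_format, OF V mV])
  then obtain V1 V2 where V1: "openin (top_of_set X) V1" "x \<in> V1" and V2: "openin ?P V2" and mV2: "\<theta> \<in> V2"
      and V12: "V1 \<times> V2 \<subseteq> V"
    by blast
  obtain W where W: "\<And>l. l \<in> I \<Longrightarrow> openin (mtopology_of (\<Theta> l)) (W l)" "\<theta> \<in> Pi\<^sub>E I W" "Pi\<^sub>E I W \<subseteq> V2"
  proof -
    have "\<exists>W. finite {i \<in> I. W i \<noteq> topspace (mtopology_of (\<Theta> i))} \<and>
        (\<forall>i\<in>I. openin (mtopology_of (\<Theta> i)) (W i)) \<and> \<theta> \<in> Pi\<^sub>E I W \<and> Pi\<^sub>E I W \<subseteq> V2"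
      by (rule openin_product_topology_alt[THEN iffD1, rule_format, OF V2 mV2])
    then show ?thesis using that by blast
  qed
  obtain a where a: "a > 0" "\<And>y'. dist y' y < a \<Longrightarrow> y' \<in> U"
    using U by (metis open_dist)
  obtain b where b: "b > 0" "\<And>x'. x' \<in> X \<Longrightarrow> dist x' x < b \<Longrightarrow> x' \<in> V1"
    using V1 unfolding openin_euclidean_subtopology_iff by metis
  have "\<exists>r>0. \<forall>z\<in>mspace (\<Theta> l). mdist (\<Theta> l) (\<theta> l) z < r \<longrightarrow> z \<in> W l" if "l \<in> I" for l
    using W(1)[OF that] W(2) that unfolding openin_mtopology_of_iff by blast
  then obtain c where c: "\<And>l. l \<in> I \<Longrightarrow> c l > 0"
      "\<And>l z. l \<in> I \<Longrightarrow> z \<in> mspace (\<Theta> l) \<Longrightarrow> mdist (\<Theta> l) (\<theta> l) z < c l \<Longrightarrow> z \<in> W l"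
    by metis
  define A where "A = insert a (insert b (c ` I))"
  have A: "finite A" "A \<noteq> {}" "\<And>r. r \<in> A \<Longrightarrow> 0 < r" using fin a b c by (auto simp: A_def)
  define \<rho> where "\<rho> = Min A"
  have \<rho>: "0 < \<rho>" "\<rho> \<le> a" "\<rho> \<le> b" "\<And>l. l \<in> I \<Longrightarrow> \<rho> \<le> c l"
  proof -
    have le: "Min A \<le> r" if "r \<in> A" for r using A(1) that by (rule Min_le)
    show "0 < \<rho>" unfolding \<rho>_def using A by (simp add: Min_gr_iff)
    show "\<rho> \<le> a" "\<rho> \<le> b" "\<And>l. l \<in> I \<Longrightarrow> \<rho> \<le> c l"
      unfolding \<rho>_def by (rule le, simp add: A_def)+
  qed
  show ?thesis
  proof (rule that[OF \<rho>(1)])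
    fix y' x' \<theta>'
    assume *: "dist y' y < \<rho>" "x' \<in> X" "dist x' x < \<rho>" "\<theta>' \<in> (\<Pi>\<^sub>E l\<in>I. mspace (\<Theta> l))"
      "\<And>l. l \<in> I \<Longrightarrow> mdist (\<Theta> l) (\<theta> l) (\<theta>' l) < \<rho>"
    have "\<theta>' \<in> Pi\<^sub>E I W"
    proof (rule PiE_I)
      fix l assume l: "l \<in> I"
      show "\<theta>' l \<in> W l"
        by (rule c(2)[OF l PiE_mem[OF *(4) l] less_le_trans[OF *(5)[OF l] \<rho>(4)[OF l]]])
    qed (rule PiE_arb[OF *(4)])
    then have "(x', \<theta>') \<in> V"
      using V12 W(3) b(2)[OF *(2) less_le_trans[OF *(3) \<rho>(3)]] by blast
    then have "(y', x', \<theta>') \<in> S"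
      using UV a(2)[OF less_le_trans[OF *(1) \<rho>(2)]] by blast
    then show "\<bar>h y' x' \<theta>' - h y x \<theta>\<bar> < \<epsilon>" by (simp add: S_def dist_real_def abs_minus_commute)
  qed
qed


section \<open>Compact sets of random effects\<close>

text \<open>Left squared because softmax scores must be affine up to a common term: expanding the
  square achieves this. Restricted to \<open>I\<close> because points of a product space carry no
  information elsewhere.\<close>

definition sqdist :: "nat set \<Rightarrow> (nat \<Rightarrow> real) \<Rightarrow> (nat \<Rightarrow> real) \<Rightarrow> real" where
  "sqdist I v w = (\<Sum>l\<in>I. (v l - w l)\<^sup>2)"

lemma sqdist_nonneg: "0 \<le> sqdist I v w"
  unfolding sqdist_def by (intro sum_nonneg) auto

lemma sqdist_commute: "sqdist I v w = sqdist I w v"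
  unfolding sqdist_def by (intro sum.cong) (auto simp: power2_commute)

lemma continuous_on_sqdist [continuous_intros]:
  assumes "continuous_on S f" "continuous_on S g"
  shows "continuous_on S (\<lambda>x. sqdist I (f x) (g x))"
  unfolding sqdist_def
  by (intro continuous_on_sum continuous_on_power continuous_on_diff
        continuous_on_product_then_coordinatewise[OF assms(1)] continuous_on_product_then_coordinatewise[OF assms(2)])

lemma sqdist_eq_0_imp_eq:
  assumes "finite I" "sqdist I v w = 0" "v \<in> extensional I" "w \<in> extensional I"
  shows "v = w"
proof (rule extensionalityI[OF assms(3,4)])
  fix l assume "l \<in> I"
  then show "v l = w l"
    using assms(1,2) unfolding sqdist_def by (subst (asm) sum_nonneg_eq_0_iff) auto
qed

lemma compact_disjoint_sqdist:
  assumes "finite I" "compact C" "compact D" "C \<inter> D = {}" "C \<subseteq> extensional I" "D \<subseteq> extensional I"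
  obtains \<delta> where "0 < \<delta>" "\<And>v w. v \<in> C \<Longrightarrow> w \<in> D \<Longrightarrow> \<delta> \<le> sqdist I v w"
proof (cases "C \<times> D = {}")
  case True
  then show ?thesis using that[of 1] by auto
next
  case False
  have "continuous_on (C \<times> D) (\<lambda>z. sqdist I (fst z) (snd z))"
    by (intro continuous_on_sqdist continuous_on_fst continuous_on_snd continuous_on_id)
  from continuous_attains_inf[OF compact_Times[OF assms(2,3)] False this]
  obtain a b where ab: "a \<in> C" "b \<in> D"
    and min: "\<And>v w. v \<in> C \<Longrightarrow> w \<in> D \<Longrightarrow> sqdist I a b \<le> sqdist I v w" by auto
  have "sqdist I a b \<noteq> 0" using sqdist_eq_0_imp_eq[OF assms(1)] ab assms(4-6) by blast
  then have "0 < sqdist I a b" using sqdist_nonneg[of I a b] by linarith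
  then show ?thesis using that min by blast
qed

lemma compact_finite_sqdist_net:
  assumes "compact K" "0 < e"
  obtains V where "finite V" "V \<subseteq> K" "\<And>w. w \<in> K \<Longrightarrow> \<exists>v\<in>V. sqdist I w v < e"
proof -
  have op: "open {w. sqdist I w v < e}" for v
    by (intro open_Collect_less continuous_on_sqdist continuous_on_id continuous_on_const)
  have cov: "K \<subseteq> (\<Union>v\<in>K. {w. sqdist I w v < e})"
    using assms(2) by (auto simp: sqdist_def)
  from compactE_image[OF assms(1) op cov]
  obtain V where "V \<subseteq> K" "finite V" "K \<subseteq> (\<Union>v\<in>V. {w. sqdist I w v < e})" by blast
  then show ?thesis using that[of V] by blast
qed

text \<open>The centers lie in \<open>A\<close> although \<open>A\<close> need not be closed: balls
  around points of \<open>A\<close> already cover its compact closure.\<close>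

lemma bounded_finite_net:
  fixes A :: "'a::euclidean_space set"
  assumes "bounded A" "0 < e"
  obtains V where "finite V" "V \<subseteq> A" "\<And>x. x \<in> A \<Longrightarrow> \<exists>v\<in>V. dist x v < e"
proof -
  have cov: "closure A \<subseteq> (\<Union>v\<in>A. ball v e)"
    using assms(2) by (auto simp: closure_approachable)
  have "compact (closure A)" using assms(1) by simp
  from compactE_image[OF this _ cov]
  obtain V where V: "V \<subseteq> A" "finite V" "closure A \<subseteq> (\<Union>v\<in>V. ball v e)" by blast
  have "\<exists>v\<in>V. dist x v < e" if "x \<in> A" for x
  proof -
    have "x \<in> (\<Union>v\<in>V. ball v e)" using V(3) closure_subset[of A] that by blast
    then show ?thesis by (auto simp: dist_commute)
  qed
  then show ?thesis using that[of V] V by blast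
qed

text \<open>Finite Borel measures on the Polish space \<open>nat \<Rightarrow> real\<close> are
  inner regular. The product measure lives on the extensional functions, a closed subset; the
  identity carries the measure to the Borel sets of the whole space, and \<open>restrict\<close>
  shows that \<open>B\<close> is a Borel set there.\<close>

lemma inner_regular_PiM_real:
  fixes \<Phi> :: "nat \<Rightarrow> real measure"
  assumes fin: "finite I" and \<Phi>: "\<And>l. real_distribution (\<Phi> l)"
    and B: "B \<in> sets (PiM I \<Phi>)" and \<epsilon>: "0 < \<epsilon>"
  obtains K where "compact K" "K \<subseteq> B" "K \<in> sets (PiM I \<Phi>)" "measure (PiM I \<Phi>) (B - K) < \<epsilon>"
proof -
  interpret \<Phi>: real_distribution "\<Phi> l" for l by (rule \<Phi>)
  let ?\<Omega> = "PiM I \<Phi>"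
  interpret \<Omega>: prob_space ?\<Omega> by (rule prob_space_PiM) (rule \<Phi>.prob_space_axioms)
  have sp: "space ?\<Omega> = extensional I" by (auto simp: space_PiM PiE_def)
  have id: "(\<lambda>w. w) \<in> ?\<Omega> \<rightarrow>\<^sub>M borel"
  proof (rule measurable_coordinatewise_then_product)
    fix l
    show "(\<lambda>w. w l) \<in> borel_measurable ?\<Omega>"
    proof (cases "l \<in> I")
      case True
      then have "(\<lambda>w. w l) \<in> ?\<Omega> \<rightarrow>\<^sub>M \<Phi> l" by (rule measurable_component_singleton)
      then show ?thesis using measurable_cong_sets[OF refl \<Phi>.events_eq_borel] by blast
    next
      case False
      then have "w l = undefined" if "w \<in> space ?\<Omega>" for w using that by (auto simp: sp extensional_def)
      then show ?thesis by (subst measurable_cong[where g = "\<lambda>_. undefined"]) simp_all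
    qed
  qed
  have restr: "(\<lambda>w. restrict w I) \<in> borel \<rightarrow>\<^sub>M ?\<Omega>"
  proof (rule measurable_restrict)
    fix l
    have "(\<lambda>w. w l) \<in> borel_measurable (borel :: (nat \<Rightarrow> real) measure)"
      by (rule borel_measurable_continuous_onI) (intro continuous_on_product_coordinates)
    then show "(\<lambda>w. w l) \<in> borel \<rightarrow>\<^sub>M \<Phi> l"
      using measurable_cong_sets[OF refl \<Phi>.events_eq_borel] by blast
  qed
  have ext: "extensional I \<in> sets (borel :: (nat \<Rightarrow> real) measure)"
  proof -
    have "extensional I = (\<Inter>l\<in>-I. {w::nat \<Rightarrow> real. w l = undefined})" by (auto simp: extensional_def)
    moreover have "closed \<dots>"
      by (intro closed_INT ballI closed_Collect_eq continuous_on_product_coordinates continuous_on_const)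
    ultimately show ?thesis by simp
  qed
  have "B = ((\<lambda>w. restrict w I) -` B \<inter> space borel) \<inter> extensional I"
    using sets.sets_into_space[OF B] sp by (auto simp: extensional_restrict)
  also have "\<dots> \<in> sets borel" using measurable_sets[OF restr B] ext by (rule sets.Int)
  finally have Bb: "B \<in> sets borel" .
  let ?P = "distr ?\<Omega> borel (\<lambda>w. w)"
  have P_eq: "emeasure ?P C = emeasure ?\<Omega> C" if "C \<in> sets borel" "C \<subseteq> extensional I" for C
    using emeasure_distr[OF id that(1)] that(2) by (simp add: sp Int_absorb2)
  have Bx: "B \<subseteq> extensional I" using sets.sets_into_space[OF B] sp by simp
  interpret P: prob_space ?P by (rule \<Omega>.prob_space_distr[OF id])
  have reg: "emeasure ?P B = (SUP K\<in>{K. K \<subseteq> B \<and> compact K}. emeasure ?P K)"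
    by (rule inner_regular) (use Bb P.emeasure_space_1 in auto)
  have "\<exists>K. K \<subseteq> B \<and> compact K \<and> P.prob B - \<epsilon> < P.prob K"
  proof (rule ccontr)
    assume "\<not> ?thesis"
    then have le: "P.prob K \<le> P.prob B - \<epsilon>" if "K \<subseteq> B" "compact K" for K
      using that by (meson not_le)
    have "emeasure ?P B \<le> ennreal (P.prob B - \<epsilon>)"
      unfolding reg by (intro SUP_least) (auto simp: P.emeasure_eq_measure intro!: ennreal_leI le)
    moreover have "0 \<le> P.prob B - \<epsilon>" using le[of "{}"] by simp
    ultimately show False using \<epsilon> by (simp add: P.emeasure_eq_measure)
  qed
  then obtain K where K: "K \<subseteq> B" "compact K" "P.prob B - \<epsilon> < P.prob K" by blast
  have Kb: "K \<in> sets borel" using compact_imp_closed[OF K(2)] by simp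
  have Ks: "K \<in> sets ?\<Omega>"
    using measurable_sets[OF id Kb] K(1) Bx by (simp add: sp Int_absorb2)
  have "measure ?P B = measure ?\<Omega> B" "measure ?P K = measure ?\<Omega> K"
    using P_eq[OF Bb Bx] P_eq[OF Kb] K(1) Bx by (auto simp: measure_def)
  with K(3) have "measure ?\<Omega> B < measure ?\<Omega> K + \<epsilon>" by linarith
  then have "measure ?\<Omega> (B - K) < \<epsilon>" using \<Omega>.finite_measure_Diff[OF B Ks K(1)] by simp
  then show ?thesis using that K Ks by blast
qed

text \<open>A quantitative form of Lusin's theorem: on a compact set of almost full measure, points that
  are close enough lie in the same of finitely many prescribed sets.\<close>

lemma compact_locally_constant:
  fixes \<Phi> :: "nat \<Rightarrow> real measure" and B :: "nat \<Rightarrow> (nat \<Rightarrow> real) set"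
  assumes fin: "finite I" and \<Phi>: "\<And>l. real_distribution (\<Phi> l)"
    and B: "\<And>m. B m \<in> sets (PiM I \<Phi>)" and \<epsilon>: "0 < \<epsilon>"
  shows "\<exists>K \<delta>. compact K \<and> K \<in> sets (PiM I \<Phi>) \<and> measure (PiM I \<Phi>) (space (PiM I \<Phi>) - K) < \<epsilon> \<and> 0 < \<delta> \<and>
    (\<forall>m<n. \<forall>v\<in>K. \<forall>w\<in>K. sqdist I v w < \<delta> \<longrightarrow> w \<in> B m \<longrightarrow> v \<in> B m)"
  using \<epsilon>
proof (induction n arbitrary: \<epsilon>)
  case 0
  obtain K where K: "compact K" "K \<subseteq> space (PiM I \<Phi>)" "K \<in> sets (PiM I \<Phi>)"
      "measure (PiM I \<Phi>) (space (PiM I \<Phi>) - K) < \<epsilon>"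
    by (rule inner_regular_PiM_real[OF fin \<Phi> sets.top 0])
  have "(0::real) < 1" by simp
  with K show ?case by blast
next
  case (Suc n)
  interpret \<Phi>: real_distribution "\<Phi> l" for l by (rule \<Phi>)
  let ?\<Omega> = "PiM I \<Phi>"
  interpret \<Omega>: prob_space ?\<Omega> by (rule prob_space_PiM) (rule \<Phi>.prob_space_axioms)
  have sp: "space ?\<Omega> = extensional I" by (auto simp: space_PiM PiE_def)
  have Bx: "B m \<subseteq> extensional I" for m using sets.sets_into_space[OF B] sp by simp
  obtain K \<delta> where K: "compact K" "K \<in> sets ?\<Omega>" "\<Omega>.prob (space ?\<Omega> - K) < \<epsilon>/2" "0 < \<delta>"
    and K\<delta>: "\<And>m v w. m < n \<Longrightarrow> v \<in> K \<Longrightarrow> w \<in> K \<Longrightarrow> sqdist I v w < \<delta> \<Longrightarrow> w \<in> B m \<Longrightarrow> v \<in> B m"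
    using Suc.IH[of "\<epsilon>/2"] Suc.prems by auto
  \<comment> \<open>Half of the allowance is spent on the earlier sets, a quarter on
    \<open>B n\<close> and a quarter on its complement.\<close>
  have \<epsilon>4: "0 < \<epsilon>/4" using Suc.prems by simp
  obtain C where C: "compact C" "C \<subseteq> B n" "C \<in> sets ?\<Omega>" "\<Omega>.prob (B n - C) < \<epsilon>/4"
    by (rule inner_regular_PiM_real[OF fin \<Phi> B \<epsilon>4])
  obtain D where D: "compact D" "D \<subseteq> space ?\<Omega> - B n" "D \<in> sets ?\<Omega>" "\<Omega>.prob ((space ?\<Omega> - B n) - D) < \<epsilon>/4"
    by (rule inner_regular_PiM_real[OF fin \<Phi> sets.compl_sets[OF B[of n]] \<epsilon>4])
  have DC: "D \<inter> C = {}" "D \<subseteq> extensional I" "C \<subseteq> extensional I"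
    using C(2) D(2) Bx[of n] sp by auto
  \<comment> \<open>Inside \<open>C \<union> D\<close> a point closer than \<open>\<eta>\<close> to
    a point of \<open>C\<close> cannot lie in \<open>D\<close>, so nearby points stay on the same
    side of \<open>B n\<close>.\<close>
  obtain \<eta> where \<eta>: "0 < \<eta>" "\<And>v w. v \<in> D \<Longrightarrow> w \<in> C \<Longrightarrow> \<eta> \<le> sqdist I v w"
    by (rule compact_disjoint_sqdist[OF fin D(1) C(1) DC]) (rule that, assumption, blast)
  define K' where "K' = K \<inter> (C \<union> D)"
  have "compact K'" unfolding K'_def using K C D by (intro compact_Int compact_Un)
  moreover have "K' \<in> sets ?\<Omega>" unfolding K'_def using K C D by auto
  moreover have "\<Omega>.prob (space ?\<Omega> - K') < \<epsilon>"
  proof -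
    have "\<Omega>.prob (space ?\<Omega> - K')
        \<le> \<Omega>.prob ((space ?\<Omega> - K) \<union> ((B n - C) \<union> ((space ?\<Omega> - B n) - D)))"
      using K C D B by (intro \<Omega>.finite_measure_mono) (auto simp: K'_def)
    also have "\<dots> \<le> \<Omega>.prob (space ?\<Omega> - K) + \<Omega>.prob ((B n - C) \<union> ((space ?\<Omega> - B n) - D))"
      using K C D B by (intro measure_Un_le) auto
    also have "\<dots> \<le> \<Omega>.prob (space ?\<Omega> - K) + (\<Omega>.prob (B n - C) + \<Omega>.prob ((space ?\<Omega> - B n) - D))"
      using K C D B by (intro add_left_mono measure_Un_le) auto
    also have "\<dots> < \<epsilon>" using K C D by simp
    finally show ?thesis .
  qed
  moreover have "v \<in> B m"
    if "m < Suc n" "v \<in> K'" "w \<in> K'" "sqdist I v w < min \<delta> \<eta>" "w \<in> B m" for m v w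
  proof (cases "m = n")
    case True
    then have "w \<in> C" using that D(2) by (auto simp: K'_def)
    then have "v \<notin> D" using \<eta>(2)[of v w] that(4) by auto
    then show ?thesis using that(2) C(2) True by (auto simp: K'_def)
  next
    case False
    then show ?thesis using K\<delta>[of m v w] that by (auto simp: K'_def)
  qed
  ultimately show ?case
    using K(4) \<eta>(1) by (intro exI[of _ K'] exI[of _ "min \<delta> \<eta>"]) auto
qed


section \<open>Finite mixtures of experts\<close>

text \<open>The tent function at \<open>q\<close> is continuous, equals 1 at \<open>q\<close> and
  lies below the indicator of the ball. Its integrals converge to 1 and bound the mass of the ball
  from below.\<close>

lemma converges_weakly_return_ball:
  fixes M :: "nat \<Rightarrow> (real ^ 'k) measure"
  assumes M: "\<And>n. prob_space (M n) \<and> sets (M n) = sets borel"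
    and w: "converges_weakly M (return borel q)" and \<eta>: "0 < \<eta>"
  shows "\<exists>n. 1 - \<eta> < measure (M n) (ball q \<eta>)"
proof -
  define f where "f z = max 0 (1 - dist z q / \<eta>)" for z :: "real ^ 'k"
  have f: "continuous_on UNIV f" "\<And>z. 0 \<le> f z" "\<And>z. f z \<le> indicator (ball q \<eta>) z"
    using \<eta> unfolding f_def
    by (auto intro!: continuous_intros simp: indicator_def field_simps dist_commute)
  have f1: "f z \<le> 1" for z using \<eta> by (simp add: f_def)
  have "bounded (range f)"
    by (intro boundedI[of _ 1]) (use f f1 in \<open>auto simp: abs_le_iff intro: order_trans[of _ 0]\<close>)
  then have "(\<lambda>n. \<integral>z. f z \<partial>M n) \<longlonglongrightarrow> (\<integral>z. f z \<partial>return borel q)"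
    using w f(1) unfolding converges_weakly_def by blast
  moreover have "f \<in> borel_measurable borel" by (rule borel_measurable_continuous_onI[OF f(1)])
  then have "(\<integral>z. f z \<partial>return borel q) = f q" by (intro integral_return) auto
  then have "(\<integral>z. f z \<partial>return borel q) = 1" by (simp add: f_def)
  ultimately have "\<forall>\<^sub>F n in sequentially. 1 - \<eta> < (\<integral>z. f z \<partial>M n)"
    using \<eta> by (intro order_tendstoD(1)) auto
  then obtain n where n: "1 - \<eta> < (\<integral>z. f z \<partial>M n)" by (auto simp: eventually_sequentially)
  interpret prob_space "M n" using M by blast
  have [measurable_cong]: "sets (M n) = sets borel" using M by blast
  have "(\<integral>z. f z \<partial>M n) \<le> (\<integral>z. indicator (ball q \<eta>) z \<partial>M n)"
  proof (rule integral_mono)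
    show "integrable (M n) f"
      by (rule integrable_const_bound[of _ 1])
         (use f f1 \<open>f \<in> borel_measurable borel\<close> in \<open>auto\<close>)
    show "integrable (M n) (indicator (ball q \<eta>) :: _ \<Rightarrow> real)"
      by (rule integrable_real_indicator) (auto simp: emeasure_eq_measure M)
  qed (rule f(3))
  also have "\<dots> = prob (ball q \<eta>)" using M sets_eq_imp_space_eq[of "M n" borel] by simp
  finally show ?thesis using n by (intro exI[of _ n]) simp
qed

lemma le_add_vec_of_ball:
  fixes z q :: "real ^ 'k"
  assumes "z \<in> ball q \<eta>"
  shows "z \<le> q + vec \<eta>" "q \<le> z + vec \<eta>"
proof -
  have "\<bar>(z - q) $ i\<bar> < \<eta>" for i
    using component_le_norm_cart[of "z - q" i] assms by (simp add: dist_norm norm_minus_commute)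
  then have "\<bar>z $ i - q $ i\<bar> < \<eta>" for i by simp
  then show "z \<le> q + vec \<eta>" "q \<le> z + vec \<eta>"
    unfolding less_eq_vec_def by (simp_all add: abs_less_iff) (smt (verit))+
qed

text \<open>Two-sided bounds in the style of the Levy metric: they are stable under limits of the law,
  whereas pointwise approximation of the distribution function fails at atoms.\<close>

lemma finite_mixture_approximation:
  fixes F\<^sub>0 :: "'s \<Rightarrow> (real ^ 'k) measure" and \<mu> :: "(real ^ 'k) measure"
  assumes F0: "\<And>\<psi>. \<psi> \<in> \<Psi>\<^sub>0 \<Longrightarrow> prob_space (F\<^sub>0 \<psi>) \<and> sets (F\<^sub>0 \<psi>) = sets borel"
    and dense: "\<And>q. \<exists>\<psi> :: nat \<Rightarrow> 's. (\<forall>n. \<psi> n \<in> \<Psi>\<^sub>0) \<and>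
               converges_weakly (\<lambda>n. F\<^sub>0 (\<psi> n)) (return borel q)"
    and \<mu>: "prob_space \<mu>" "sets \<mu> = sets borel" and \<eta>: "0 < \<eta>"
  shows "\<exists>(n::nat) p \<psi>. (\<forall>j\<le>n. 0 \<le> p j \<and> \<psi> j \<in> \<Psi>\<^sub>0) \<and> (\<Sum>j\<le>n. p j) = (1::real) \<and>
    (\<forall>y. dist_fun \<mu> (y - vec \<eta>) - \<eta> \<le> (\<Sum>j\<le>n. p j * dist_fun (F\<^sub>0 (\<psi> j)) y) \<and>
         (\<Sum>j\<le>n. p j * dist_fun (F\<^sub>0 (\<psi> j)) y) \<le> dist_fun \<mu> (y + vec \<eta>) + \<eta>)"
proof -
  interpret prob_space \<mu> by (rule \<mu>)
  have [measurable_cong, simp]: "sets \<mu> = sets borel" by (rule \<mu>)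
  have [simp]: "space \<mu> = UNIV" using sets_eq_imp_space_eq[OF \<mu>(2)] by simp
  have [simp]: "prob UNIV = 1" using prob_space by simp
  have \<eta>2: "0 < \<eta>/2" using \<eta> by simp
  obtain D :: "(real ^ 'k) set" where D: "countable D" "\<And>x e. 0 < e \<Longrightarrow> \<exists>d\<in>D. dist x d < e"
    using countable_dense_exists[where 'a = "real ^ 'k"] by (metis UNIV_I open_ball centre_in_ball empty_iff mem_ball)
  then have "D \<noteq> {}" by (metis empty_iff zero_less_one)
  define d where "d = from_nat_into D"
  have d: "\<exists>j. dist z (d j) < \<eta>/2" for z
    using D(2)[OF \<eta>2, of z] from_nat_into_surj[OF D(1)] unfolding d_def by metis
  have "\<exists>\<psi>\<in>\<Psi>\<^sub>0. 1 - \<eta>/2 < measure (F\<^sub>0 \<psi>) (ball (d j) (\<eta>/2))" for j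
  proof -
    obtain \<psi> :: "nat \<Rightarrow> 's" where \<psi>: "\<And>n. \<psi> n \<in> \<Psi>\<^sub>0"
        "converges_weakly (\<lambda>n. F\<^sub>0 (\<psi> n)) (return borel (d j))"
      using dense by blast
    show ?thesis using converges_weakly_return_ball[OF F0[OF \<psi>(1)] \<psi>(2) \<eta>2] \<psi>(1) by blast
  qed
  then obtain \<psi> where \<psi>: "\<And>j. \<psi> j \<in> \<Psi>\<^sub>0"
    and conc: "\<And>j. 1 - \<eta>/2 < measure (F\<^sub>0 (\<psi> j)) (ball (d j) (\<eta>/2))" by metis
  have a01: "0 \<le> dist_fun (F\<^sub>0 (\<psi> j)) y" "dist_fun (F\<^sub>0 (\<psi> j)) y \<le> 1" for j y
    using F0[OF \<psi>] by (auto simp: dist_fun_def intro!: prob_space.prob_le_1)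
  \<comment> \<open>\<open>low\<close> and \<open>up\<close> compare an expert with a step at its
    grid point: the radius of the ball costs a shift by \<eta>/2, the mass outside it costs
    \<eta>/2.\<close>
  have low: "1 - \<eta>/2 \<le> dist_fun (F\<^sub>0 (\<psi> j)) y" if "d j \<le> y - vec (\<eta>/2)" for j y
  proof -
    interpret F: prob_space "F\<^sub>0 (\<psi> j)" using F0[OF \<psi>] by blast
    have "ball (d j) (\<eta>/2) \<subseteq> {..y}"
      using le_add_vec_of_ball(1) that by (fastforce simp: le_diff_eq)
    then have "F.prob (ball (d j) (\<eta>/2)) \<le> F.prob {..y}"
      using F0[OF \<psi>[of j]] by (intro F.finite_measure_mono) auto
    then show ?thesis using conc[of j] by (simp add: dist_fun_def)
  qed
  have up: "dist_fun (F\<^sub>0 (\<psi> j)) y \<le> \<eta>/2" if "\<not> d j \<le> y + vec (\<eta>/2)" for j y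
  proof -
    interpret F: prob_space "F\<^sub>0 (\<psi> j)" using F0[OF \<psi>] by blast
    have "{..y} \<subseteq> space (F\<^sub>0 (\<psi> j)) - ball (d j) (\<eta>/2)"
    proof
      fix z assume z: "z \<in> {..y}"
      have "z \<notin> ball (d j) (\<eta>/2)"
        using le_add_vec_of_ball(2)[of z "d j" "\<eta>/2"] z that by (meson add_right_mono atMost_iff order_trans)
      then show "z \<in> space (F\<^sub>0 (\<psi> j)) - ball (d j) (\<eta>/2)"
        using F0[OF \<psi>[of j]] sets_eq_imp_space_eq[of "F\<^sub>0 (\<psi> j)" borel] by simp
    qed
    then have "F.prob {..y} \<le> F.prob (space (F\<^sub>0 (\<psi> j)) - ball (d j) (\<eta>/2))"
      using F0[OF \<psi>[of j]] by (intro F.finite_measure_mono) auto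
    also have "\<dots> = 1 - F.prob (ball (d j) (\<eta>/2))"
      using F0[OF \<psi>[of j]] by (intro F.prob_compl) auto
    finally show ?thesis using conc[of j] by (simp add: dist_fun_def)
  qed
  define c where "c z = (LEAST j. dist z (d j) < \<eta>/2)" for z
  have c: "dist z (d (c z)) < \<eta>/2" for z
    unfolding c_def by (rule LeastI_ex[OF d])
  have [measurable]: "c \<in> borel \<rightarrow>\<^sub>M count_space UNIV"
    unfolding c_def[abs_def] by measurable
  have c_sets: "{z. c z \<in> J} \<in> sets borel" for J
    using measurable_sets[of c borel "count_space UNIV" J] by (simp add: vimage_def)
  have "\<exists>n. 1 - \<eta>/2 < prob {z. c z \<le> n}"
  proof -
    have "(\<lambda>n. prob {z. c z \<le> n}) \<longlonglongrightarrow> prob (\<Union>n. {z. c z \<le> n})"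
      using c_sets[of "{.._}"] by (intro finite_Lim_measure_incseq) (auto simp: incseq_def)
    also have "(\<Union>n. {z. c z \<le> n}) = space \<mu>" by auto
    finally have "(\<lambda>n. prob {z. c z \<le> n}) \<longlonglongrightarrow> 1" by (simp only: prob_space)
    then have "\<forall>\<^sub>F n in sequentially. 1 - \<eta>/2 < prob {z. c z \<le> n}"
      using \<eta> by (intro order_tendstoD(1)) auto
    then show ?thesis by (auto simp: eventually_sequentially)
  qed
  then obtain n where n: "1 - \<eta>/2 < prob {z. c z \<le> n}" by blast
  \<comment> \<open>\<open>c\<close> rounds to a grid point; cutting off at \<open>n\<close> makes
    the mixture finite. Only the points with \<open>n < c z\<close> are misplaced, and their mass is
    at most \<eta>/2.\<close>
  define c' where "c' z = min (c z) n" for z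
  have c'_sets: "{z. c' z \<in> J} \<in> sets borel" for J
    using c_sets[of "{j. min j n \<in> J}"] by (simp add: c'_def)
  define p where "p j = prob {z. c' z = j}" for j
  \<comment> \<open>The weights are the law of \<open>c'\<close>, so a mixture is an expectation
    under \<mu>, and bounds that hold for each \<open>z\<close> can be integrated.\<close>
  have mix: "(\<Sum>j\<le>n. p j * a j) = (\<integral>z. a (c' z) \<partial>\<mu>)" for a :: "nat \<Rightarrow> real"
  proof -
    have "a (c' z) = (\<Sum>j\<le>n. indicator {z. c' z = j} z * a j)" for z
    proof -
      have "(\<Sum>j\<le>n. indicator {z. c' z = j} z * a j) = (\<Sum>j\<le>n. if j = c' z then a j else 0)"
        by (intro sum.cong) auto
      then show ?thesis by (simp add: c'_def)
    qed
    then have "(\<integral>z. a (c' z) \<partial>\<mu>) = (\<integral>z. (\<Sum>j\<le>n. indicator {z. c' z = j} z * a j) \<partial>\<mu>)" by simp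
    also have "\<dots> = (\<Sum>j\<le>n. (\<integral>z. indicator {z. c' z = j} z * a j \<partial>\<mu>))"
      using c'_sets[of "{_}"]
      by (intro Bochner_Integration.integral_sum integrable_mult_left integrable_real_indicator)
         (auto simp: emeasure_eq_measure)
    also have "\<dots> = (\<Sum>j\<le>n. p j * a j)" by (simp add: p_def)
    finally show ?thesis by simp
  qed
  have int_a: "integrable \<mu> (\<lambda>z. a (c' z))" for a :: "nat \<Rightarrow> real"
  proof (rule integrable_const_bound[of _ "\<Sum>j\<le>n. \<bar>a j\<bar>"])
    have "c' \<in> borel \<rightarrow>\<^sub>M count_space UNIV" using c'_sets by (auto intro!: measurableI simp: vimage_def)
    then show "(\<lambda>z. a (c' z)) \<in> borel_measurable \<mu>"
      by (simp add: measurable_compose[of c' _ "count_space UNIV"] cong: measurable_cong_sets)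
    show "AE z in \<mu>. norm (a (c' z)) \<le> (\<Sum>j\<le>n. \<bar>a j\<bar>)"
      by (intro AE_I2) (auto simp: c'_def intro!: member_le_sum[of "min _ n" _ "\<lambda>j. \<bar>a j\<bar>"])
  qed
  have bad: "prob {z. n < c z} \<le> \<eta>/2"
  proof -
    have "{z. n < c z} = space \<mu> - {z. c z \<le> n}" by auto
    then have "prob {z. n < c z} = 1 - prob {z. c z \<le> n}"
      using c_sets[of "{..n}"] by (simp only:) (intro prob_compl, simp)
    then show ?thesis using n by simp
  qed
  have bad_sets: "{z. n < c z} \<in> sets borel" using c_sets[of "{n<..}"] by simp
  have vec2: "vec (\<eta>/2) + vec (\<eta>/2) = (vec \<eta> :: real ^ 'k)" by (simp add: vec_eq_iff)
  have near: "z \<le> d (c' z) + vec (\<eta>/2)" "d (c' z) \<le> z + vec (\<eta>/2)" if "c z \<le> n" for z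
    using le_add_vec_of_ball[of z "d (c z)" "\<eta>/2"] c[of z] that
    by (auto simp: c'_def dist_commute min_absorb1)
  have "dist_fun \<mu> (y - vec \<eta>) - \<eta> \<le> (\<Sum>j\<le>n. p j * dist_fun (F\<^sub>0 (\<psi> j)) y)" for y
  proof -
    \<comment> \<open>The shift by \<eta> splits into \<eta>/2 for the distance from
      \<open>z\<close> to its grid point and \<eta>/2 for the ball of the expert. The error \<eta>
      splits into the cut-off mass and the mass of the expert outside its ball.\<close>
    have "indicator {..y - vec \<eta>} z - indicator {z. n < c z} z - \<eta>/2 \<le> dist_fun (F\<^sub>0 (\<psi> (c' z))) y" for z
    proof (cases "z \<le> y - vec \<eta> \<and> c z \<le> n")
      case True
      have "d (c' z) \<le> z + vec (\<eta>/2)" using near True by blast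
      also have "\<dots> \<le> y - vec \<eta> + vec (\<eta>/2)" using True by (intro add_right_mono) simp
      also have "\<dots> = y - vec (\<eta>/2)" unfolding vec2[symmetric] by simp
      finally show ?thesis using low[of "c' z" y] True by (simp add: indicator_def)
    next
      case False
      then show ?thesis using a01(1)[of "c' z" y] \<eta> by (auto simp: indicator_def)
    qed
    then have "(\<integral>z. indicator {..y - vec \<eta>} z - indicator {z. n < c z} z - \<eta>/2 \<partial>\<mu>)
        \<le> (\<integral>z. dist_fun (F\<^sub>0 (\<psi> (c' z))) y \<partial>\<mu>)"
      using bad_sets
      by (intro integral_mono int_a Bochner_Integration.integrable_diff integrable_real_indicator integrable_const)
         (auto simp: emeasure_eq_measure)
    also have "(\<integral>z. indicator {..y - vec \<eta>} z - indicator {z. n < c z} z - \<eta>/2 \<partial>\<mu>)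
        = dist_fun \<mu> (y - vec \<eta>) - prob {z. n < c z} - \<eta>/2"
      using bad_sets by (simp add: emeasure_eq_measure dist_fun_def prob_space integrable_real_indicator)
    finally show ?thesis using bad by (simp add: mix)
  qed
  moreover have "(\<Sum>j\<le>n. p j * dist_fun (F\<^sub>0 (\<psi> j)) y) \<le> dist_fun \<mu> (y + vec \<eta>) + \<eta>" for y
  proof -
    have "dist_fun (F\<^sub>0 (\<psi> (c' z))) y \<le> indicator {..y + vec \<eta>} z + indicator {z. n < c z} z + \<eta>/2" for z
    proof (cases "\<not> z \<le> y + vec \<eta> \<and> c z \<le> n")
      case True
      have "\<not> d (c' z) \<le> y + vec (\<eta>/2)"
      proof
        assume "d (c' z) \<le> y + vec (\<eta>/2)"
        then have "d (c' z) + vec (\<eta>/2) \<le> y + vec (\<eta>/2) + vec (\<eta>/2)" by (rule add_right_mono)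
        then have "z \<le> y + vec \<eta>" using near(1)[of z] True vec2 by (metis add.assoc order_trans)
        then show False using True by simp
      qed
      then show ?thesis using up[of "c' z" y] True by (simp add: indicator_def)
    next
      case False
      then show ?thesis using a01(2)[of "c' z" y] \<eta> by (auto simp: indicator_def)
    qed
    then have "(\<integral>z. dist_fun (F\<^sub>0 (\<psi> (c' z))) y \<partial>\<mu>)
        \<le> (\<integral>z. indicator {..y + vec \<eta>} z + indicator {z. n < c z} z + \<eta>/2 \<partial>\<mu>)"
      using bad_sets
      by (intro integral_mono int_a Bochner_Integration.integrable_add integrable_real_indicator integrable_const)
         (auto simp: emeasure_eq_measure)
    also have "\<dots> = dist_fun \<mu> (y + vec \<eta>) + prob {z. n < c z} + \<eta>/2"
      using bad_sets by (simp add: emeasure_eq_measure dist_fun_def prob_space integrable_real_indicator)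
    finally show ?thesis using bad by (simp add: mix)
  qed
  moreover have "(\<Sum>j\<le>n. p j) = 1" using mix[of "\<lambda>_. 1"] by (simp add: prob_space)
  ultimately show ?thesis
    using \<psi> by (intro exI[of _ n] exI[of _ p] exI[of _ \<psi>]) (auto simp: p_def)
qed


section \<open>Softmax gating\<close>

text \<open>A weight \<open>p j\<close> enters the gate as the summand \<open>ln (p j)\<close> of
  the intercept. This requires \<open>p j > 0\<close>, so components of weight 0 are dropped before
  the rest are numbered from 1 to \<open>g\<close>.\<close>

lemma mmoe_softmax:
  fixes J :: "'j set" and a :: "'j \<Rightarrow> real ^ 'p"
  assumes fin: "finite J" and pos: "\<exists>j\<in>J. 0 < p j" and p: "\<And>j. j \<in> J \<Longrightarrow> 0 \<le> p j"
    and \<psi>: "\<And>j. j \<in> J \<Longrightarrow> \<psi> j \<in> \<Psi>\<^sub>0"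
  shows "(\<lambda>y x w. (\<Sum>j\<in>J. p j * exp (a0 j + a j \<bullet> x + (\<Sum>l=1..L. b j l * w l)) * dist_fun (F\<^sub>0 (\<psi> j)) y) /
      (\<Sum>j\<in>J. p j * exp (a0 j + a j \<bullet> x + (\<Sum>l=1..L. b j l * w l)))) \<in> mmoe_dist_funs L F\<^sub>0 \<Psi>\<^sub>0"
proof -
  define J' where "J' = {j\<in>J. 0 < p j}"
  have J': "finite J'" "J' \<noteq> {}" "J' \<subseteq> J" using fin pos by (auto simp: J'_def)
  define g where "g = card J'"
  have g: "1 \<le> g" using J' by (simp add: g_def card_gt_0_iff Suc_le_eq)
  obtain h where h: "bij_betw h {1..g} J'"
    using ex_bij_betw_nat_finite_1[OF J'(1)] unfolding g_def by blast
  have restr: "(\<Sum>j\<in>J. p j * f j) = (\<Sum>i=1..g. exp (ln (p (h i))) * f (h i))" for f :: "'j \<Rightarrow> real"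
  proof -
    have "(\<Sum>j\<in>J. p j * f j) = (\<Sum>j\<in>J'. p j * f j)"
      using fin J' p by (intro sum.mono_neutral_right) (auto simp: J'_def less_le)
    also have "\<dots> = (\<Sum>j\<in>J'. exp (ln (p j)) * f j)"
      by (intro sum.cong) (auto simp: J'_def)
    also have "\<dots> = (\<Sum>i=1..g. exp (ln (p (h i))) * f (h i))"
      by (rule sum.reindex_bij_betw[OF h, symmetric])
    finally show ?thesis .
  qed
  have "(\<lambda>y x w. (\<Sum>j\<in>J. p j * exp (a0 j + a j \<bullet> x + (\<Sum>l=1..L. b j l * w l)) * dist_fun (F\<^sub>0 (\<psi> j)) y) /
      (\<Sum>j\<in>J. p j * exp (a0 j + a j \<bullet> x + (\<Sum>l=1..L. b j l * w l))))
    = (\<lambda>y x w. \<Sum>i=1..g. gate L g (\<lambda>i. ln (p (h i)) + a0 (h i)) (\<lambda>i. a (h i)) (\<lambda>i. b (h i)) i x w *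
        dist_fun (F\<^sub>0 (\<psi> (h i))) y)"
    unfolding gate_def mult.assoc restr
    by (simp add: exp_add sum_divide_distrib mult.assoc)
  note eq = this
  have "\<forall>i\<in>{1..g}. \<psi> (h i) \<in> \<Psi>\<^sub>0"
    using h J' \<psi> by (auto simp: bij_betw_def)
  then show ?thesis
    unfolding mmoe_dist_funs_def mem_Collect_eq eq
    by (intro exI[of _ g] exI[of _ "\<lambda>i. ln (p (h i)) + a0 (h i)"] exI[of _ "\<lambda>i. a (h i)"]
          exI[of _ "\<lambda>i. b (h i)"] exI[of _ "\<lambda>i. \<psi> (h i)"] conjI g refl)
qed

text \<open>The center \<open>c0\<close> has weight at least \<open>exp (- t * (2 * e))\<close>, a
  far one at most \<open>exp (- t * (3 * e))\<close>. The ratio \<open>exp (- t * e)\<close>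
  outweighs the number of centers.\<close>

lemma softmax_far_weights:
  fixes d :: "'c \<Rightarrow> real"
  assumes fin: "finite C" and c0: "c0 \<in> C" "d c0 < 2 * e" and t: "0 \<le> t" "real (card C) * exp (- t * e) \<le> \<epsilon>"
  shows "(\<Sum>c\<in>{c\<in>C. 3 * e \<le> d c}. exp (- t * d c)) \<le> \<epsilon> * (\<Sum>c\<in>C. exp (- t * d c))"
proof -
  have "(\<Sum>c\<in>{c\<in>C. 3 * e \<le> d c}. exp (- t * d c)) \<le> (\<Sum>c\<in>{c\<in>C. 3 * e \<le> d c}. exp (- t * (3 * e)))"
    using t(1) by (intro sum_mono) (auto intro!: mult_left_mono)
  also have "\<dots> \<le> real (card C) * exp (- t * (3 * e))"
    using fin by (simp add: card_mono)
  also have "\<dots> = real (card C) * exp (- t * e) * exp (- t * (2 * e))"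
    by (simp add: exp_add[symmetric] algebra_simps)
  also have "\<dots> \<le> \<epsilon> * exp (- t * (2 * e))" using t(2) by (intro mult_right_mono) auto
  also have "\<dots> \<le> \<epsilon> * (\<Sum>c\<in>C. exp (- t * d c))"
  proof (rule mult_left_mono)
    have "exp (- t * (2 * e)) \<le> exp (- t * d c0)" using t(1) c0(2) by (auto intro!: mult_left_mono)
    also have "\<dots> \<le> (\<Sum>c\<in>C. exp (- t * d c))" using fin c0(1) by (intro member_le_sum) auto
    finally show "exp (- t * (2 * e)) \<le> (\<Sum>c\<in>C. exp (- t * d c))" .
    show "0 \<le> \<epsilon>" using t(2) by (rule order_trans[rotated]) simp
  qed
  finally show ?thesis .
qed

lemma exists_sharp_softmax:
  assumes "0 < e" "0 < \<epsilon>"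
  shows "\<exists>t\<ge>0. real k * exp (- t * e) \<le> \<epsilon>"
proof -
  \<comment> \<open>With \<open>u = k / \<epsilon>\<close> and \<open>t * e = u\<close>, the claim
    reduces to \<open>u \<le> exp u\<close>.\<close>
  define t where "t = real k / (e * \<epsilon>)"
  have te: "t * e = real k / \<epsilon>" using assms by (simp add: t_def)
  have "real k / \<epsilon> \<le> exp (real k / \<epsilon>)" using exp_ge_add_one_self[of "real k / \<epsilon>"] by linarith
  then have "real k * exp (- (t * e)) \<le> \<epsilon>"
    unfolding te exp_minus using assms by (simp add: field_simps)
  moreover have "0 \<le> t" using assms by (simp add: t_def)
  ultimately show ?thesis by (intro exI[of _ t]) simp
qed

text \<open>Indices outside \<open>P\<close> carry weight at most \<epsilon> and values in [0, 1].
  For the lower bound, where \<open>u\<close> may be negative, \<open>u \<le> 1\<close> ensures that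
  removing that weight costs no more than the weight itself.\<close>

lemma weighted_sum_bounds:
  fixes \<omega> m :: "'c \<Rightarrow> real"
  assumes fin: "finite C" and \<omega>: "\<And>c. c \<in> C \<Longrightarrow> 0 \<le> \<omega> c" "(\<Sum>c\<in>C. \<omega> c) = 1"
    and far: "(\<Sum>c\<in>{c\<in>C. \<not> P c}. \<omega> c) \<le> \<epsilon>"
    and m: "\<And>c. c \<in> C \<Longrightarrow> 0 \<le> m c \<and> m c \<le> 1"
  shows "\<lbrakk>\<And>c. c \<in> C \<Longrightarrow> P c \<Longrightarrow> m c \<le> u; 0 \<le> u\<rbrakk> \<Longrightarrow> (\<Sum>c\<in>C. \<omega> c * m c) \<le> u + \<epsilon>"
    and "\<lbrakk>\<And>c. c \<in> C \<Longrightarrow> P c \<Longrightarrow> u \<le> m c; u \<le> 1\<rbrakk> \<Longrightarrow> u - \<epsilon> \<le> (\<Sum>c\<in>C. \<omega> c * m c)"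
proof -
  have split: "(\<Sum>c\<in>C. f c) = (\<Sum>c\<in>{c\<in>C. P c}. f c) + (\<Sum>c\<in>{c\<in>C. \<not> P c}. f c)" for f :: "'c \<Rightarrow> real"
    using fin by (subst sum.union_disjoint[symmetric]) (auto intro!: sum.cong)
  have near1: "(\<Sum>c\<in>{c\<in>C. P c}. \<omega> c) \<le> 1"
    using \<omega>(2) split[of \<omega>] sum_nonneg[of "{c\<in>C. \<not> P c}" \<omega>] \<omega>(1) by fastforce
  {
    assume u: "\<And>c. c \<in> C \<Longrightarrow> P c \<Longrightarrow> m c \<le> u" "0 \<le> u"
    have "(\<Sum>c\<in>C. \<omega> c * m c) \<le> (\<Sum>c\<in>{c\<in>C. P c}. \<omega> c * u) + (\<Sum>c\<in>{c\<in>C. \<not> P c}. \<omega> c * 1)"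
      unfolding split[of "\<lambda>c. \<omega> c * m c"] using u \<omega>(1) m
      by (intro add_mono sum_mono mult_left_mono) auto
    also have "\<dots> \<le> 1 * u + \<epsilon>"
      unfolding sum_distrib_right[symmetric] using near1 far u(2) by (intro add_mono mult_right_mono) auto
    finally show "(\<Sum>c\<in>C. \<omega> c * m c) \<le> u + \<epsilon>" by simp
  next
    assume u: "\<And>c. c \<in> C \<Longrightarrow> P c \<Longrightarrow> u \<le> m c" "u \<le> 1"
    have "u - \<epsilon> \<le> u - (\<Sum>c\<in>{c\<in>C. \<not> P c}. \<omega> c)" using far by simp
    also have "\<dots> \<le> u - u * (\<Sum>c\<in>{c\<in>C. \<not> P c}. \<omega> c)"
    proof -
      have "0 \<le> (\<Sum>c\<in>{c\<in>C. \<not> P c}. \<omega> c)" using \<omega>(1) by (intro sum_nonneg) simp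
      from mult_right_mono[OF u(2) this] show ?thesis by simp
    qed
    also have "\<dots> = u * (\<Sum>c\<in>{c\<in>C. P c}. \<omega> c)"
    proof -
      have "(\<Sum>c\<in>{c\<in>C. P c}. \<omega> c) = 1 - (\<Sum>c\<in>{c\<in>C. \<not> P c}. \<omega> c)"
        using \<omega>(2) split[of \<omega>] by simp
      then show ?thesis by (simp add: right_diff_distrib)
    qed
    also have "\<dots> \<le> (\<Sum>c\<in>C. \<omega> c * m c)"
    proof -
      have "u * (\<Sum>c\<in>{c\<in>C. P c}. \<omega> c) = (\<Sum>c\<in>{c\<in>C. P c}. \<omega> c * u)"
        by (simp add: sum_distrib_left mult.commute)
      also have "\<dots> \<le> (\<Sum>c\<in>{c\<in>C. P c}. \<omega> c * m c) + (\<Sum>c\<in>{c\<in>C. \<not> P c}. \<omega> c * m c)"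
        using u \<omega>(1) m sum_nonneg[of "{c\<in>C. \<not> P c}" "\<lambda>c. \<omega> c * m c"]
        by (intro order_trans[OF _ add_increasing2]) (auto intro!: sum_mono mult_left_mono)
      finally show ?thesis unfolding split[of "\<lambda>c. \<omega> c * m c"] .
    qed
    finally show "u - \<epsilon> \<le> (\<Sum>c\<in>C. \<omega> c * m c)" .
  }
qed

text \<open>Softmax gating with scores \<open>-t (|x - a|\<^sup>2 + |w - v|\<^sup>2)\<close>, which are affine in \<open>(x, w)\<close> up to a
  term common to all components, selects the centers \<open>(a, v)\<close> nearest to \<open>(x, w)\<close>.\<close>

lemma mmoe_nearest_centers:
  fixes F\<^sub>0 :: "'s \<Rightarrow> (real ^ 'k) measure" and A :: "(real ^ 'p) set"
    and \<mu> :: "real ^ 'p \<Rightarrow> (nat \<Rightarrow> real) \<Rightarrow> (real ^ 'k) measure"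
  assumes F0: "\<And>\<psi>. \<psi> \<in> \<Psi>\<^sub>0 \<Longrightarrow> prob_space (F\<^sub>0 \<psi>) \<and> sets (F\<^sub>0 \<psi>) = sets borel"
    and dense: "\<And>q. \<exists>\<psi> :: nat \<Rightarrow> 's. (\<forall>n. \<psi> n \<in> \<Psi>\<^sub>0) \<and>
               converges_weakly (\<lambda>n. F\<^sub>0 (\<psi> n)) (return borel q)"
    and A: "finite A" "A \<noteq> {}" and V: "finite V" "V \<noteq> {}"
    and \<mu>: "\<And>a v. a \<in> A \<Longrightarrow> v \<in> V \<Longrightarrow> prob_space (\<mu> a v) \<and> sets (\<mu> a v) = sets borel"
    and e: "0 < e" and \<epsilon>: "0 < \<epsilon>"
  obtains F where "F \<in> mmoe_dist_funs L F\<^sub>0 \<Psi>\<^sub>0"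
    "\<And>x w y u. \<lbrakk>\<exists>a\<in>A. (dist x a)\<^sup>2 < e; \<exists>v\<in>V. sqdist {1..L} w v < e;
      \<And>a v. a \<in> A \<Longrightarrow> v \<in> V \<Longrightarrow> (dist x a)\<^sup>2 < 3 * e \<Longrightarrow> sqdist {1..L} w v < 3 * e \<Longrightarrow>
        dist_fun (\<mu> a v) (y + vec \<epsilon>) \<le> u\<rbrakk> \<Longrightarrow> F y x w \<le> u + 2 * \<epsilon>"
    "\<And>x w y u. \<lbrakk>\<exists>a\<in>A. (dist x a)\<^sup>2 < e; \<exists>v\<in>V. sqdist {1..L} w v < e;
      \<And>a v. a \<in> A \<Longrightarrow> v \<in> V \<Longrightarrow> (dist x a)\<^sup>2 < 3 * e \<Longrightarrow> sqdist {1..L} w v < 3 * e \<Longrightarrow>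
        u \<le> dist_fun (\<mu> a v) (y - vec \<epsilon>)\<rbrakk> \<Longrightarrow> u - 2 * \<epsilon> \<le> F y x w"
proof -
  define mix where "mix n p \<psi> y = (\<Sum>j\<le>n. p j * dist_fun (F\<^sub>0 (\<psi> j)) y)"
    for n :: nat and p :: "nat \<Rightarrow> real" and \<psi> :: "nat \<Rightarrow> 's" and y
  let ?C = "A \<times> V"
  have fC: "finite ?C" using A V by simp
  define fits where "fits c q \<longleftrightarrow> (case q of (n, p, \<psi>) \<Rightarrow> (\<forall>j\<le>n. 0 \<le> p j \<and> \<psi> j \<in> \<Psi>\<^sub>0) \<and> (\<Sum>j\<le>n. p j) = 1 \<and>
    (\<forall>y. dist_fun (\<mu> (fst c) (snd c)) (y - vec \<epsilon>) - \<epsilon> \<le> mix n p \<psi> y \<and>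
         mix n p \<psi> y \<le> dist_fun (\<mu> (fst c) (snd c)) (y + vec \<epsilon>) + \<epsilon>))" for c q
  have "\<forall>c\<in>?C. \<exists>q. fits c q"
  proof
    fix c assume "c \<in> ?C"
    then have "prob_space (\<mu> (fst c) (snd c))" "sets (\<mu> (fst c) (snd c)) = sets borel" using \<mu> by auto
    from finite_mixture_approximation[OF F0 dense this \<epsilon>]
    show "\<exists>q. fits c q" unfolding mix_def fits_def by auto
  qed
  from bchoice[OF this] obtain q where q: "\<forall>c\<in>?C. fits c (q c)" ..
  define n where "n c = fst (q c)" for c
  define p where "p c = fst (snd (q c))" for c
  define \<psi> where "\<psi> c = snd (snd (q c))" for c
  have Q: "(\<forall>j\<le>n c. 0 \<le> p c j \<and> \<psi> c j \<in> \<Psi>\<^sub>0) \<and> (\<Sum>j\<le>n c. p c j) = 1 \<and>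
    (\<forall>y. dist_fun (\<mu> (fst c) (snd c)) (y - vec \<epsilon>) - \<epsilon> \<le> mix (n c) (p c) (\<psi> c) y \<and>
         mix (n c) (p c) (\<psi> c) y \<le> dist_fun (\<mu> (fst c) (snd c)) (y + vec \<epsilon>) + \<epsilon>)" if "c \<in> ?C" for c
    using q[rule_format, OF that] unfolding fits_def n_def p_def \<psi>_def case_prod_beta .
  have mix01: "0 \<le> mix (n c) (p c) (\<psi> c) y \<and> mix (n c) (p c) (\<psi> c) y \<le> 1" if "c \<in> ?C" for c y
  proof
    have a01: "0 \<le> dist_fun (F\<^sub>0 (\<psi> c j)) y" "dist_fun (F\<^sub>0 (\<psi> c j)) y \<le> 1" if "j \<le> n c" for j
      using F0[of "\<psi> c j"] Q[OF \<open>c \<in> ?C\<close>] that by (auto simp: dist_fun_def intro!: prob_space.prob_le_1)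
    show "0 \<le> mix (n c) (p c) (\<psi> c) y"
      unfolding mix_def using Q[OF that] a01 by (intro sum_nonneg) auto
    have "mix (n c) (p c) (\<psi> c) y \<le> (\<Sum>j\<le>n c. p c j * 1)"
      unfolding mix_def using Q[OF that] a01 by (intro sum_mono mult_left_mono) auto
    then show "mix (n c) (p c) (\<psi> c) y \<le> 1" using Q[OF that] by simp
  qed
  obtain t where t: "0 \<le> t" "real (card ?C) * exp (- t * e) \<le> \<epsilon>"
    using exists_sharp_softmax[OF e \<epsilon>] by blast
  \<comment> \<open>A component is a center together with an index of the mixture at that center.
    Scores depend only on the center, so its softmax weight is distributed according to
    \<open>p c\<close>.\<close>
  define J where "J = (SIGMA c:?C. {..n c})"
  define a0 where "a0 z = - t * (fst (fst z) \<bullet> fst (fst z) + (\<Sum>l=1..L. (snd (fst z) l)\<^sup>2))"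
    for z :: "((real ^ 'p) \<times> (nat \<Rightarrow> real)) \<times> nat"
  define al where "al z = (2 * t) *\<^sub>R fst (fst z)" for z :: "((real ^ 'p) \<times> (nat \<Rightarrow> real)) \<times> nat"
  define be where "be z l = 2 * t * snd (fst z) l" for z :: "((real ^ 'p) \<times> (nat \<Rightarrow> real)) \<times> nat" and l
  define P where "P z = p (fst z) (snd z)" for z
  define \<Psi> where "\<Psi> z = \<psi> (fst z) (snd z)" for z
  define F where "F = (\<lambda>y x w. (\<Sum>z\<in>J. P z * exp (a0 z + al z \<bullet> x + (\<Sum>l=1..L. be z l * w l)) * dist_fun (F\<^sub>0 (\<Psi> z)) y) /
      (\<Sum>z\<in>J. P z * exp (a0 z + al z \<bullet> x + (\<Sum>l=1..L. be z l * w l))))"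
  have "F \<in> mmoe_dist_funs L F\<^sub>0 \<Psi>\<^sub>0"
    unfolding F_def
  proof (rule mmoe_softmax)
    show "finite J" using fC by (auto simp: J_def)
    show "0 \<le> P z" "\<Psi> z \<in> \<Psi>\<^sub>0" if "z \<in> J" for z
      using Q[of "fst z"] that by (auto simp: J_def P_def \<Psi>_def)
    obtain c where c: "c \<in> ?C" using A V by auto
    have "\<exists>j\<le>n c. 0 < p c j"
    proof (rule ccontr)
      assume "\<not> ?thesis"
      then have "(\<Sum>j\<le>n c. p c j) \<le> (\<Sum>j\<le>n c. 0)" by (intro sum_mono) (auto simp: not_less)
      then show False using Q[OF c] by simp
    qed
    then obtain j where "j \<le> n c" "0 < p c j" by blast
    then show "\<exists>z\<in>J. 0 < P z" using c by (intro bexI[of _ "(c, j)"]) (auto simp: J_def P_def)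
  qed
  define d where "d x w c = (dist x (fst c))\<^sup>2 + sqdist {1..L} w (snd c)"
    for x :: "real ^ 'p" and w and c :: "(real ^ 'p) \<times> (nat \<Rightarrow> real)"
  \<comment> \<open>Completing the square: \<open>E x w\<close> is common to all components and
    cancels in the quotient, which leaves the scores \<open>- t * d x w c\<close>.\<close>
  define E where "E x w = exp (t * (x \<bullet> x + (\<Sum>l=1..L. (w l)\<^sup>2)))" for x :: "real ^ 'p" and w :: "nat \<Rightarrow> real"
  have expo: "exp (a0 z + al z \<bullet> x + (\<Sum>l=1..L. be z l * w l)) = E x w * exp (- t * d x w (fst z))" for z x w
  proof -
    have "(\<Sum>l=1..L. be z l * w l) - t * (\<Sum>l=1..L. (snd (fst z) l)\<^sup>2)
        = t * (\<Sum>l=1..L. (w l)\<^sup>2) - t * sqdist {1..L} w (snd (fst z))"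
      unfolding sqdist_def be_def sum_distrib_left sum_subtractf[symmetric]
      by (intro sum.cong) (auto simp: power2_eq_square algebra_simps)
    moreover have "al z \<bullet> x - t * (fst (fst z) \<bullet> fst (fst z)) = t * (x \<bullet> x) - t * (dist x (fst (fst z)))\<^sup>2"
      unfolding al_def dist_norm power2_norm_eq_inner
      by (simp add: inner_diff algebra_simps inner_commute)
    ultimately have "a0 z + al z \<bullet> x + (\<Sum>l=1..L. be z l * w l)
        = t * (x \<bullet> x + (\<Sum>l=1..L. (w l)\<^sup>2)) + (- t * d x w (fst z))"
      unfolding a0_def d_def by (simp add: algebra_simps)
    then show ?thesis unfolding E_def exp_add[symmetric] by (rule arg_cong)
  qed
  define Z where "Z x w = (\<Sum>c\<in>?C. exp (- t * d x w c))" for x w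
  define \<omega> where "\<omega> x w c = exp (- t * d x w c) / Z x w" for x w c
  have Z: "0 < Z x w" for x w unfolding Z_def using A V by (intro sum_pos) auto
  have sumJ: "(\<Sum>z\<in>J. P z * exp (a0 z + al z \<bullet> x + (\<Sum>l=1..L. be z l * w l)) * f z)
      = E x w * (\<Sum>c\<in>?C. exp (- t * d x w c) * (\<Sum>j\<le>n c. p c j * f (c, j)))" for f x w
  proof -
    have "(\<Sum>z\<in>J. P z * exp (a0 z + al z \<bullet> x + (\<Sum>l=1..L. be z l * w l)) * f z)
        = (\<Sum>c\<in>?C. \<Sum>j\<le>n c. p c j * (E x w * exp (- t * d x w c)) * f (c, j))"
      unfolding J_def expo P_def using fC by (subst sum.Sigma) (auto simp: case_prod_beta)
    then show ?thesis by (simp add: sum_distrib_left mult_ac)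
  qed
  have F_eq: "F y x w = (\<Sum>c\<in>?C. \<omega> x w c * mix (n c) (p c) (\<psi> c) y)" for y x w
  proof -
    have "(\<Sum>z\<in>J. P z * exp (a0 z + al z \<bullet> x + (\<Sum>l=1..L. be z l * w l)))
        = E x w * (\<Sum>c\<in>?C. exp (- t * d x w c) * (\<Sum>j\<le>n c. p c j))"
      using sumJ[of x w "\<lambda>_. 1"] by simp
    also have "\<dots> = E x w * Z x w" unfolding Z_def using Q by (intro arg_cong2[where f = "(*)"] sum.cong) auto
    finally have den: "(\<Sum>z\<in>J. P z * exp (a0 z + al z \<bullet> x + (\<Sum>l=1..L. be z l * w l))) = E x w * Z x w" .
    have "E x w \<noteq> 0" by (simp add: E_def)
    then show ?thesis
      unfolding F_def den sumJ by (simp add: \<omega>_def mix_def \<Psi>_def sum_divide_distrib)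
  qed
  have \<omega>: "\<And>c. 0 \<le> \<omega> x w c" "(\<Sum>c\<in>?C. \<omega> x w c) = 1" for x w
    using Z[of x w] by (auto simp: \<omega>_def sum_divide_distrib[symmetric] Z_def intro: less_imp_le)
  have near: "\<exists>c\<in>?C. d x w c < 2 * e" if "\<exists>a\<in>A. (dist x a)\<^sup>2 < e" "\<exists>v\<in>V. sqdist {1..L} w v < e" for x w
  proof -
    obtain a v where "a \<in> A" "v \<in> V" "(dist x a)\<^sup>2 < e" "sqdist {1..L} w v < e" using \<open>\<exists>a\<in>A. _\<close> \<open>\<exists>v\<in>V. _\<close> by blast
    then show ?thesis by (intro bexI[of _ "(a, v)"]) (auto simp: d_def)
  qed
  have near': "(dist x (fst c))\<^sup>2 < 3 * e" "sqdist {1..L} w (snd c) < 3 * e" if "d x w c < 3 * e" for x w c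
    using that sqdist_nonneg[of "{1..L}" w "snd c"] zero_le_power2[of "dist x (fst c)"]
    unfolding d_def by linarith+
  have far: "(\<Sum>c\<in>{c\<in>?C. \<not> d x w c < 3 * e}. \<omega> x w c) \<le> \<epsilon>"
    if nr: "\<exists>a\<in>A. (dist x a)\<^sup>2 < e" "\<exists>v\<in>V. sqdist {1..L} w v < e" for x w
  proof -
    obtain c0 where c0: "c0 \<in> ?C" "d x w c0 < 2 * e" using near[OF nr] by blast
    have "(\<Sum>c\<in>{c\<in>?C. 3 * e \<le> d x w c}. exp (- t * d x w c)) \<le> \<epsilon> * Z x w"
      unfolding Z_def by (rule softmax_far_weights[where d = "d x w", OF fC c0 t])
    then show ?thesis using Z[of x w]
      by (simp add: \<omega>_def sum_divide_distrib[symmetric] not_less divide_le_eq)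
  qed
  show ?thesis
  proof (rule that[OF \<open>F \<in> _\<close>])
    fix x w y u
    assume *: "\<exists>a\<in>A. (dist x a)\<^sup>2 < e" "\<exists>v\<in>V. sqdist {1..L} w v < e"
    {
      assume u: "\<And>a v. a \<in> A \<Longrightarrow> v \<in> V \<Longrightarrow> (dist x a)\<^sup>2 < 3 * e \<Longrightarrow> sqdist {1..L} w v < 3 * e \<Longrightarrow>
        dist_fun (\<mu> a v) (y + vec \<epsilon>) \<le> u"
      have u': "dist_fun (\<mu> (fst c) (snd c)) (y + vec \<epsilon>) \<le> u" if "c \<in> ?C" "d x w c < 3 * e" for c
        using u[of "fst c" "snd c"] near'[OF that(2)] that(1) by auto
      have u'': "mix (n c) (p c) (\<psi> c) y \<le> u + \<epsilon>" if "c \<in> ?C" "d x w c < 3 * e" for c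
        using u'[OF that] Q[OF that(1)] by (meson add_right_mono order_trans)
      \<comment> \<open>A near center exists, so the condition on \<open>u\<close> is not vacuous
        and forces \<open>0 \<le> u\<close>.\<close>
      obtain c0 where c0: "c0 \<in> ?C" "d x w c0 < 3 * e" using near[OF *] e by fastforce
      have "0 \<le> u" using u'[OF c0] by (rule order_trans[rotated]) (simp add: dist_fun_def)
      then have "F y x w \<le> (u + \<epsilon>) + \<epsilon>"
        unfolding F_eq using u'' \<epsilon> by (intro weighted_sum_bounds(1)[OF fC \<omega> far[OF *] mix01]) auto
      then show "F y x w \<le> u + 2 * \<epsilon>" by simp
    next
      assume u: "\<And>a v. a \<in> A \<Longrightarrow> v \<in> V \<Longrightarrow> (dist x a)\<^sup>2 < 3 * e \<Longrightarrow> sqdist {1..L} w v < 3 * e \<Longrightarrow>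
        u \<le> dist_fun (\<mu> a v) (y - vec \<epsilon>)"
      have u': "u \<le> dist_fun (\<mu> (fst c) (snd c)) (y - vec \<epsilon>)" if "c \<in> ?C" "d x w c < 3 * e" for c
        using u[of "fst c" "snd c"] near'[OF that(2)] that(1) by auto
      have u'': "u - \<epsilon> \<le> mix (n c) (p c) (\<psi> c) y" if "c \<in> ?C" "d x w c < 3 * e" for c
        using u'[OF that] Q[OF that(1)] by (meson diff_right_mono order_trans)
      obtain c0 where c0: "c0 \<in> ?C" "d x w c0 < 3 * e" using near[OF *] e by fastforce
      have "u - \<epsilon> \<le> 1" using u''[OF c0] mix01[OF c0(1)] by (meson order_trans)
      then have "(u - \<epsilon>) - \<epsilon> \<le> F y x w"
        unfolding F_eq using u'' by (intro weighted_sum_bounds(2)[OF fC \<omega> far[OF *] mix01]) auto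
      then show "u - 2 * \<epsilon> \<le> F y x w" by simp
    }
  qed
qed

lemma mmoe_dist_funs_nonempty:
  assumes "\<psi> \<in> \<Psi>\<^sub>0"
  shows "\<exists>F. F \<in> mmoe_dist_funs L F\<^sub>0 \<Psi>\<^sub>0"
proof -
  have "(\<lambda>y x w. (\<Sum>j\<in>{0::nat}. 1 * exp (0 + 0 \<bullet> x + (\<Sum>l=1..L. 0 * w l)) * dist_fun (F\<^sub>0 \<psi>) y) /
      (\<Sum>j\<in>{0::nat}. 1 * exp (0 + 0 \<bullet> x + (\<Sum>l=1..L. 0 * w l)))) \<in> mmoe_dist_funs L F\<^sub>0 \<Psi>\<^sub>0"
    by (rule mmoe_softmax[where p = "\<lambda>_. 1" and a = "\<lambda>_. 0" and \<psi> = "\<lambda>_. \<psi>"]) (auto simp: assms)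
  then show ?thesis by blast
qed

lemma norm_vec_le:
  fixes r :: real
  assumes "0 \<le> r"
  shows "norm (vec r :: real ^ 'k) \<le> real CARD('k) * r"
  using norm_le_l1_cart[of "vec r :: real ^ 'k"] assms by simp

text \<open>Covariates range over an arbitrary set \<open>X\<close>, so the centers in the covariate space are taken
  in \<open>X\<close> itself and convergence is locally uniform in \<open>x \<in> X\<close>.\<close>

proposition mmoe_local_approximation:
  fixes F\<^sub>0 :: "'s \<Rightarrow> (real ^ 'k) measure" and X :: "(real ^ 'p) set"
    and h :: "real ^ 'p \<Rightarrow> (nat \<Rightarrow> real) \<Rightarrow> (real ^ 'k) measure"
    and \<Phi> :: "nat \<Rightarrow> real measure" and B :: "nat \<Rightarrow> (nat \<Rightarrow> real) set" and L :: nat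
  defines "\<Omega> \<equiv> PiM {1..L} \<Phi>"
  assumes F0: "\<And>\<psi>. \<psi> \<in> \<Psi>\<^sub>0 \<Longrightarrow> prob_space (F\<^sub>0 \<psi>) \<and> sets (F\<^sub>0 \<psi>) = sets borel"
    and dense: "\<And>q. \<exists>\<psi> :: nat \<Rightarrow> 's. (\<forall>n. \<psi> n \<in> \<Psi>\<^sub>0) \<and>
               converges_weakly (\<lambda>n. F\<^sub>0 (\<psi> n)) (return borel q)"
    and \<Phi>: "\<And>l. real_distribution (\<Phi> l)"
    and B: "\<And>m. B m \<in> sets \<Omega>"
    and h: "\<And>x w. x \<in> X \<Longrightarrow> w \<in> space \<Omega> \<Longrightarrow> prob_space (h x w) \<and> sets (h x w) = sets borel"
    and cont: "\<And>y x w \<epsilon>. x \<in> X \<Longrightarrow> w \<in> space \<Omega> \<Longrightarrow> 0 < \<epsilon> \<Longrightarrow>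
      \<exists>M \<rho>. 0 < \<rho> \<and> (\<forall>y' x' v. dist y' y < \<rho> \<longrightarrow> x' \<in> X \<longrightarrow> dist x' x < \<rho> \<longrightarrow> v \<in> space \<Omega> \<longrightarrow>
        (\<forall>m<M. w \<in> B m \<longrightarrow> v \<in> B m) \<longrightarrow> \<bar>dist_fun (h x' v) y' - dist_fun (h x w) y\<bar> < \<epsilon>)"
  shows "\<exists>F. (\<forall>n::nat. F n \<in> mmoe_dist_funs L F\<^sub>0 \<Psi>\<^sub>0) \<and>
    (AE w in \<Omega>. \<forall>x\<in>X. \<forall>y. \<forall>\<epsilon>>0. \<exists>N \<delta>. 0 < \<delta> \<and>
      (\<forall>n\<ge>N. \<forall>x'\<in>X. dist x' x < \<delta> \<longrightarrow> \<bar>F n y x' w - dist_fun (h x w) y\<bar> < \<epsilon>))"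
proof -
  interpret \<Phi>: real_distribution "\<Phi> l" for l by (rule \<Phi>)
  interpret \<Omega>: prob_space \<Omega> unfolding \<Omega>_def by (rule prob_space_PiM) (rule \<Phi>.prob_space_axioms)
  \<comment> \<open>The tolerances \<open>(1/2) ^ n\<close> are chosen summable. Stage
    \<open>n\<close> respects only the first \<open>n\<close> sets \<open>B m\<close>; any fixed
    number of them is respected from some stage on.\<close>
  define good where "good n z \<longleftrightarrow> (case z of (K, \<delta>) \<Rightarrow> compact K \<and> K \<in> sets \<Omega> \<and>
    \<Omega>.prob (space \<Omega> - K) < (1/2) ^ n \<and> 0 < \<delta> \<and>
    (\<forall>m<n. \<forall>v\<in>K. \<forall>w\<in>K. sqdist {1..L} v w < \<delta> \<longrightarrow> w \<in> B m \<longrightarrow> v \<in> B m))" for n z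
  define z where "z n = (SOME z. good n z)" for n
  have good: "good n (z n)" for n
  proof -
    obtain K \<delta> where "good n (K, \<delta>)"
      using compact_locally_constant[of "{1..L}" \<Phi> B "(1/2) ^ n" n] \<Phi> B unfolding \<Omega>_def good_def by auto
    then show ?thesis unfolding z_def by (rule someI)
  qed
  define K where "K n = fst (z n)" for n
  define \<delta> where "\<delta> n = snd (z n)" for n
  have K: "compact (K n)" "K n \<in> sets \<Omega>" "\<Omega>.prob (space \<Omega> - K n) < (1/2) ^ n" "0 < \<delta> n"
    and K\<delta>: "\<And>m v w. m < n \<Longrightarrow> v \<in> K n \<Longrightarrow> w \<in> K n \<Longrightarrow> sqdist {1..L} v w < \<delta> n \<Longrightarrow> w \<in> B m \<Longrightarrow> v \<in> B m" for n
    using good[of n] unfolding good_def K_def \<delta>_def case_prod_beta by blast+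
  have KO: "K n \<subseteq> space \<Omega>" for n using sets.sets_into_space[OF K(2)] .
  define near where "near n x w a v \<longleftrightarrow> a \<in> X \<and> v \<in> K n \<and> dist x a < 2 / Suc n \<and> sqdist {1..L} w v < \<delta> n"
    for n and x a :: "real ^ 'p" and w v
  define stage where "stage n F \<longleftrightarrow> F \<in> mmoe_dist_funs L F\<^sub>0 \<Psi>\<^sub>0 \<and>
    (\<forall>x\<in>X. norm x \<le> real n \<longrightarrow> (\<forall>w\<in>K n. \<forall>y u.
      ((\<forall>a v. near n x w a v \<longrightarrow> dist_fun (h a v) (y + vec (1 / Suc n)) \<le> u) \<longrightarrow> F y x w \<le> u + 2 * (1 / Suc n)) \<and>
      ((\<forall>a v. near n x w a v \<longrightarrow> u \<le> dist_fun (h a v) (y - vec (1 / Suc n))) \<longrightarrow> u - 2 * (1 / Suc n) \<le> F y x w)))"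
    for n F
  have "\<exists>F. stage n F" for n
  \<comment> \<open>Without centers the requirement at stage \<open>n\<close> is vacuous, and any
    MMoE function will do.\<close>
  proof (cases "X \<inter> cball 0 (real n) = {} \<or> K n = {}")
    case True
    obtain \<psi> where "\<psi> \<in> \<Psi>\<^sub>0" using dense by blast
    from mmoe_dist_funs_nonempty[where L = L and F\<^sub>0 = F\<^sub>0, OF this]
    obtain F :: "real ^ 'k \<Rightarrow> real ^ 'p \<Rightarrow> (nat \<Rightarrow> real) \<Rightarrow> real"
      where F: "F \<in> mmoe_dist_funs L F\<^sub>0 \<Psi>\<^sub>0" by blast
    have no: False if "x \<in> X" "norm x \<le> real n" "w \<in> K n" for x w using True that by auto
    have "stage n F" unfolding stage_def by (intro conjI F ballI impI allI) (drule (2) no, simp)+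
    then show ?thesis by blast
  next
    case False
    \<comment> \<open>\<open>3 * e\<close> bounds the squared distances to the centers that matter
      in \<open>mmoe_nearest_centers\<close>; the two bounds on \<open>e\<close> fit it to the radii
      \<open>\<delta> n\<close> and \<open>2 / Suc n\<close> in \<open>near\<close>.\<close>
    define e where "e = min (\<delta> n / 3) ((1 / Suc n)\<^sup>2)"
    have e: "0 < e" "3 * e \<le> \<delta> n" "3 * e < (2 / Suc n)\<^sup>2"
    proof -
      have "e \<le> (1 / Suc n)\<^sup>2" "0 < (1 / real (Suc n))\<^sup>2" by (auto simp: e_def)
      then have "3 * e < 4 * (1 / real (Suc n))\<^sup>2" by linarith
      then show "3 * e < (2 / Suc n)\<^sup>2" by (simp add: power_divide)
    qed (use K(4)[of n] in \<open>auto simp: e_def\<close>)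
    obtain V where V: "finite V" "V \<subseteq> K n" "\<And>w. w \<in> K n \<Longrightarrow> \<exists>v\<in>V. sqdist {1..L} w v < e"
      by (rule compact_finite_sqdist_net[OF K(1) e(1), of n "{1..L}"]) (rule that, assumption, assumption, blast)
    have bd: "bounded (X \<inter> cball 0 (real n))" by (simp add: bounded_Int)
    have se: "0 < sqrt e" using e by simp
    obtain A where A: "finite A" "A \<subseteq> X \<inter> cball 0 (real n)" "\<And>x. x \<in> X \<inter> cball 0 (real n) \<Longrightarrow> \<exists>a\<in>A. dist x a < sqrt e"
      using bounded_finite_net[OF bd se] by metis
    have ne: "A \<noteq> {}" "V \<noteq> {}" using False A(3) V(3) by blast+
    have \<mu>: "prob_space (h a v) \<and> sets (h a v) = sets borel" if "a \<in> A" "v \<in> V" for a v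
      using that A V KO h by blast
    have pos: "0 < 1 / real (Suc n)" by simp
    show ?thesis
    proof (rule mmoe_nearest_centers[where L = L, OF F0 dense A(1) ne(1) V(1) ne(2) \<mu> e(1) pos])
      fix F assume F: "F \<in> mmoe_dist_funs L F\<^sub>0 \<Psi>\<^sub>0"
        "\<And>x w y u. \<lbrakk>\<exists>a\<in>A. (dist x a)\<^sup>2 < e; \<exists>v\<in>V. sqdist {1..L} w v < e;
          \<And>a v. a \<in> A \<Longrightarrow> v \<in> V \<Longrightarrow> (dist x a)\<^sup>2 < 3 * e \<Longrightarrow> sqdist {1..L} w v < 3 * e \<Longrightarrow>
            dist_fun (h a v) (y + vec (1 / Suc n)) \<le> u\<rbrakk> \<Longrightarrow> F y x w \<le> u + 2 * (1 / Suc n)"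
        "\<And>x w y u. \<lbrakk>\<exists>a\<in>A. (dist x a)\<^sup>2 < e; \<exists>v\<in>V. sqdist {1..L} w v < e;
          \<And>a v. a \<in> A \<Longrightarrow> v \<in> V \<Longrightarrow> (dist x a)\<^sup>2 < 3 * e \<Longrightarrow> sqdist {1..L} w v < 3 * e \<Longrightarrow>
            u \<le> dist_fun (h a v) (y - vec (1 / Suc n))\<rbrakk> \<Longrightarrow> u - 2 * (1 / Suc n) \<le> F y x w"
      have nearI: "near n x w a v" if "a \<in> A" "v \<in> V" "(dist x a)\<^sup>2 < 3 * e" "sqdist {1..L} w v < 3 * e" for x w a v
      proof -
        have "(dist x a)\<^sup>2 < (2 / Suc n)\<^sup>2" using that(3) e(3) by linarith
        then have "dist x a < 2 / Suc n" by (rule power_less_imp_less_base) simp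
        then show ?thesis unfolding near_def using that A V e(2) by auto
      qed
      have "stage n F"
        unfolding stage_def
      proof (intro conjI F(1) ballI impI allI)
        fix x w y u assume x: "x \<in> X" "norm x \<le> real n" and w: "w \<in> K n"
        have "\<exists>a\<in>A. dist x a < sqrt e" using A(3)[of x] x by simp
        moreover have "(dist x a)\<^sup>2 < e" if "dist x a < sqrt e" for a
          using power_strict_mono[OF that, of 2] e(1) by simp
        ultimately have a: "\<exists>a\<in>A. (dist x a)\<^sup>2 < e" by blast
        note v = V(3)[OF w]
        show "F y x w \<le> u + 2 * (1 / Suc n)"
          if "\<forall>a v. near n x w a v \<longrightarrow> dist_fun (h a v) (y + vec (1 / Suc n)) \<le> u"
          by (rule F(2)[OF a v]) (use that nearI in blast)
        show "u - 2 * (1 / Suc n) \<le> F y x w"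
          if "\<forall>a v. near n x w a v \<longrightarrow> u \<le> dist_fun (h a v) (y - vec (1 / Suc n))"
          by (rule F(3)[OF a v]) (use that nearI in blast)
      qed
      then show "\<exists>F. stage n F" by blast
    qed
  qed
  then have st: "stage n (SOME F. stage n F)" for n by (rule someI_ex)
  define F where "F n = (SOME F. stage n F)" for n
  have F: "F n \<in> mmoe_dist_funs L F\<^sub>0 \<Psi>\<^sub>0" for n using st[of n] unfolding stage_def F_def by blast
  have F_up: "F n y x w \<le> u + 2 * (1 / Suc n)"
    if "x \<in> X" "norm x \<le> real n" "w \<in> K n" "\<And>a v. near n x w a v \<Longrightarrow> dist_fun (h a v) (y + vec (1 / Suc n)) \<le> u"
    for n x y w u
    using st[of n] that unfolding stage_def F_def by blast
  have F_low: "u - 2 * (1 / Suc n) \<le> F n y x w"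
    if "x \<in> X" "norm x \<le> real n" "w \<in> K n" "\<And>a v. near n x w a v \<Longrightarrow> u \<le> dist_fun (h a v) (y - vec (1 / Suc n))"
    for n x y w u
    using st[of n] that unfolding stage_def F_def by blast
  \<comment> \<open>Borel-Cantelli: almost every \<open>w\<close> lies in \<open>K n\<close> for all
    large \<open>n\<close>, so the bounds of stage \<open>n\<close> eventually apply to it.\<close>
  have "AE w in \<Omega>. \<forall>\<^sub>F n in sequentially. w \<in> space \<Omega> - (space \<Omega> - K n)"
  proof (rule borel_cantelli_AE1)
    show "summable (\<lambda>n. \<Omega>.prob (space \<Omega> - K n))"
      by (rule summable_comparison_test'[OF summable_geometric, of "1/2" 0])
         (use K(3) in \<open>auto intro: less_imp_le\<close>)
  qed (use K(2) in \<open>auto simp: \<Omega>.emeasure_eq_measure\<close>)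
  then have "AE w in \<Omega>. \<forall>x\<in>X. \<forall>y. \<forall>\<epsilon>>0. \<exists>N \<delta>. 0 < \<delta> \<and>
      (\<forall>n\<ge>N. \<forall>x'\<in>X. dist x' x < \<delta> \<longrightarrow> \<bar>F n y x' w - dist_fun (h x w) y\<bar> < \<epsilon>)"
    using AE_space
  proof eventually_elim
    case (elim w)
    show ?case
    proof (intro ballI allI impI)
      fix x y and \<epsilon> :: real
      assume x: "x \<in> X" and \<epsilon>: "0 < \<epsilon>"
      have \<epsilon>2: "0 < \<epsilon>/2" using \<epsilon> by simp
      obtain M \<rho> where \<rho>: "0 < \<rho>" and near_h': "\<forall>y' x' v. dist y' y < \<rho> \<longrightarrow> x' \<in> X \<longrightarrow> dist x' x < \<rho> \<longrightarrow>
          v \<in> space \<Omega> \<longrightarrow> (\<forall>m<M. w \<in> B m \<longrightarrow> v \<in> B m) \<longrightarrow> \<bar>dist_fun (h x' v) y' - dist_fun (h x w) y\<bar> < \<epsilon>/2"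
        using cont[OF x elim(2) \<epsilon>2, of y] by (elim exE conjE)
      have near_h: "\<bar>dist_fun (h x' v) y' - dist_fun (h x w) y\<bar> < \<epsilon>/2"
        if "dist y' y < \<rho>" "x' \<in> X" "dist x' x < \<rho>" "v \<in> space \<Omega>" "\<And>m. m < M \<Longrightarrow> w \<in> B m \<Longrightarrow> v \<in> B m" for y' x' v
        using near_h'[rule_format, OF that(1-4)] that(5) by simp
      have lim: "(\<lambda>n. c * (1 / real (Suc n))) \<longlonglongrightarrow> c * 0" for c
        by (intro tendsto_mult tendsto_const LIMSEQ_Suc[OF lim_1_over_n])
      have sm: "\<forall>\<^sub>F n in sequentially. c * (1 / real (Suc n)) < r" if "0 < r" for c r
        using order_tendstoD(2)[OF lim[of c]] that by simp
      \<comment> \<open>\<open>norm x + 1\<close> leaves room for \<open>x'\<close> within distance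
        1 of \<open>x\<close>. The distances from \<open>x\<close> to \<open>x'\<close> and from
        \<open>x'\<close> to the center are below \<rho>/2 each. The factor \<open>CARD('k)\<close>
        bounds the norm of the shift in \<open>y\<close>, and the last condition absorbs the mixture
        and softmax errors.\<close>
      have "\<forall>\<^sub>F n in sequentially. w \<in> K n \<and> M \<le> n \<and> norm x + 1 \<le> real n \<and> 2 * (1 / real (Suc n)) < \<rho>/2 \<and>
          real CARD('k) * (1 / real (Suc n)) < \<rho> \<and> 2 * (1 / real (Suc n)) < \<epsilon>/2"
      proof (intro eventually_conj)
        show "\<forall>\<^sub>F n in sequentially. w \<in> K n" using elim(1) by (rule eventually_mono) auto
        show "\<forall>\<^sub>F n in sequentially. norm x + 1 \<le> real n"
          using eventually_ge_at_top[of "nat \<lceil>norm x + 1\<rceil>"] by eventually_elim linarith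
        show "\<forall>\<^sub>F n in sequentially. 2 * (1 / real (Suc n)) < \<rho>/2" using \<rho> by (intro sm) simp
        show "\<forall>\<^sub>F n in sequentially. real CARD('k) * (1 / real (Suc n)) < \<rho>" using \<rho> by (intro sm)
        show "\<forall>\<^sub>F n in sequentially. 2 * (1 / real (Suc n)) < \<epsilon>/2" using \<epsilon> by (intro sm) simp
      qed (rule eventually_ge_at_top)
      then obtain N where N: "\<And>n. N \<le> n \<Longrightarrow> w \<in> K n \<and> M \<le> n \<and> norm x + 1 \<le> real n \<and> 2 * (1 / real (Suc n)) < \<rho>/2 \<and>
          real CARD('k) * (1 / real (Suc n)) < \<rho> \<and> 2 * (1 / real (Suc n)) < \<epsilon>/2"
        unfolding eventually_sequentially by blast
      have "\<bar>F n y x' w - dist_fun (h x w) y\<bar> < \<epsilon>" if n: "N \<le> n" and x': "x' \<in> X" "dist x' x < min 1 (\<rho>/2)" for n x'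
      proof -
        have nx: "norm x' \<le> real n"
          using N[OF n] x'(2) norm_triangle_sub[of x' x] by (simp add: dist_norm)
        \<comment> \<open>The sign \<open>s\<close> treats the upward and the downward shift
          together.\<close>
        have *: "\<bar>dist_fun (h a v) (y + s *\<^sub>R vec (1 / Suc n)) - dist_fun (h x w) y\<bar> < \<epsilon>/2"
          if nr: "near n x' w a v" and s: "\<bar>s\<bar> = 1" for a v s
        proof (rule near_h)
          have "dist (y + s *\<^sub>R vec (1 / Suc n)) y = norm (vec (1 / Suc n) :: real ^ 'k)"
            using s by (simp add: dist_norm)
          also have "\<dots> \<le> real CARD('k) * (1 / Suc n)" by (rule norm_vec_le) simp
          finally show "dist (y + s *\<^sub>R vec (1 / Suc n)) y < \<rho>" using N[OF n] by linarith
          show "a \<in> X" "v \<in> space \<Omega>" using nr KO by (auto simp: near_def)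
          show "dist a x < \<rho>"
            using nr N[OF n] x'(2) dist_triangle[of a x x'] by (simp add: near_def dist_commute)
          fix m assume "m < M" "w \<in> B m"
          then show "v \<in> B m"
            using nr N[OF n] K\<delta>[of m n v w] by (simp add: near_def sqdist_commute)
        qed
        have "F n y x' w \<le> (dist_fun (h x w) y + \<epsilon>/2) + 2 * (1 / Suc n)"
        proof (rule F_up[OF x'(1) nx])
          show "w \<in> K n" using N[OF n] by blast
          show "dist_fun (h a v) (y + vec (1 / Suc n)) \<le> dist_fun (h x w) y + \<epsilon>/2" if "near n x' w a v" for a v
            using *[OF that, of 1] unfolding scaleR_one by (simp only: abs_less_iff) linarith
        qed
        moreover have "(dist_fun (h x w) y - \<epsilon>/2) - 2 * (1 / Suc n) \<le> F n y x' w"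
        proof (rule F_low[OF x'(1) nx])
          show "w \<in> K n" using N[OF n] by blast
          show "dist_fun (h x w) y - \<epsilon>/2 \<le> dist_fun (h a v) (y - vec (1 / Suc n))" if "near n x' w a v" for a v
            using *[OF that, of "-1"] unfolding scaleR_minus1_left diff_conv_add_uminus[symmetric]
            by (simp only: abs_less_iff) linarith
        qed
        ultimately show ?thesis using N[OF n] by (simp add: abs_less_iff)
      qed
      then show "\<exists>N \<delta>. 0 < \<delta> \<and> (\<forall>n\<ge>N. \<forall>x'\<in>X. dist x' x < \<delta> \<longrightarrow> \<bar>F n y x' w - dist_fun (h x w) y\<bar> < \<epsilon>)"
        using \<rho> by (intro exI[of _ N] exI[of _ "min 1 (\<rho>/2)"]) auto
    qed
  qed
  with F show ?thesis by (intro exI[of _ F] conjI allI)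
qed


section \<open>Polya's theorem on Euclidean space\<close>

text \<open>The property of distribution functions on \<open>\<real>\<^sup>K\<close> that is used in Polya's theorem. It is
  preserved by convex combinations, and \<open>cdf_tail F M\<close> bounds the mass outside a cube.\<close>

definition clamp_cube :: "real \<Rightarrow> real ^ 'k \<Rightarrow> real ^ 'k" where
  "clamp_cube M y = (\<chi> i. max (- M) (min M (y $ i)))"

text \<open>The orthant below this corner consists of the points with coordinate \<open>k\<close> at
  most \<open>- M\<close> and the others at most \<open>M\<close>. These orthants and the complement
  of \<open>{..vec M}\<close> cover everything outside the cube, so a union bound in terms of
  distribution function values is possible.\<close>

definition lower_corner :: "real \<Rightarrow> 'k \<Rightarrow> real ^ 'k" where
  "lower_corner M k = (\<chi> i. if i = k then - M else M)"

definition cdf_tail :: "(real ^ 'k \<Rightarrow> real) \<Rightarrow> real \<Rightarrow> real" where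
  "cdf_tail F M = 1 - F (vec M) + (\<Sum>k\<in>UNIV. F (lower_corner M k))"

definition cdf_like :: "(real ^ 'k \<Rightarrow> real) \<Rightarrow> bool" where
  "cdf_like F \<longleftrightarrow> mono F \<and> (\<forall>M y. \<bar>F y - F (clamp_cube M y)\<bar> \<le> cdf_tail F M)"

text \<open>For \<open>z\<close> in the cube, \<open>z \<le> y\<close> and
  \<open>z \<le> clamp_cube M y\<close> are equivalent. The two orthants therefore differ only
  inside the exceptional set \<open>C\<close>, whose mass is at most the tail.\<close>

lemma cdf_like_dist_fun:
  fixes \<mu> :: "(real ^ 'k) measure"
  assumes "prob_space \<mu>" "sets \<mu> = sets borel"
  shows "cdf_like (dist_fun \<mu>)"
proof -
  interpret prob_space \<mu> by fact
  have [simp]: "space \<mu> = UNIV" using sets_eq_imp_space_eq[OF assms(2)] by simp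
  have S: "{..y} \<in> events" for y using assms(2) by simp
  have "mono (dist_fun \<mu>)"
    unfolding dist_fun_def by (intro monoI finite_measure_mono S) auto
  moreover have "\<bar>dist_fun \<mu> y - dist_fun \<mu> (clamp_cube M y)\<bar> \<le> cdf_tail (dist_fun \<mu>) M" for M y
  proof -
    define C where "C = (UNIV - {..vec M}) \<union> (\<Union>k::'k. {..lower_corner M k})"
    have C: "C \<in> events" unfolding C_def using assms(2) by auto
    have C_le: "prob C \<le> cdf_tail (dist_fun \<mu>) M"
    proof -
      have "prob C \<le> prob (UNIV - {..vec M}) + prob (\<Union>k::'k. {..lower_corner M k})"
        unfolding C_def by (intro measure_Un_le) (auto simp: assms(2))
      also have "prob (UNIV - {..vec M}) = 1 - prob {..vec M}" using prob_compl[OF S] by simp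
      also have "prob (\<Union>k::'k. {..lower_corner M k}) \<le> (\<Sum>k\<in>UNIV. prob {..lower_corner M k})"
        by (intro measure_UNION_le) (auto simp: assms(2))
      finally show ?thesis by (simp add: cdf_tail_def dist_fun_def)
    qed
    have key: "z \<le> y \<longleftrightarrow> z \<le> clamp_cube M y" if "z \<notin> C" for z
    proof -
      have up: "z $ i \<le> M" for i using that by (auto simp: C_def less_eq_vec_def)
      have lo: "- M < z $ i" for i
      proof (rule ccontr)
        assume "\<not> - M < z $ i"
        then have "z \<le> lower_corner M i" using up by (auto simp: less_eq_vec_def lower_corner_def)
        then show False using that by (auto simp: C_def)
      qed
      have "z $ i \<le> y $ i \<longleftrightarrow> z $ i \<le> max (- M) (min M (y $ i))" for i using up[of i] lo[of i] by auto
      then show ?thesis by (simp add: less_eq_vec_def clamp_cube_def)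
    qed
    have "prob {..y} \<le> prob ({..clamp_cube M y} \<union> C)"
      using S C key by (intro finite_measure_mono) auto
    also have "\<dots> \<le> prob {..clamp_cube M y} + prob C" by (rule measure_Un_le[OF S C])
    finally have 1: "prob {..y} \<le> prob {..clamp_cube M y} + prob C" .
    have "prob {..clamp_cube M y} \<le> prob ({..y} \<union> C)"
      using S C key by (intro finite_measure_mono) auto
    also have "\<dots> \<le> prob {..y} + prob C" by (rule measure_Un_le[OF S C])
    finally have 2: "prob {..clamp_cube M y} \<le> prob {..y} + prob C" .
    show ?thesis using 1 2 C_le unfolding dist_fun_def by linarith
  qed
  ultimately show ?thesis by (simp add: cdf_like_def)
qed

lemma cdf_like_convex_sum:
  fixes F :: "'c \<Rightarrow> real ^ 'k \<Rightarrow> real"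
  assumes "\<And>j. j \<in> J \<Longrightarrow> 0 \<le> c j" "(\<Sum>j\<in>J. c j) = 1" "\<And>j. j \<in> J \<Longrightarrow> cdf_like (F j)"
  shows "cdf_like (\<lambda>y. \<Sum>j\<in>J. c j * F j y)"
proof -
  have "mono (\<lambda>y. \<Sum>j\<in>J. c j * F j y)"
    using assms by (intro monoI sum_mono mult_left_mono) (auto simp: cdf_like_def dest: monoD)
  moreover have "\<bar>(\<Sum>j\<in>J. c j * F j y) - (\<Sum>j\<in>J. c j * F j (clamp_cube M y))\<bar>
      \<le> cdf_tail (\<lambda>y. \<Sum>j\<in>J. c j * F j y) M" for M y
  proof -
    have "\<bar>(\<Sum>j\<in>J. c j * F j y) - (\<Sum>j\<in>J. c j * F j (clamp_cube M y))\<bar>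
        = \<bar>\<Sum>j\<in>J. c j * (F j y - F j (clamp_cube M y))\<bar>"
      by (simp add: sum_subtractf right_diff_distrib)
    also have "\<dots> \<le> (\<Sum>j\<in>J. \<bar>c j * (F j y - F j (clamp_cube M y))\<bar>)" by (rule sum_abs)
    also have "\<dots> \<le> (\<Sum>j\<in>J. c j * cdf_tail (F j) M)"
      using assms by (intro sum_mono) (auto simp: cdf_like_def abs_mult intro: mult_left_mono)
    also have "\<dots> = cdf_tail (\<lambda>y. \<Sum>j\<in>J. c j * F j y) M"
      unfolding cdf_tail_def using assms(2)
      by (simp add: distrib_left right_diff_distrib sum.distrib sum_subtractf sum_distrib_left sum.swap[of _ J])
    finally show ?thesis .
  qed
  ultimately show ?thesis by (simp add: cdf_like_def)
qed

lemma cdf_tail_tendsto_0: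
  fixes \<mu> :: "(real ^ 'k) measure"
  assumes "prob_space \<mu>" "sets \<mu> = sets borel"
  shows "(\<lambda>n. cdf_tail (dist_fun \<mu>) (real n)) \<longlonglongrightarrow> 0"
proof -
  interpret prob_space \<mu> by fact
  have [simp]: "space \<mu> = UNIV" using sets_eq_imp_space_eq[OF assms(2)] by simp
  have "(\<lambda>n. prob {..vec (real n)}) \<longlonglongrightarrow> prob (\<Union>n. {..vec (real n)})"
    by (intro finite_Lim_measure_incseq) (auto simp: assms(2) incseq_def less_eq_vec_def intro: order_trans)
  also have "(\<Union>n. {..vec (real n)}) = (UNIV :: (real ^ 'k) set)"
  proof -
    have "\<exists>n. z \<le> vec (real n)" for z :: "real ^ 'k"
    proof -
      obtain n where "norm z \<le> real n" using real_arch_simple by blast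
      then have "z $ i \<le> real n" for i
        using component_le_norm_cart[of z i] by linarith
      then show ?thesis by (intro exI[of _ n]) (simp add: less_eq_vec_def)
    qed
    then show ?thesis by auto
  qed
  finally have 1: "(\<lambda>n. dist_fun \<mu> (vec (real n))) \<longlonglongrightarrow> 1"
    using prob_space by (simp add: dist_fun_def)
  \<comment> \<open>The orthants need not be monotone in \<open>n\<close>, so they are enclosed in
    half-spaces, which decrease to the empty set.\<close>
  have 2: "(\<lambda>n. dist_fun \<mu> (lower_corner (real n) k)) \<longlonglongrightarrow> 0" for k
  proof (rule real_tendsto_sandwich[where f = "\<lambda>_. 0" and h = "\<lambda>n. prob {z. z $ k \<le> - real n}"])
    have m: "{z. z $ k \<le> - real n} \<in> events" for n
      unfolding assms(2) by (intro borel_closed closed_Collect_le continuous_intros)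
    have "(\<lambda>n. prob {z. z $ k \<le> - real n}) \<longlonglongrightarrow> prob (\<Inter>n. {z. z $ k \<le> - real n})"
      using m by (intro finite_Lim_measure_decseq) (auto simp: decseq_def intro: order_trans)
    also have "(\<Inter>n. {z. z $ k \<le> - real n}) = {}"
    proof -
      have "\<exists>n. \<not> z $ k \<le> - real n" for z :: "real ^ 'k"
      proof -
        obtain n where "- (z $ k) < real n" using reals_Archimedean2 by blast
        then have "\<not> z $ k \<le> - real n" by linarith
        then show ?thesis by blast
      qed
      then show ?thesis by auto
    qed
    finally show "(\<lambda>n. prob {z. z $ k \<le> - real n}) \<longlonglongrightarrow> 0" by simp
    show "\<forall>\<^sub>F n in sequentially. dist_fun \<mu> (lower_corner (real n) k) \<le> prob {z. z $ k \<le> - real n}"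
    proof (intro always_eventually allI)
      fix n
      have "{..lower_corner (real n) k} \<subseteq> {z. z $ k \<le> - real n}"
      proof
        fix z assume "z \<in> {..lower_corner (real n) k}"
        then have "z $ k \<le> lower_corner (real n) k $ k" by (simp only: atMost_iff less_eq_vec_def)
        then show "z \<in> {z. z $ k \<le> - real n}" by (simp add: lower_corner_def)
      qed
      then show "dist_fun \<mu> (lower_corner (real n) k) \<le> prob {z. z $ k \<le> - real n}"
        unfolding dist_fun_def by (rule finite_measure_mono[OF _ m])
    qed
  qed (auto simp: dist_fun_def)
  have "(\<lambda>n. 1 - dist_fun \<mu> (vec (real n)) + (\<Sum>k\<in>UNIV. dist_fun \<mu> (lower_corner (real n) k)))
      \<longlonglongrightarrow> 1 - 1 + (\<Sum>k\<in>(UNIV::'k set). 0)"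
    by (intro tendsto_intros 1 2)
  then show ?thesis by (simp add: cdf_tail_def)
qed

text \<open>On a cube, finitely many boxes on which the continuous limit varies little suffice: by
  monotonicity the values at the two extreme corners of a box control all values inside. Clamping
  extends the bound from the cube to the whole space.\<close>

lemma polya_uniform_limit:
  fixes G :: "nat \<Rightarrow> real ^ 'k \<Rightarrow> real"
  assumes G: "\<And>n. cdf_like (G n)" and \<mu>: "prob_space \<mu>" "sets \<mu> = sets borel"
    and cont: "continuous_on UNIV (dist_fun \<mu>)" and lim: "\<And>y. (\<lambda>n. G n y) \<longlonglongrightarrow> dist_fun \<mu> y"
  shows "uniform_limit UNIV G (dist_fun \<mu>) sequentially"
proof (rule uniform_limitI)
  fix \<epsilon> :: real assume "0 < \<epsilon>"
  \<comment> \<open>Five errors of size at most \<open>e\<close> occur: clamping of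
    \<open>G n\<close> and of the limit, convergence at a corner, and the variation of the limit
    from a box center to either corner.\<close>
  define e where "e = \<epsilon> / 6"
  have e: "0 < e" using \<open>0 < \<epsilon>\<close> by (simp add: e_def)
  let ?H = "dist_fun \<mu>"
  have H: "cdf_like ?H" by (rule cdf_like_dist_fun[OF \<mu>])
  have monoG: "G n y \<le> G n y'" if "y \<le> y'" for n y y' using G[of n] that by (auto simp: cdf_like_def dest: monoD)
  have monoH: "?H y \<le> ?H y'" if "y \<le> y'" for y y' using H that by (auto simp: cdf_like_def dest: monoD)
  have "\<forall>\<^sub>F n in sequentially. cdf_tail ?H (real n) < e"
    using order_tendstoD(2)[OF cdf_tail_tendsto_0[OF \<mu>] e] .
  then obtain n0 where n0: "cdf_tail ?H (real n0) < e" by (auto simp: eventually_sequentially)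
  define M where "M = real n0"
  \<comment> \<open>A tail involves finitely many values of the function, so pointwise convergence
    alone gives a uniform bound on the mass that \<open>G n\<close> has outside the cube.\<close>
  have "(\<lambda>n. cdf_tail (G n) M) \<longlonglongrightarrow> cdf_tail ?H M"
    unfolding cdf_tail_def by (intro tendsto_intros lim)
  then have tail: "\<forall>\<^sub>F n in sequentially. cdf_tail (G n) M < e"
    using n0 unfolding M_def by (rule order_tendstoD(2))
  let ?Q = "cbox (- vec M) (vec M) :: (real ^ 'k) set"
  have "\<exists>d>0. ?H (y + vec d) < ?H y + e \<and> ?H y - e < ?H (y - vec d)" for y
  proof -
    have c: "((\<lambda>d. ?H (y + f d)) \<longlongrightarrow> ?H y) (at_right 0)" if f: "(f \<longlongrightarrow> 0) (at_right (0::real))" for f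
    proof -
      have "isCont ?H y" using cont by (simp add: continuous_on_eq_continuous_at)
      moreover have "((\<lambda>d. y + f d) \<longlongrightarrow> y) (at_right 0)"
        using tendsto_add[OF tendsto_const f, of y] by simp
      ultimately show ?thesis by (rule isCont_tendsto_compose)
    qed
    have v: "((\<lambda>d. vec d :: real ^ 'k) \<longlongrightarrow> 0) (at_right 0)"
      by (rule vec_tendstoI) simp
    have v': "((\<lambda>d. - vec d :: real ^ 'k) \<longlongrightarrow> 0) (at_right 0)"
      using tendsto_minus[OF v] by simp
    have "\<forall>\<^sub>F d in at_right 0. ?H (y + vec d) < ?H y + e \<and> ?H y - e < ?H (y - vec d) \<and> 0 < d"
      using order_tendstoD(2)[OF c[OF v], of "?H y + e"] order_tendstoD(1)[OF c[OF v'], of "?H y - e"] e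
        eventually_at_right_less[of "0::real"]
      by (simp add: eventually_conj)
    then have "\<exists>d. ?H (y + vec d) < ?H y + e \<and> ?H y - e < ?H (y - vec d) \<and> 0 < d"
      by (rule eventually_happens'[OF trivial_limit_at_right_real])
    then show ?thesis by blast
  qed
  then obtain d where d: "\<And>y. 0 < d y" "\<And>y. ?H (y + vec (d y)) < ?H y + e" "\<And>y. ?H y - e < ?H (y - vec (d y))"
    by metis
  have op: "open (box (y - vec (d y)) (y + vec (d y)))" for y by (rule open_box)
  have cov: "?Q \<subseteq> (\<Union>y\<in>?Q. box (y - vec (d y)) (y + vec (d y)))"
  proof
    fix y assume "y \<in> ?Q"
    moreover have "y \<in> box (y - vec (d y)) (y + vec (d y))" using d(1)[of y] by (simp add: mem_box_cart)
    ultimately show "y \<in> (\<Union>y\<in>?Q. box (y - vec (d y)) (y + vec (d y)))" by (rule UN_I)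
  qed
  obtain S where "S \<subseteq> ?Q" and S: "finite S" "?Q \<subseteq> (\<Union>y\<in>S. box (y - vec (d y)) (y + vec (d y)))"
    by (rule compactE_image[OF compact_cbox op cov])
  have "\<forall>\<^sub>F n in sequentially. \<forall>y\<in>S. G n (y + vec (d y)) < ?H (y + vec (d y)) + e \<and>
      ?H (y - vec (d y)) - e < G n (y - vec (d y))"
  proof (intro eventually_ball_finite[OF S(1)] ballI eventually_conj)
    fix y
    show "\<forall>\<^sub>F n in sequentially. G n (y + vec (d y)) < ?H (y + vec (d y)) + e"
      using order_tendstoD(2)[OF lim] e by simp
    show "\<forall>\<^sub>F n in sequentially. ?H (y - vec (d y)) - e < G n (y - vec (d y))"
      using order_tendstoD(1)[OF lim] e by simp
  qed
  with tail show "\<forall>\<^sub>F n in sequentially. \<forall>y\<in>UNIV. dist (G n y) (?H y) < \<epsilon>"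
  proof eventually_elim
    case (elim n)
    show ?case
    proof
      fix y :: "real ^ 'k"
      define c where "c = clamp_cube M y"
      have "c \<in> ?Q" by (auto simp: c_def clamp_cube_def mem_box_cart M_def)
      then obtain s where s: "s \<in> S" "c \<in> box (s - vec (d s)) (s + vec (d s))" using S(2) by blast
      then have cs: "s - vec (d s) \<le> c" "c \<le> s + vec (d s)"
        by (auto simp: mem_box_cart less_eq_vec_def intro: less_imp_le)
      have b1: "G n c \<le> G n (s + vec (d s))" "?H (s - vec (d s)) \<le> ?H c"
        "G n (s - vec (d s)) \<le> G n c" "?H c \<le> ?H (s + vec (d s))"
        using monoG monoH cs by auto
      have b2: "G n (s + vec (d s)) < ?H (s + vec (d s)) + e" "?H (s - vec (d s)) - e < G n (s - vec (d s))"
        using elim(2) s(1) by auto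
      have t1: "\<bar>G n y - G n c\<bar> < e"
        using G[of n] elim(1) unfolding cdf_like_def c_def by (meson le_less_trans)
      have t2: "\<bar>?H y - ?H c\<bar> < e"
        using H n0 unfolding cdf_like_def c_def M_def by (meson le_less_trans)
      have "\<bar>G n y - ?H y\<bar> < 6 * e"
        using b1 b2 t1 t2 d(2)[of s] d(3)[of s] by linarith
      then show "dist (G n y) (?H y) < \<epsilon>" by (simp add: dist_real_def e_def)
    qed
  qed
qed


section \<open>Compact denseness\<close>

lemma gate_pos: "1 \<le> g \<Longrightarrow> 0 < gate L g \<alpha>\<^sub>0 \<alpha> \<beta> j x w"
  unfolding gate_def by (intro divide_pos_pos sum_pos) auto

lemma sum_gate: "1 \<le> g \<Longrightarrow> (\<Sum>j=1..g. gate L g \<alpha>\<^sub>0 \<alpha> \<beta> j x w) = 1"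
proof -
  assume g: "1 \<le> g"
  have "0 < (\<Sum>j=1..g. exp (\<alpha>\<^sub>0 j + \<alpha> j \<bullet> x + (\<Sum>l=1..L. \<beta> j l * w l)))"
    using g by (intro sum_pos) auto
  then show ?thesis unfolding gate_def sum_divide_distrib[symmetric] by simp
qed

lemma cdf_like_mmoe:
  assumes F: "F \<in> mmoe_dist_funs L F\<^sub>0 \<Psi>\<^sub>0"
    and F0: "\<And>\<psi>. \<psi> \<in> \<Psi>\<^sub>0 \<Longrightarrow> prob_space (F\<^sub>0 \<psi>) \<and> sets (F\<^sub>0 \<psi>) = sets borel"
  shows "cdf_like (\<lambda>y. F y x w)"
proof -
  obtain g \<alpha>\<^sub>0 \<alpha> \<beta> \<psi> where F_eq: "F = (\<lambda>y x w. \<Sum>j=1..g. gate L g \<alpha>\<^sub>0 \<alpha> \<beta> j x w * dist_fun (F\<^sub>0 (\<psi> j)) y)"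
    and g: "1 \<le> g" and \<psi>: "\<forall>j\<in>{1..g}. \<psi> j \<in> \<Psi>\<^sub>0"
    using F unfolding mmoe_dist_funs_def by blast
  show ?thesis
    unfolding F_eq using gate_pos[OF g, THEN less_imp_le] sum_gate[OF g] \<psi> F0
    by (intro cdf_like_convex_sum cdf_like_dist_fun) auto
qed

lemma mmoe_bounds:
  assumes F: "F \<in> mmoe_dist_funs L F\<^sub>0 \<Psi>\<^sub>0"
    and F0: "\<And>\<psi>. \<psi> \<in> \<Psi>\<^sub>0 \<Longrightarrow> prob_space (F\<^sub>0 \<psi>) \<and> sets (F\<^sub>0 \<psi>) = sets borel"
  shows "0 \<le> F y x w" "F y x w \<le> 1"
proof -
  obtain g \<alpha>\<^sub>0 \<alpha> \<beta> \<psi> where F_eq: "F = (\<lambda>y x w. \<Sum>j=1..g. gate L g \<alpha>\<^sub>0 \<alpha> \<beta> j x w * dist_fun (F\<^sub>0 (\<psi> j)) y)"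
    and g: "1 \<le> g" and \<psi>: "\<forall>j\<in>{1..g}. \<psi> j \<in> \<Psi>\<^sub>0"
    using F unfolding mmoe_dist_funs_def by blast
  have a01: "0 \<le> dist_fun (F\<^sub>0 (\<psi> j)) y" "dist_fun (F\<^sub>0 (\<psi> j)) y \<le> 1" if "j \<in> {1..g}" for j
    using F0[of "\<psi> j"] \<psi> that by (auto simp: dist_fun_def intro!: prob_space.prob_le_1)
  show "0 \<le> F y x w"
    unfolding F_eq using gate_pos[OF g, THEN less_imp_le] a01 by (intro sum_nonneg mult_nonneg_nonneg) auto
  have "F y x w \<le> (\<Sum>j=1..g. gate L g \<alpha>\<^sub>0 \<alpha> \<beta> j x w * 1)"
    unfolding F_eq using gate_pos[OF g, THEN less_imp_le] a01 by (intro sum_mono mult_left_mono) auto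
  then show "F y x w \<le> 1" using sum_gate[OF g, of L \<alpha>\<^sub>0 \<alpha> \<beta> x w] by simp
qed

lemma measurable_mmoe:
  assumes F: "F \<in> mmoe_dist_funs L F\<^sub>0 \<Psi>\<^sub>0"
    and w: "\<And>l. l \<in> {1..L} \<Longrightarrow> (\<lambda>v. w v l) \<in> borel_measurable M"
  shows "(\<lambda>v. F y x (w v)) \<in> borel_measurable M"
proof -
  obtain g \<alpha>\<^sub>0 \<alpha> \<beta> \<psi> where F_eq: "F = (\<lambda>y x w. \<Sum>j=1..g. gate L g \<alpha>\<^sub>0 \<alpha> \<beta> j x w * dist_fun (F\<^sub>0 (\<psi> j)) y)"
    using F unfolding mmoe_dist_funs_def by blast
  have e: "(\<lambda>v. exp (\<alpha>\<^sub>0 j + \<alpha> j \<bullet> x + (\<Sum>l=1..L. \<beta> j l * w v l))) \<in> borel_measurable M" for j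
    by (intro measurable_compose[OF _ borel_measurable_exp] borel_measurable_sum borel_measurable_times
          borel_measurable_add borel_measurable_const w)
  show ?thesis
    unfolding F_eq gate_def
    by (intro borel_measurable_sum borel_measurable_times borel_measurable_divide borel_measurable_const e)
qed

text \<open>The approximation is pointwise in the random effects and only locally uniform in \<open>x\<close>; after
  integration over the random effects it is uniform in \<open>y\<close> and in \<open>x\<close> on compact sets.\<close>

proposition mmoe_integrated_approximation:
  fixes F\<^sub>0 :: "'s \<Rightarrow> (real ^ 'k) measure" and X :: "(real ^ 'p) set"
    and h :: "real ^ 'p \<Rightarrow> (nat \<Rightarrow> real) \<Rightarrow> (real ^ 'k) measure"
    and \<Phi> :: "nat \<Rightarrow> real measure" and L :: nat
  defines "\<Omega> \<equiv> PiM {1..L} \<Phi>"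
  assumes F0: "\<And>\<psi>. \<psi> \<in> \<Psi>\<^sub>0 \<Longrightarrow> prob_space (F\<^sub>0 \<psi>) \<and> sets (F\<^sub>0 \<psi>) = sets borel"
    and \<Phi>: "\<And>l. real_distribution (\<Phi> l)"
    and h: "\<And>x w. x \<in> X \<Longrightarrow> w \<in> space \<Omega> \<Longrightarrow> prob_space (h x w) \<and> sets (h x w) = sets borel"
    and h_meas: "\<And>x y. x \<in> X \<Longrightarrow> (\<lambda>w. dist_fun (h x w) y) \<in> borel_measurable \<Omega>"
    and h_cont: "\<And>x w. x \<in> X \<Longrightarrow> w \<in> space \<Omega> \<Longrightarrow> continuous_on UNIV (dist_fun (h x w))"
    and h_cont_x: "\<And>x w y \<xi>. w \<in> space \<Omega> \<Longrightarrow> (\<And>i. \<xi> i \<in> X) \<Longrightarrow> x \<in> X \<Longrightarrow> \<xi> \<longlonglongrightarrow> x \<Longrightarrow>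
      (\<lambda>i. dist_fun (h (\<xi> i) w) y) \<longlonglongrightarrow> dist_fun (h x w) y"
    and F: "\<And>n::nat. F n \<in> mmoe_dist_funs L F\<^sub>0 \<Psi>\<^sub>0"
    and approx: "AE w in \<Omega>. \<forall>x\<in>X. \<forall>y. \<forall>\<epsilon>>0. \<exists>N \<delta>. 0 < \<delta> \<and>
      (\<forall>n\<ge>N. \<forall>x'\<in>X. dist x' x < \<delta> \<longrightarrow> \<bar>F n y x' w - dist_fun (h x w) y\<bar> < \<epsilon>)"
    and X': "compact X'" "X' \<subseteq> X" and \<epsilon>: "0 < \<epsilon>"
  shows "\<exists>N. \<forall>n\<ge>N. \<forall>y. \<forall>x\<in>X'. (\<integral>w. \<bar>F n y x w - dist_fun (h x w) y\<bar> \<partial>\<Omega>) < \<epsilon>"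
proof (rule ccontr)
  interpret \<Phi>: real_distribution "\<Phi> l" for l by (rule \<Phi>)
  interpret \<Omega>: prob_space \<Omega> unfolding \<Omega>_def by (rule prob_space_PiM) (rule \<Phi>.prob_space_axioms)
  \<comment> \<open>Failure supplies indices tending to infinity with points \<open>y\<close> and
    \<open>x\<close>. Compactness makes \<open>x\<close> converge along a subsequence, while
    \<open>y\<close> stays arbitrary and is handled by Polya's theorem. Arguing along a sequence
    keeps suprema over \<open>(y, x)\<close>, and the question of their measurability, out of the
    integral.\<close>
  define bad where "bad N q \<longleftrightarrow> (case q of (n, y, x) \<Rightarrow> N \<le> n \<and> x \<in> X' \<and>
      \<epsilon> \<le> (\<integral>w. \<bar>F n y x w - dist_fun (h x w) y\<bar> \<partial>\<Omega>))" for N :: nat and q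
  assume *: "\<not> ?thesis"
  have "\<exists>q. bad N q" for N
  proof -
    obtain n y x where "N \<le> n" "x \<in> X'" "\<epsilon> \<le> (\<integral>w. \<bar>F n y x w - dist_fun (h x w) y\<bar> \<partial>\<Omega>)"
      using * by (meson not_le)
    then have "bad N (n, y, x)" by (simp add: bad_def)
    then show ?thesis by blast
  qed
  then have q: "bad N (SOME q. bad N q)" for N by (rule someI_ex)
  define q where "q N = (SOME q. bad N q)" for N
  define r where "r N = fst (q N)" for N
  define \<eta> where "\<eta> N = fst (snd (q N))" for N
  define \<xi> where "\<xi> N = snd (snd (q N))" for N
  have r: "N \<le> r N" and \<xi>: "\<xi> N \<in> X'"
    and big: "\<epsilon> \<le> (\<integral>w. \<bar>F (r N) (\<eta> N) (\<xi> N) w - dist_fun (h (\<xi> N) w) (\<eta> N)\<bar> \<partial>\<Omega>)" for N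
    using q[of N] unfolding bad_def r_def \<eta>_def \<xi>_def q_def case_prod_beta by auto
  obtain x \<sigma> where x: "x \<in> X'" and \<sigma>: "strict_mono (\<sigma> :: nat \<Rightarrow> nat)" and lim: "(\<xi> \<circ> \<sigma>) \<longlonglongrightarrow> x"
    using X'(1) \<xi> unfolding compact_eq_seq_compact_metric seq_compact_def by metis
  have xX: "x \<in> X" "\<And>N. \<xi> N \<in> X" using x \<xi> X'(2) by auto
  have F01: "0 \<le> F n y x w" "F n y x w \<le> 1" for n y x w using mmoe_bounds[OF F F0] by auto
  have h01: "0 \<le> dist_fun (h x w) y \<and> dist_fun (h x w) y \<le> 1" if "x \<in> X" "w \<in> space \<Omega>" for x w y
    using h[OF that] by (auto simp: dist_fun_def intro!: prob_space.prob_le_1)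
  have F_meas: "(\<lambda>w. F n y x w) \<in> borel_measurable \<Omega>" for n y x
  proof (rule measurable_mmoe[OF F])
    fix l assume "l \<in> {1..L}"
    then have "(\<lambda>w. w l) \<in> \<Omega> \<rightarrow>\<^sub>M \<Phi> l" unfolding \<Omega>_def by (rule measurable_component_singleton)
    then show "(\<lambda>w. w l) \<in> borel_measurable \<Omega>"
      using measurable_cong_sets[OF refl \<Phi>.events_eq_borel] by blast
  qed
  define D where "D i w = \<bar>F (r (\<sigma> i)) (\<eta> (\<sigma> i)) (\<xi> (\<sigma> i)) w - dist_fun (h (\<xi> (\<sigma> i)) w) (\<eta> (\<sigma> i))\<bar>" for i w
  have D_meas: "D i \<in> borel_measurable \<Omega>" for i
    unfolding D_def[abs_def] by (intro borel_measurable_abs borel_measurable_diff F_meas h_meas xX)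
  have "AE w in \<Omega>. (\<lambda>i. D i w) \<longlonglongrightarrow> 0"
    using approx AE_space
  proof eventually_elim
    case (elim w)
    let ?H = "dist_fun (h x w)"
    have hx: "prob_space (h x w)" "sets (h x w) = sets borel" using h[OF xX(1) elim(2)] by auto
    have "uniform_limit UNIV (\<lambda>i y. F (r (\<sigma> i)) y (\<xi> (\<sigma> i)) w) ?H sequentially"
    proof (rule polya_uniform_limit[OF _ hx h_cont[OF xX(1) elim(2)]])
      show "cdf_like (\<lambda>y. F (r (\<sigma> i)) y (\<xi> (\<sigma> i)) w)" for i by (rule cdf_like_mmoe[OF F F0])
      show "(\<lambda>i. F (r (\<sigma> i)) y (\<xi> (\<sigma> i)) w) \<longlonglongrightarrow> ?H y" for y
      proof (rule LIMSEQ_I)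
        fix e :: real assume e: "0 < e"
        obtain N \<delta> where \<delta>: "0 < \<delta>"
          and N: "\<forall>n\<ge>N. \<forall>x'\<in>X. dist x' x < \<delta> \<longrightarrow> \<bar>F n y x' w - ?H y\<bar> < e"
          using elim(1)[rule_format, OF xX(1) e, of y] by (elim exE conjE)
        obtain N' where N': "\<And>i. N' \<le> i \<Longrightarrow> dist (\<xi> (\<sigma> i)) x < \<delta>"
          using metric_LIMSEQ_D[OF lim \<delta>] by auto
        have "norm (F (r (\<sigma> i)) y (\<xi> (\<sigma> i)) w - ?H y) < e" if "max N N' \<le> i" for i
        proof -
          have "N \<le> r (\<sigma> i)" using that r[of "\<sigma> i"] seq_suble[OF \<sigma>, of i] by linarith
          then show ?thesis using N xX(2) N'[of i] that by simp
        qed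
        then show "\<exists>no. \<forall>i\<ge>no. norm (F (r (\<sigma> i)) y (\<xi> (\<sigma> i)) w - ?H y) < e" by blast
      qed
    qed
    \<comment> \<open>The covariate moves too, so both functions at
      \<open>\<xi> (\<sigma> i)\<close> are compared with \<open>h\<close> at the limit
      \<open>x\<close>. Uniformity in \<open>y\<close> then allows evaluation at the moving point
      \<open>\<eta> (\<sigma> i)\<close>.\<close>
    moreover have "uniform_limit UNIV (\<lambda>i y. dist_fun (h (\<xi> (\<sigma> i)) w) y) ?H sequentially"
    proof (rule polya_uniform_limit[OF _ hx h_cont[OF xX(1) elim(2)]])
      show "cdf_like (\<lambda>y. dist_fun (h (\<xi> (\<sigma> i)) w) y)" for i
        using cdf_like_dist_fun h[OF xX(2) elim(2)] by blast
      show "(\<lambda>i. dist_fun (h (\<xi> (\<sigma> i)) w) y) \<longlonglongrightarrow> ?H y" for y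
        by (rule h_cont_x[OF elim(2) xX(2) xX(1)]) (use lim in \<open>simp add: comp_def\<close>)
    qed
    ultimately have U: "uniform_limit UNIV
        (\<lambda>i y. F (r (\<sigma> i)) y (\<xi> (\<sigma> i)) w - dist_fun (h (\<xi> (\<sigma> i)) w) y) (\<lambda>y. ?H y - ?H y) sequentially"
      by (rule uniform_limit_minus)
    show "(\<lambda>i. D i w) \<longlonglongrightarrow> 0"
    proof (rule tendstoI)
      fix e :: real assume "0 < e"
      from uniform_limitD[OF U this]
      show "\<forall>\<^sub>F i in sequentially. dist (D i w) 0 < e"
        by eventually_elim (simp add: D_def dist_real_def)
    qed
  qed
  then have "(\<lambda>i. \<integral>w. D i w \<partial>\<Omega>) \<longlonglongrightarrow> (\<integral>w. 0 \<partial>\<Omega>)"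
  proof (rule integral_dominated_convergence[where w = "\<lambda>_. 1", rotated 3])
    show "AE w in \<Omega>. norm (D i w) \<le> 1" for i
      using AE_space
    proof eventually_elim
      case (elim w)
      show ?case
        using h01[OF xX(2) elim, of "\<sigma> i" "\<eta> (\<sigma> i)"] F01[of "r (\<sigma> i)" "\<eta> (\<sigma> i)" "\<xi> (\<sigma> i)" w]
        by (simp add: D_def abs_le_iff)
    qed
  qed (use D_meas in auto)
  then have "\<forall>\<^sub>F i in sequentially. (\<integral>w. D i w \<partial>\<Omega>) < \<epsilon>"
    using \<epsilon> by (intro order_tendstoD(2)) auto
  then obtain i where "(\<integral>w. D i w \<partial>\<Omega>) < \<epsilon>" by (auto simp: eventually_sequentially)
  then show False using big[of "\<sigma> i"] unfolding D_def by simp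
qed

section \<open>From one observation to joint distribution functions\<close>

lemma continuous_map_dist_fun_factors:
  assumes par: "gen_params L X \<Theta> G H" and x: "x \<in> X"
  shows "continuous_map (product_topology (\<lambda>l. mtopology_of (\<Theta> l)) {1..L}) euclideanreal (\<lambda>\<theta>. dist_fun (H x \<theta>) y)"
proof -
  let ?P = "product_topology (\<lambda>l. mtopology_of (\<Theta> l)) {1..L}"
  have "continuous_map ?P (prod_topology euclidean (prod_topology (top_of_set X) ?P)) (\<lambda>\<theta>. (y, x, \<theta>))"
    using x by (intro continuous_map_pairedI continuous_map_id[unfolded id_def]) (auto simp: continuous_map_const)
  moreover have "continuous_map (prod_topology euclidean (prod_topology (top_of_set X) ?P)) euclideanreal
      (\<lambda>(y, x, \<theta>). dist_fun (H x \<theta>) y)"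
    using par unfolding gen_params_def by blast
  ultimately have "continuous_map ?P euclideanreal ((\<lambda>(y, x, \<theta>). dist_fun (H x \<theta>) y) \<circ> (\<lambda>\<theta>. (y, x, \<theta>)))"
    by (rule continuous_map_compose)
  then show ?thesis by (simp add: comp_def)
qed

text \<open>\<open>F\<close> is fixed before \<open>N\<close> and \<open>X'\<close>, since its
  choice involves only the law of one branch. For a given design the error is bounded by a sum over
  observations, and each summand is an integral under that law.\<close>

lemma mmoe_approximates_gen_joint:
  fixes F\<^sub>0 :: "'s \<Rightarrow> (real ^ 'k) measure" and X :: "(real ^ 'p) set" and \<Theta> :: "nat \<Rightarrow> 'a metric"
  assumes F0: "\<And>\<psi>. \<psi> \<in> \<Psi>\<^sub>0 \<Longrightarrow> prob_space (F\<^sub>0 \<psi>) \<and> sets (F\<^sub>0 \<psi>) = sets borel"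
    and dense: "\<And>q. \<exists>\<psi> :: nat \<Rightarrow> 's. (\<forall>n. \<psi> n \<in> \<Psi>\<^sub>0) \<and>
               converges_weakly (\<lambda>n. F\<^sub>0 (\<psi> n)) (return borel q)"
    and \<Phi>: "\<And>l. real_distribution (\<Phi> l)"
    and \<Phi>_cont: "\<And>l. l \<in> {1..L} \<Longrightarrow> continuous_on UNIV (cdf (\<Phi> l))"
    and par: "gen_params L X \<Theta> G H"
  shows "\<exists>F. (\<forall>n::nat. F n \<in> mmoe_dist_funs L F\<^sub>0 \<Psi>\<^sub>0) \<and>
    (\<forall>N X'. compact X' \<and> X' \<subseteq> X \<longrightarrow>
       uniform_limit {(y, x). \<forall>i\<in>observations N L. x i \<in> X'}
         (\<lambda>n (y, x). mmoe_joint L \<Phi> (F n) N y x) (\<lambda>(y, x). gen_joint L \<Theta> G H N y x) sequentially)"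
proof -
  note [simp del] = units.simps
  interpret \<Phi>: real_distribution "\<Phi> l" for l by (rule \<Phi>)
  let ?mb = "\<lambda>l. metric_borel (\<Theta> l)"
  let ?E = "\<Pi>\<^sub>E l\<in>{1..L}. mspace (\<Theta> l)"
  have polish: "mcomplete_of (\<Theta> l)" "separable_space (mtopology_of (\<Theta> l))"
    and G: "G l \<in> (\<Pi>\<^sub>M m\<in>{1..<l}. ?mb m) \<rightarrow>\<^sub>M prob_algebra (?mb l)" if "l \<in> {1..L}" for l
    using par that unfolding gen_params_def by blast+
  have H: "prob_space (H x \<theta>) \<and> sets (H x \<theta>) = sets borel" if "x \<in> X" "\<theta> \<in> ?E" for x \<theta>
    using par that unfolding gen_params_def by blast
  have H_cont: "continuous_map (prod_topology euclidean
         (prod_topology (top_of_set X) (product_topology (\<lambda>l. mtopology_of (\<Theta> l)) {1..L})))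
       euclideanreal (\<lambda>(y, x, \<theta>). dist_fun (H x \<theta>) y)"
    using par unfolding gen_params_def by blast
  define rand where "rand l \<tau> \<longleftrightarrow>
      (\<lambda>(a, w). \<tau> a w) \<in> (\<Pi>\<^sub>M m\<in>{1..<l}. ?mb m) \<Otimes>\<^sub>M borel \<rightarrow>\<^sub>M ?mb l \<and>
      (\<forall>a\<in>space (\<Pi>\<^sub>M m\<in>{1..<l}. ?mb m). distr (\<Phi> l) (?mb l) (\<tau> a) = G l a)" for l \<tau>
  define \<tau> where "\<tau> l = (SOME \<tau>. rand l \<tau>)" for l
  have rand: "rand l (\<tau> l)" if l: "l \<in> {1..L}" for l
  proof -
    have "\<exists>\<tau>. rand l \<tau>"
    proof (rule kernel_randomization[OF G[OF l] polish[OF l] \<Phi> \<Phi>_cont[OF l]])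
      fix \<tau>' assume "(\<lambda>(a, w). \<tau>' a w) \<in> (\<Pi>\<^sub>M m\<in>{1..<l}. ?mb m) \<Otimes>\<^sub>M borel \<rightarrow>\<^sub>M ?mb l"
        "\<And>a. a \<in> space (\<Pi>\<^sub>M m\<in>{1..<l}. ?mb m) \<Longrightarrow> distr (\<Phi> l) (?mb l) (\<tau>' a) = G l a"
      then have "rand l \<tau>'" unfolding rand_def by blast
      then show "\<exists>\<tau>. rand l \<tau>" by blast
    qed
    from someI_ex[OF this] show ?thesis unfolding \<tau>_def .
  qed
  have \<tau>: "(\<lambda>(a, w). \<tau> m a w) \<in> (\<Pi>\<^sub>M k\<in>{1..<m}. ?mb k) \<Otimes>\<^sub>M borel \<rightarrow>\<^sub>M ?mb m"
    and \<tau>_distr: "\<And>a. a \<in> space (\<Pi>\<^sub>M k\<in>{1..<m}. ?mb k) \<Longrightarrow> distr (\<Phi> m) (?mb m) (\<tau> m a) = G m a"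
    if "m \<in> {1..L}" for m
    using rand[OF that] unfolding rand_def by blast+
  define \<Omega> where "\<Omega> = PiM {1..L} \<Phi>"
  interpret \<Omega>: prob_space \<Omega> unfolding \<Omega>_def by (rule prob_space_PiM) (rule \<Phi>.prob_space_axioms)
  define T where "T w = latent \<tau> L w" for w
  have coord: "(\<lambda>w. w l) \<in> borel_measurable \<Omega>" if "l \<in> {1..L}" for l
  proof -
    have "(\<lambda>w. w l) \<in> \<Omega> \<rightarrow>\<^sub>M \<Phi> l" unfolding \<Omega>_def using that by (rule measurable_component_singleton)
    then show ?thesis using measurable_cong_sets[OF refl \<Phi>.events_eq_borel] by blast
  qed
  have T: "T \<in> \<Omega> \<rightarrow>\<^sub>M (\<Pi>\<^sub>M l\<in>{1..L}. ?mb l)"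
    unfolding T_def[abs_def] by (rule measurable_latent[OF \<tau> coord])
  have T_E: "T w \<in> ?E" if "w \<in> space \<Omega>" for w
    using measurable_space[OF T that] by (simp add: space_PiM)
  \<comment> \<open>The space of effects is nonempty and \<open>T\<close> maps it into the product,
    so no factor space is empty.\<close>
  have ne: "mspace (\<Theta> l) \<noteq> {}" if "l \<in> {1..L}" for l
    using \<Omega>.not_empty T_E that by blast
  define s where "s l = (SOME s. dense_sequence (\<Theta> l) s)" for l
  have ds: "dense_sequence (\<Theta> l) (s l)" if "l \<in> {1..L}" for l
    unfolding s_def by (rule someI_ex[OF dense_sequence_exists[OF polish(2)[OF that] ne[OF that]]])
  have s: "s l k \<in> mspace (\<Theta> l)" if "l \<in> {1..L}" for l k
    using ds[OF that] by (auto simp: dense_sequence_def)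
  have s_dense: "\<exists>k. mdist (\<Theta> l) (s l k) z < e" if "l \<in> {1..L}" "z \<in> mspace (\<Theta> l)" "0 < e" for l z e
    using ds[OF that(1)] that(2,3) unfolding dense_sequence_def by blast
  \<comment> \<open>Countably many measurable sets that locate \<open>T w\<close> to any precision:
    preimages of balls around dense points, with level, radius and center coded in one index. Codes
    of other levels get the empty set.\<close>
  define B where "B m = (case prod_decode m of (l, q) \<Rightarrow> case prod_decode q of (n, k) \<Rightarrow>
      if l \<in> {1..L} then {w \<in> space \<Omega>. mdist (\<Theta> l) (s l k) (T w l) < (1/2) ^ n} else {})" for m
  have B_code: "w \<in> B (prod_encode (l, prod_encode (n, k))) \<longleftrightarrow>
      w \<in> space \<Omega> \<and> mdist (\<Theta> l) (s l k) (T w l) < (1/2) ^ n" if "l \<in> {1..L}" for w l n k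
    using that by (simp add: B_def)
  have B: "B m \<in> sets \<Omega>" for m
  proof -
    obtain l q where lq: "prod_decode m = (l, q)" by fastforce
    obtain n k where nk: "prod_decode q = (n, k)" by fastforce
    show ?thesis
    proof (cases "l \<in> {1..L}")
      case True
      have "(\<lambda>w. T w l) \<in> \<Omega> \<rightarrow>\<^sub>M ?mb l"
        using T by (rule measurable_compose[OF _ measurable_component_singleton[OF True]])
      from measurable_compose[OF this pred_mdist_metric_borel[OF s[OF True]]]
      have "{w \<in> space \<Omega>. mdist (\<Theta> l) (s l k) (T w l) < (1/2) ^ n} \<in> sets \<Omega>" by (simp add: pred_def)
      then show ?thesis using True by (simp add: B_def lq nk)
    next
      case False
      then show ?thesis by (auto simp: B_def lq nk)
    qed
  qed
  define h where "h x w = H x (T w)" for x w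
  have h: "prob_space (h x w) \<and> sets (h x w) = sets borel" if "x \<in> X" "w \<in> space \<Omega>" for x w
    unfolding h_def by (rule H[OF that(1) T_E[OF that(2)]])
  have H_meas: "(\<lambda>\<theta>. dist_fun (H x \<theta>) y) \<in> borel_measurable (\<Pi>\<^sub>M l\<in>{1..L}. ?mb l)" if "x \<in> X" for x y
    by (rule borel_measurable_continuous_map_product[OF _ polish(2) continuous_map_dist_fun_factors[OF par that]]) auto
  have h_meas: "(\<lambda>w. dist_fun (h x w) y) \<in> borel_measurable \<Omega>" if "x \<in> X" for x y
    unfolding h_def using measurable_compose[OF T H_meas[OF that]] .
  define close where "close \<epsilon> x y w \<rho> \<longleftrightarrow> (\<forall>y' x' v. dist y' y < \<rho> \<longrightarrow> x' \<in> X \<longrightarrow> dist x' x < \<rho> \<longrightarrow> v \<in> space \<Omega> \<longrightarrow>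
        (\<forall>l\<in>{1..L}. mdist (\<Theta> l) (T w l) (T v l) < \<rho>) \<longrightarrow> \<bar>dist_fun (h x' v) y' - dist_fun (h x w) y\<bar> < \<epsilon>)" for \<epsilon> x y w \<rho>
  have near: "\<exists>\<rho>>0. close \<epsilon> x y w \<rho>"
    if x: "x \<in> X" and w: "w \<in> space \<Omega>" and \<epsilon>: "0 < \<epsilon>" for x y w \<epsilon>
  proof (rule continuous_map_prod_product_nearby[OF _ H_cont x T_E[OF w] \<epsilon>, of y])
    fix \<rho> :: real assume \<rho>: "0 < \<rho>"
      and *: "\<And>y' x' \<theta>'. dist y' y < \<rho> \<Longrightarrow> x' \<in> X \<Longrightarrow> dist x' x < \<rho> \<Longrightarrow> \<theta>' \<in> ?E \<Longrightarrow>
        (\<And>l. l \<in> {1..L} \<Longrightarrow> mdist (\<Theta> l) (T w l) (\<theta>' l) < \<rho>) \<Longrightarrow>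
        \<bar>dist_fun (H x' \<theta>') y' - dist_fun (H x (T w)) y\<bar> < \<epsilon>"
    show ?thesis
      unfolding close_def
    proof (intro exI[of _ \<rho>] conjI \<rho> allI impI)
      fix y' x' v assume "dist y' y < \<rho>" "x' \<in> X" "dist x' x < \<rho>" and v: "v \<in> space \<Omega>"
        and "\<forall>l\<in>{1..L}. mdist (\<Theta> l) (T w l) (T v l) < \<rho>"
      then show "\<bar>dist_fun (h x' v) y' - dist_fun (h x w) y\<bar> < \<epsilon>"
        unfolding h_def by (intro * T_E[OF v]) auto
    qed
  qed simp
  have mdist_self: "mdist (\<Theta> l) (T w l) (T w l) = 0" if "l \<in> {1..L}" "w \<in> space \<Omega>" for l w
    using T_E[OF that(2)] that(1) by (simp add: PiE_iff)
  have h_cont: "continuous_on UNIV (dist_fun (h x w))" if x: "x \<in> X" and w: "w \<in> space \<Omega>" for x w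
    unfolding continuous_on_iff
  proof (intro ballI allI impI)
    fix y :: "real ^ 'k" and \<epsilon> :: real assume "0 < \<epsilon>"
    from near[OF x w this, of y] obtain \<rho> where \<rho>: "0 < \<rho>" and *: "close \<epsilon> x y w \<rho>" by blast
    have "dist (dist_fun (h x w) y') (dist_fun (h x w) y) < \<epsilon>" if "dist y' y < \<rho>" for y'
      using *[unfolded close_def, rule_format, OF that x _ w] mdist_self[OF _ w] \<rho> by (simp add: dist_real_def)
    then show "\<exists>d>0. \<forall>y'\<in>UNIV. dist y' y < d \<longrightarrow> dist (dist_fun (h x w) y') (dist_fun (h x w) y) < \<epsilon>"
      using \<rho> by (intro exI[of _ \<rho>]) simp
  qed
  have h_cont_x: "(\<lambda>i. dist_fun (h (\<xi> i) w) y) \<longlonglongrightarrow> dist_fun (h x w) y"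
    if w: "w \<in> space \<Omega>" and \<xi>: "\<And>i. \<xi> i \<in> X" and x: "x \<in> X" and lim: "\<xi> \<longlonglongrightarrow> x" for x w y \<xi>
  proof (rule LIMSEQ_I)
    fix \<epsilon> :: real assume "0 < \<epsilon>"
    from near[OF x w this, of y] obtain \<rho> where \<rho>: "0 < \<rho>" and *: "close \<epsilon> x y w \<rho>" by blast
    obtain i0 where i0: "\<And>i. i0 \<le> i \<Longrightarrow> dist (\<xi> i) x < \<rho>"
      using metric_LIMSEQ_D[OF lim \<rho>] by auto
    have "norm (dist_fun (h (\<xi> i) w) y - dist_fun (h x w) y) < \<epsilon>" if "i0 \<le> i" for i
      using *[unfolded close_def, rule_format, OF _ \<xi> i0[OF that] w, of y] mdist_self[OF _ w] \<rho> by simp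
    then show "\<exists>i0. \<forall>i\<ge>i0. norm (dist_fun (h (\<xi> i) w) y - dist_fun (h x w) y) < \<epsilon>" by blast
  qed
  have cont: "\<exists>M \<rho>. 0 < \<rho> \<and> (\<forall>y' x' v. dist y' y < \<rho> \<longrightarrow> x' \<in> X \<longrightarrow> dist x' x < \<rho> \<longrightarrow> v \<in> space \<Omega> \<longrightarrow>
        (\<forall>m<M. w \<in> B m \<longrightarrow> v \<in> B m) \<longrightarrow> \<bar>dist_fun (h x' v) y' - dist_fun (h x w) y\<bar> < \<epsilon>)"
    if x: "x \<in> X" and w: "w \<in> space \<Omega>" and \<epsilon>: "0 < \<epsilon>" for x y w \<epsilon>
  proof -
    from near[OF x w \<epsilon>, of y] obtain \<rho> where \<rho>: "0 < \<rho>" and *: "close \<epsilon> x y w \<rho>" by blast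
    \<comment> \<open>\<open>T w\<close> and \<open>T v\<close> will lie in a common ball of radius
      \<open>(1/2) ^ n\<close>, so their distance is below twice this radius.\<close>
    obtain n where n: "(1/2::real) ^ n < \<rho>/2" using real_arch_pow_inv[of "\<rho>/2" "1/2"] \<rho> by auto
    have Tm: "T v l \<in> mspace (\<Theta> l)" if "l \<in> {1..L}" "v \<in> space \<Omega>" for l v
      using T_E[OF that(2)] that(1) by (rule PiE_mem)
    define k where "k l = (SOME k. mdist (\<Theta> l) (s l k) (T w l) < (1/2) ^ n)" for l
    have k: "mdist (\<Theta> l) (s l (k l)) (T w l) < (1/2) ^ n" if l: "l \<in> {1..L}" for l
    proof -
      have "(0::real) < (1/2) ^ n" by simp
      from someI_ex[OF s_dense[OF l Tm[OF l w] this]] show ?thesis unfolding k_def .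
    qed
    define code where "code l = prod_encode (l, prod_encode (n, k l))" for l
    \<comment> \<open>The sum of the codes is an upper bound for each of them, so agreement on the
      first \<open>M\<close> sets includes the chosen ball of every level.\<close>
    define M where "M = Suc (\<Sum>l\<in>{1..L}. code l)"
    have M: "code l < M" if "l \<in> {1..L}" for l
      unfolding M_def using member_le_sum[OF that, of code] by (simp add: le_imp_less_Suc)
    show ?thesis
    proof (intro exI[of _ M] exI[of _ \<rho>] conjI \<rho> allI impI)
      fix y' x' v assume yx: "dist y' y < \<rho>" "x' \<in> X" "dist x' x < \<rho>" and v: "v \<in> space \<Omega>"
        and bits: "\<forall>m<M. w \<in> B m \<longrightarrow> v \<in> B m"
      have "mdist (\<Theta> l) (T w l) (T v l) < \<rho>" if l: "l \<in> {1..L}" for l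
      proof -
        interpret Metric_space "mspace (\<Theta> l)" "mdist (\<Theta> l)" by (rule Metric_space_mspace_mdist)
        have "w \<in> B (code l)" using k[OF l] w unfolding code_def B_code[OF l] by blast
        then have "v \<in> B (code l)" using bits M[OF l] by blast
        then have "mdist (\<Theta> l) (s l (k l)) (T v l) < (1/2) ^ n" unfolding code_def B_code[OF l] by blast
        moreover have "mdist (\<Theta> l) (T w l) (T v l) \<le> mdist (\<Theta> l) (s l (k l)) (T w l) + mdist (\<Theta> l) (s l (k l)) (T v l)"
          using triangle[OF Tm[OF l w] s[OF l] Tm[OF l v]] by (simp only: commute[of "T w l"])
        ultimately show ?thesis using k[OF l] n by linarith
      qed
      then show "\<bar>dist_fun (h x' v) y' - dist_fun (h x w) y\<bar> < \<epsilon>"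
        using *[unfolded close_def, rule_format, OF yx v] by blast
    qed
  qed
  have "\<exists>F. (\<forall>n::nat. F n \<in> mmoe_dist_funs L F\<^sub>0 \<Psi>\<^sub>0) \<and>
    (AE w in \<Omega>. \<forall>x\<in>X. \<forall>y. \<forall>\<epsilon>>0. \<exists>N \<delta>. 0 < \<delta> \<and>
      (\<forall>n\<ge>N. \<forall>x'\<in>X. dist x' x < \<delta> \<longrightarrow> \<bar>F n y x' w - dist_fun (h x w) y\<bar> < \<epsilon>))"
    unfolding \<Omega>_def
    by (rule mmoe_local_approximation[where B = B], unfold \<Omega>_def[symmetric])
       (fact F0 dense \<Phi> B h cont)+
  then obtain F where F: "\<And>n::nat. F n \<in> mmoe_dist_funs L F\<^sub>0 \<Psi>\<^sub>0"
    and approx: "AE w in \<Omega>. \<forall>x\<in>X. \<forall>y. \<forall>\<epsilon>>0. \<exists>N \<delta>. 0 < \<delta> \<and>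
      (\<forall>n\<ge>N. \<forall>x'\<in>X. dist x' x < \<delta> \<longrightarrow> \<bar>F n y x' w - dist_fun (h x w) y\<bar> < \<epsilon>)"
    by blast
  have F01: "0 \<le> F n y x w" "F n y x w \<le> 1" for n y x w using mmoe_bounds[OF F F0] by auto
  have F_meas: "(\<lambda>w. F n y x w) \<in> borel_measurable \<Omega>" for n y x
    by (rule measurable_mmoe[OF F coord])
  have "uniform_limit {(y, x). \<forall>i\<in>observations N L. x i \<in> X'}
       (\<lambda>n (y, x). mmoe_joint L \<Phi> (F n) N y x) (\<lambda>(y, x). gen_joint L \<Theta> G H N y x) sequentially"
    if X': "compact X'" "X' \<subseteq> X" for N X'
  proof (rule uniform_limitI)
    fix \<epsilon> :: real assume \<epsilon>: "0 < \<epsilon>"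
    let ?I = "observations N L"
    define P where "P = (\<Pi>\<^sub>M i\<in>units_upto N L. \<Phi> (length i))"
    interpret P: prob_space P unfolding P_def by (rule prob_space_PiM) (rule \<Phi>.prob_space_axioms)
    \<comment> \<open>The summand 1 keeps the denominator positive for a design without observations
      and makes the total error strictly smaller than \<epsilon>.\<close>
    define e where "e = \<epsilon> / (real (card ?I) + 1)"
    have e: "0 < e" "real (card ?I) * e < \<epsilon>" using \<epsilon> by (auto simp: e_def field_simps)
    have "\<exists>N. \<forall>n\<ge>N. \<forall>y. \<forall>x\<in>X'. (\<integral>w. \<bar>F n y x w - dist_fun (h x w) y\<bar> \<partial>\<Omega>) < e"
      unfolding \<Omega>_def
      by (rule mmoe_integrated_approximation[where X = X and F\<^sub>0 = F\<^sub>0 and \<Psi>\<^sub>0 = \<Psi>\<^sub>0], unfold \<Omega>_def[symmetric])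
         (fact F0 \<Phi> h h_meas h_cont h_cont_x F approx X' e(1))+
    then obtain n0 where n0: "\<And>n y x. n0 \<le> n \<Longrightarrow> x \<in> X' \<Longrightarrow> (\<integral>w. \<bar>F n y x w - dist_fun (h x w) y\<bar> \<partial>\<Omega>) < e"
      by blast
    have lf: "latent_field \<tau> N L \<in> P \<rightarrow>\<^sub>M factor_space \<Theta> (units_upto N L)"
      unfolding P_def by (rule measurable_latent_field[OF \<tau>]) auto
    have fl: "factor_law \<Theta> G N L = distr P (factor_space \<Theta> (units_upto N L)) (latent_field \<tau> N L)"
      unfolding P_def by (rule factor_law_eq_distr[OF \<tau> \<tau>_distr \<Phi>])
    have anc: "(\<lambda>w. ancestors w i) \<in> P \<rightarrow>\<^sub>M \<Omega>" if "i \<in> ?I" for i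
      using measurable_ancestors[OF that, of \<Phi>] unfolding P_def \<Omega>_def atLeastLessThanSuc_atLeastAtMost .
    have anc_distr: "distr P \<Omega> (\<lambda>w. ancestors w i) = \<Omega>" if "i \<in> ?I" for i
      using distr_ancestors[OF that, of \<Phi>] \<Phi>.prob_space_axioms unfolding P_def \<Omega>_def by blast
    have main: "\<bar>mmoe_joint L \<Phi> (F n) N y x - gen_joint L \<Theta> G H N y x\<bar> < \<epsilon>"
      if n: "n0 \<le> n" and x: "\<forall>i\<in>?I. x i \<in> X'" for n y x
    proof -
      have xX: "x i \<in> X" if "i \<in> ?I" for i using x X'(2) that by blast
      let ?pF = "\<lambda>w. \<Prod>i\<in>?I. F n (y i) (x i) (ancestors w i)"
      let ?ph = "\<lambda>w. \<Prod>i\<in>?I. dist_fun (h (x i) (ancestors w i)) (y i)"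
      have "gen_joint L \<Theta> G H N y x
          = (\<integral>w. (\<Prod>i\<in>?I. dist_fun (H (x i) (ancestors (latent_field \<tau> N L w) i)) (y i)) \<partial>P)"
        unfolding gen_joint_def fl
      proof (rule integral_distr[OF lf])
        show "(\<lambda>\<theta>. \<Prod>i\<in>?I. dist_fun (H (x i) (ancestors \<theta> i)) (y i))
            \<in> borel_measurable (factor_space \<Theta> (units_upto N L))"
        proof (rule borel_measurable_prod)
          fix i assume i: "i \<in> ?I"
          have "(\<lambda>\<theta>. ancestors \<theta> i) \<in> factor_space \<Theta> (units_upto N L) \<rightarrow>\<^sub>M (\<Pi>\<^sub>M l\<in>{1..L}. ?mb l)"
            using measurable_ancestors[OF i, of ?mb] unfolding factor_space_def atLeastLessThanSuc_atLeastAtMost .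
          from measurable_compose[OF this H_meas[OF xX[OF i]]]
          show "(\<lambda>\<theta>. dist_fun (H (x i) (ancestors \<theta> i)) (y i)) \<in> borel_measurable (factor_space \<Theta> (units_upto N L))" .
        qed
      qed
      also have "\<dots> = (\<integral>w. ?ph w \<partial>P)"
      proof (intro Bochner_Integration.integral_cong prod.cong refl)
        fix w i assume i: "i \<in> ?I"
        have "T (ancestors w i) = latent \<tau> L (\<lambda>m. w (take m i))"
          unfolding T_def by (rule latent_cong) (auto simp: ancestors_def length_units[OF i])
        then show "dist_fun (H (x i) (ancestors (latent_field \<tau> N L w) i)) (y i) = dist_fun (h (x i) (ancestors w i)) (y i)"
          unfolding h_def ancestors_latent_field[OF i] by simp
      qed
      finally have gen: "gen_joint L \<Theta> G H N y x = \<dots>" .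
      have mmoe: "mmoe_joint L \<Phi> (F n) N y x = (\<integral>w. ?pF w \<partial>P)"
        unfolding mmoe_joint_def P_def ..
      have hm: "(\<lambda>w. dist_fun (h (x i) (ancestors w i)) (y i)) \<in> borel_measurable P" if "i \<in> ?I" for i
        by (rule measurable_compose[OF anc[OF that] h_meas[OF xX[OF that]]])
      have Fm: "(\<lambda>w. F n (y i) (x i) (ancestors w i)) \<in> borel_measurable P" if "i \<in> ?I" for i
        by (rule measurable_compose[OF anc[OF that] F_meas])
      have h01: "0 \<le> dist_fun (h (x i) (ancestors w i)) (y i)" "dist_fun (h (x i) (ancestors w i)) (y i) \<le> 1"
        if "i \<in> ?I" "w \<in> space P" for i w
        using h[OF xX[OF that(1)] measurable_space[OF anc[OF that(1)] that(2)]]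
        by (auto simp: dist_fun_def intro!: prob_space.prob_le_1)
      define d where "d i w = \<bar>F n (y i) (x i) (ancestors w i) - dist_fun (h (x i) (ancestors w i)) (y i)\<bar>" for i w
      have d_int: "integrable P (d i)" if i: "i \<in> ?I" for i
      proof (rule P.integrable_const_bound[of _ 1])
        show "AE w in P. norm (d i w) \<le> 1"
          using AE_space
        proof eventually_elim
          case (elim w)
          show ?case using h01[OF i elim] F01[of n "y i" "x i" "ancestors w i"] by (simp add: d_def abs_le_iff)
        qed
        show "d i \<in> borel_measurable P"
          unfolding d_def[abs_def] by (intro borel_measurable_abs borel_measurable_diff Fm[OF i] hm[OF i])
      qed
      have intF: "integrable P ?pF"
        by (rule P.integrable_const_bound[of _ 1])
           (use F01 Fm in \<open>auto intro!: borel_measurable_prod prod_le_1 simp: abs_prod\<close>)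
      have inth: "integrable P ?ph"
      proof (rule P.integrable_const_bound[of _ 1])
        show "AE w in P. norm (?ph w) \<le> 1"
          using AE_space by eventually_elim (use h01 in \<open>auto intro!: prod_le_1 simp: abs_prod\<close>)
      qed (intro borel_measurable_prod hm)
      have "\<bar>mmoe_joint L \<Phi> (F n) N y x - gen_joint L \<Theta> G H N y x\<bar>
          = \<bar>\<integral>w. ?pF w - ?ph w \<partial>P\<bar>"
        unfolding mmoe gen by (subst Bochner_Integration.integral_diff[OF intF inth]) (rule refl)
      also have "\<dots> \<le> (\<integral>w. \<bar>?pF w - ?ph w\<bar> \<partial>P)"
        by (rule integral_abs_bound)
      also have "\<dots> \<le> (\<integral>w. (\<Sum>i\<in>?I. d i w) \<partial>P)"
      proof (rule integral_mono)
        show "integrable P (\<lambda>w. \<bar>?pF w - ?ph w\<bar>)"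
          by (intro integrable_abs Bochner_Integration.integrable_diff intF inth)
        show "integrable P (\<lambda>w. \<Sum>i\<in>?I. d i w)" by (intro Bochner_Integration.integrable_sum d_int)
        fix w assume w: "w \<in> space P"
        have "norm (?pF w - ?ph w)
            \<le> (\<Sum>i\<in>?I. norm (F n (y i) (x i) (ancestors w i) - dist_fun (h (x i) (ancestors w i)) (y i)))"
          using F01 h01[OF _ w] by (intro norm_prod_diff) auto
        then show "\<bar>?pF w - ?ph w\<bar>
            \<le> (\<Sum>i\<in>?I. d i w)" by (simp add: d_def)
      qed
      also have "\<dots> = (\<Sum>i\<in>?I. \<integral>w. d i w \<partial>P)" by (rule Bochner_Integration.integral_sum[OF d_int])
      also have "\<dots> \<le> (\<Sum>i\<in>?I. e)"
      proof (rule sum_mono)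
        fix i assume i: "i \<in> ?I"
        \<comment> \<open>The effects above \<open>i\<close> have the law \<Omega>, so the error at
          this observation is the one-branch error, already below \<open>e\<close>.\<close>
        have "(\<integral>w. d i w \<partial>P) = (\<integral>w. \<bar>F n (y i) (x i) w - dist_fun (h (x i) w) (y i)\<bar> \<partial>distr P \<Omega> (\<lambda>w. ancestors w i))"
          unfolding d_def
          by (rule integral_distr[OF anc[OF i], symmetric])
             (intro borel_measurable_abs borel_measurable_diff F_meas h_meas xX[OF i])
        also have "\<dots> < e" unfolding anc_distr[OF i] using n0[OF n] x i by blast
        finally show "(\<integral>w. d i w \<partial>P) \<le> e" by simp
      qed
      also have "\<dots> < \<epsilon>" using e(2) by simp
      finally show ?thesis .
    qed
    show "\<forall>\<^sub>F n in sequentially. \<forall>z\<in>{(y, x). \<forall>i\<in>?I. x i \<in> X'}.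
        dist (case z of (y, x) \<Rightarrow> mmoe_joint L \<Phi> (F n) N y x) (case z of (y, x) \<Rightarrow> gen_joint L \<Theta> G H N y x) < \<epsilon>"
      using eventually_ge_at_top[of n0] by eventually_elim (auto simp: dist_real_def intro: main)
  qed
  with F show ?thesis by blast
qed

theorem theorem2:
  fixes L :: nat
    and X :: "(real ^ 'p) set"
    and F\<^sub>0 :: "'s \<Rightarrow> (real ^ 'k) measure"
    and \<Psi>\<^sub>0 :: "'s set"
    and \<Phi> :: "nat \<Rightarrow> real measure"
  assumes "L \<ge> 1"
    and "\<And>\<psi>. \<psi> \<in> \<Psi>\<^sub>0 \<Longrightarrow> prob_space (F\<^sub>0 \<psi>) \<and> sets (F\<^sub>0 \<psi>) = sets borel"
    and "\<And>q. \<exists>\<psi> :: nat \<Rightarrow> 's. (\<forall>n. \<psi> n \<in> \<Psi>\<^sub>0) \<and>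
               converges_weakly (\<lambda>n. F\<^sub>0 (\<psi> n)) (return borel q)"
    and "\<And>l. l \<in> {1..L} \<Longrightarrow> real_distribution (\<Phi> l)"
    and "\<And>l. l \<in> {1..L} \<Longrightarrow> continuous_on UNIV (cdf (\<Phi> l))"
  shows "compactly_dense L X (mmoe_models L F\<^sub>0 \<Psi>\<^sub>0 \<Phi>) (gen_models TYPE('a) L X)"
  unfolding compactly_dense_def
proof
  \<comment> \<open>The lemmas ask for a distribution at every index; point masses fill the indices
    outside \<open>{1..L}\<close>, which no unit has as its level.\<close>
  define \<Phi>' where "\<Phi>' l = (if l \<in> {1..L} then \<Phi> l else return borel 0)" for l
  have "real_distribution (return borel 0)"
    by (simp add: real_distribution_def real_distribution_axioms_def prob_space_return)
  then have \<Phi>': "real_distribution (\<Phi>' l)" for l using assms(4) by (simp add: \<Phi>'_def)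
  have \<Phi>'_cont: "continuous_on UNIV (cdf (\<Phi>' l))" if "l \<in> {1..L}" for l
    using assms(5)[OF that] that by (simp add: \<Phi>'_def)
  have "(\<Pi>\<^sub>M i\<in>units_upto N L. \<Phi> (length i)) = (\<Pi>\<^sub>M i\<in>units_upto N L. \<Phi>' (length i))" for N
    by (intro PiM_cong refl) (use length_units_upto in \<open>simp add: \<Phi>'_def\<close>)
  then have joint: "mmoe_joint L \<Phi> F = mmoe_joint L \<Phi>' F"
    for F :: "real ^ 'k \<Rightarrow> real ^ 'p \<Rightarrow> (nat \<Rightarrow> real) \<Rightarrow> real"
    by (intro ext) (simp add: mmoe_joint_def)
  fix m :: "('k, 'p) nested_model" assume "m \<in> gen_models TYPE('a) L X"
  then obtain \<Theta> :: "nat \<Rightarrow> 'a metric" and G H where m: "m = gen_joint L \<Theta> G H" and par: "gen_params L X \<Theta> G H"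
    unfolding gen_models_def by blast
  have "\<exists>F. (\<forall>n::nat. F n \<in> mmoe_dist_funs L F\<^sub>0 \<Psi>\<^sub>0) \<and>
    (\<forall>N X'. compact X' \<and> X' \<subseteq> X \<longrightarrow>
       uniform_limit {(y, x). \<forall>i\<in>observations N L. x i \<in> X'}
         (\<lambda>n (y, x). mmoe_joint L \<Phi>' (F n) N y x) (\<lambda>(y, x). gen_joint L \<Theta> G H N y x) sequentially)"
    by (rule mmoe_approximates_gen_joint[OF assms(2,3) \<Phi>' \<Phi>'_cont par])
  then obtain F where F: "\<forall>n::nat. F n \<in> mmoe_dist_funs L F\<^sub>0 \<Psi>\<^sub>0"
    and lim: "\<forall>N X'. compact X' \<and> X' \<subseteq> X \<longrightarrow>
       uniform_limit {(y, x). \<forall>i\<in>observations N L. x i \<in> X'}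
         (\<lambda>n (y, x). mmoe_joint L \<Phi>' (F n) N y x) (\<lambda>(y, x). gen_joint L \<Theta> G H N y x) sequentially"
    by (elim exE conjE)
  show "\<exists>s. (\<forall>n::nat. s n \<in> mmoe_models L F\<^sub>0 \<Psi>\<^sub>0 \<Phi>) \<and>
        (\<forall>N X'. hierarchical_design L N \<and> compact X' \<and> X' \<subseteq> X \<longrightarrow>
           uniform_limit {(y, x). \<forall>i\<in>observations N L. x i \<in> X'}
             (\<lambda>n (y, x). s n N y x) (\<lambda>(y, x). m N y x) sequentially)"
  proof (intro exI[of _ "\<lambda>n. mmoe_joint L \<Phi> (F n)"] conjI allI impI)
    show "mmoe_joint L \<Phi> (F n) \<in> mmoe_models L F\<^sub>0 \<Psi>\<^sub>0 \<Phi>" for n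
      unfolding mmoe_models_def using F by (intro imageI) (rule spec)
    show "uniform_limit {(y, x). \<forall>i\<in>observations N L. x i \<in> X'}
             (\<lambda>n (y, x). mmoe_joint L \<Phi> (F n) N y x) (\<lambda>(y, x). m N y x) sequentially"
      if "hierarchical_design L N \<and> compact X' \<and> X' \<subseteq> X" for N X'
      unfolding m joint using lim that by blast
  qed
qed

end
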